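(* Let $0<\rho\le1$ and let $a\in S^0_{\rho,0}(n,2)$ be such that for every multi-index $\alpha\in\mathbb{Z}_+^n$ \[ \sup_{x_0,\zeta\in\mathbb{R}^n}\Big(\int_{B_1(x_0)}\int_{\mathbb{R}^n}|\partial_x^\alpha a(x,\zeta-\eta,\eta)|^2\,d\eta\,dx\Big)^{1/2}<\infty, \] where $B_1(x_0)$ is the unit ball centred at $x_0$. Then $T_a$ is bounded from $L^p(\mathbb{R}^n)\times L^q(\mathbb{R}^n)$ to $L^r(\mathbb{R}^n)$ for all $p,q\in[2,\infty]$ and $r\in[1,2]$ with $1/p+1/q=1/r$.
   Context: A symbol $a:\mathbb{R}^n\times\mathbb{R}^n\times\mathbb{R}^n\to\mathbb{C}$ belongs to $S^m_{\rho,\delta}(n,2)$ if for all multi-indices $\alpha,\beta,\gamma\in\mathbb{Z}_+^n$ there is $C_{\alpha,\beta,\gamma}$ with $|\partial_\xi^\alpha\partial_\eta^\beta\partial_x^\gamma a(x,\xi,\eta)|\le C_{\alpha,\beta,\gamma}(1+|\xi|^2+|\eta|^2)^{(m-\rho(|\alpha|+|\beta|)+\delta|\gamma|)/2}$. The bilinear operator is $T_a(f,g)(x)=\int\int a(x,\xi,\eta)\widehat f(\xi)\widehat g(\eta)e^{ix\cdot(\xi+\eta)}d\xi\,d\eta$ for Schwartz $f,g$, with $\widehat f(\xi)=\int f(y)e^{-iy\cdot\xi}dy$; boundedness means $\|T_a(f,g)\|_{L^r}\le C\|f\|_{L^p}\|g\|_{L^q}$ for Schwartz $f,g$. *)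

theory Defs
  imports "HOL-Probability.Probability"
begin

fun iter_deriv :: "'a::real_normed_vector list \<Rightarrow> ('a \<Rightarrow> complex) \<Rightarrow> 'a \<Rightarrow> complex" where
  "iter_deriv [] f = f"
| "iter_deriv (d # ds) f = (\<lambda>v. frechet_derivative (iter_deriv ds f) (at v) d)"

definition smooth_fun :: "('a::real_normed_vector \<Rightarrow> complex) \<Rightarrow> bool" where
  "smooth_fun f \<longleftrightarrow> (\<forall>ds v. iter_deriv ds f differentiable (at v))"

type_synonym 'n triple = "(real^'n) \<times> (real^'n) \<times> (real^'n)"

definition uncurry3 :: "(real^'n \<Rightarrow> real^'n \<Rightarrow> real^'n \<Rightarrow> complex) \<Rightarrow> 'n triple \<Rightarrow> complex" where
  "uncurry3 a = (\<lambda>(x, \<xi>, \<eta>). a x \<xi> \<eta>)"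

text \<open>Number of x-directions (gamma) in a list of coordinate directions of R^(3n);
  the remaining ones are xi- or eta-directions (|alpha|+|beta|).\<close>
definition n_x :: "('n::finite) triple list \<Rightarrow> nat" where
  "n_x ds = length (filter (\<lambda>d. fst d \<noteq> 0) ds)"

definition n_xieta :: "('n::finite) triple list \<Rightarrow> nat" where
  "n_xieta ds = length (filter (\<lambda>d. fst d = 0) ds)"

definition bisymbol :: "real \<Rightarrow> real \<Rightarrow> real \<Rightarrow> (real^'n::finite \<Rightarrow> real^'n \<Rightarrow> real^'n \<Rightarrow> complex) \<Rightarrow> bool" where
  "bisymbol m \<rho> \<delta> a \<longleftrightarrow> smooth_fun (uncurry3 a) \<and>
     (\<forall>ds \<in> lists Basis. \<exists>C. \<forall>x \<xi> \<eta>.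
        norm (iter_deriv ds (uncurry3 a) (x, \<xi>, \<eta>))
          \<le> C * (1 + norm \<xi> ^ 2 + norm \<eta> ^ 2)
                 powr ((m - \<rho> * real (n_xieta ds) + \<delta> * real (n_x ds)) / 2))"

definition schwartz :: "(real^'n::finite \<Rightarrow> complex) \<Rightarrow> bool" where
  "schwartz f \<longleftrightarrow> smooth_fun f \<and>
     (\<forall>ds \<in> lists Basis. \<forall>k::nat. \<exists>C. \<forall>x. (1 + norm x) ^ k * norm (iter_deriv ds f x) \<le> C)"

definition fourier :: "(real^'n::finite \<Rightarrow> complex) \<Rightarrow> real^'n \<Rightarrow> complex" where
  "fourier f \<xi> = (\<integral>y. f y * cis (- (y \<bullet> \<xi>)) \<partial>lborel)"

definition bilinear_op :: "(real^'n::finite \<Rightarrow> real^'n \<Rightarrow> real^'n \<Rightarrow> complex)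
    \<Rightarrow> (real^'n \<Rightarrow> complex) \<Rightarrow> (real^'n \<Rightarrow> complex) \<Rightarrow> real^'n \<Rightarrow> complex" where
  "bilinear_op a f g x =
     (\<integral>\<eta>. (\<integral>\<xi>. a x \<xi> \<eta> * fourier f \<xi> * fourier g \<eta> * cis (x \<bullet> (\<xi> + \<eta>)) \<partial>lborel) \<partial>lborel)"

definition Lp_norm :: "ereal \<Rightarrow> (real^'n::finite \<Rightarrow> complex) \<Rightarrow> ennreal" where
  "Lp_norm p h =
     (if p = \<infinity> then esssup lborel (\<lambda>x. ennreal (norm (h x)))
      else (let I = (\<integral>\<^sup>+x. ennreal (norm (h x) powr real_of_ereal p) \<partial>lborel)
            in if I = \<infinity> then \<infinity> else ennreal (enn2real I powr (1 / real_of_ereal p))))"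

end

(*
Let F = f (x) g, and freeze the space variable of the symbol at z: T_b F (X) is the integral of
b(v) F^(v) e^{iX.v} over v in R^n x R^n, with b = a(z, .), and T_a(f, g)(x) is its value at z = x, X = (x, x).

(1) For fixed z, x |-> T_b F (x, x) is the inverse Fourier transform of the integral over eta of
(b F^)(zeta - eta, eta). By Bessel's inequality and Cauchy-Schwarz, the L^2 norm of T_b F (x, x) over x in R^n and
z in a unit ball is controlled by the hypothesis times the L^2 norms of f and g.
(2) Because rho > 0, derivatives of a of high order in (xi, eta) satisfy the L^2 hypothesis trivially. It is
invariant under translations in (xi, eta), so a one-dimensional Landau inequality carries it over to all
derivatives of intermediate order.
(3) The weights 1 + i(y - x0).b can be put on f and g at the cost of frequency derivatives of the symbol. By a Sobolev
inequality in z on small cubes, the integral of |T_a(f, g)|^2 over B(x0, 1/2) is then at most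
C (|f|^2 * W)(x0) (|g|^2 * W)(x0) with an integrable weight W.
(4) Integrating over x0 and applying Hoelder's inequality gives all the exponents at once, without interpolation.
*)

theory Submission
  imports Defs
begin

section \<open>Integration lemmas\<close>

text \<open>The obstacle is the diagonal z = x: there symbol and phase vary together and Bessel's
  inequality does not apply. Freezing z separates them; the way back costs up to n derivatives in
  the space variable, one per coordinate. Since delta = 0 these leave the decay in frequency
  untouched, and the hypothesis covers all of them. The weights, one per coordinate and function,
  produce up to 2n frequency derivatives, on which the hypothesis is silent. Decay alone settles
  order k only if \<rho> k >= n, so the orders below must be interpolated. Uniformity in zeta is
  essential for this: moving along a frequency direction leads from one slice to another. On balls
  of fixed radius, however, L^2 dominates L^r for r <= 2, and the integrable W controls the
  interaction between distant balls; L^p and L^q enter only when the local bounds are integrated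
  over x0.\<close>

lemma norm_integral_le_nn_integral:
  fixes f :: "'a \<Rightarrow> 'b::{banach,second_countable_topology}"
  shows "ennreal (norm (integral\<^sup>L M f)) \<le> (\<integral>\<^sup>+x. ennreal (norm (f x)) \<partial>M)"
proof (cases "integrable M f")
  case True
  then show ?thesis by (rule integral_norm_bound_ennreal)
next
  \<comment> \<open>A non-integrable function has Bochner integral 0, so the bound holds without an
    integrability assumption.\<close>
  case False
  then show ?thesis by (simp add: not_integrable_integral_eq)
qed

lemma integrable_lborel_prod:
  fixes f :: "'a::euclidean_space \<Rightarrow> real \<Rightarrow> complex"
  assumes "\<And>b. b \<in> Basis \<Longrightarrow> integrable lborel (f b)"
  shows "integrable lborel (\<lambda>x::'a. \<Prod>b\<in>Basis. f b (x \<bullet> b))"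
    and "(\<integral>x. (\<Prod>b\<in>Basis. f b (x \<bullet> b)) \<partial>lborel) = (\<Prod>b\<in>Basis. \<integral>t. f b t \<partial>lborel)"
proof -
  interpret product_sigma_finite "\<lambda>b::'a. lborel :: real measure"
    by standard
  have [measurable]: "f b \<in> borel_measurable borel" if "b \<in> Basis" for b
    using assms[OF that] by (simp add: integrable_iff_bounded)
  have eq: "(\<Prod>b\<in>Basis. f b ((\<Sum>c\<in>Basis. x c *\<^sub>R c) \<bullet> b)) = (\<Prod>b\<in>Basis. f b (x b))" for x :: "'a \<Rightarrow> real"
    by (intro prod.cong refl) simp
  show "integrable lborel (\<lambda>x::'a. \<Prod>b\<in>Basis. f b (x \<bullet> b))"
    unfolding lborel_eq[where 'a='a]
    apply (subst integrable_distr_eq)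
      apply measurable
    apply (subst eq)
    using product_integrable_prod[of Basis f] assms by simp
  show "(\<integral>x. (\<Prod>b\<in>Basis. f b (x \<bullet> b)) \<partial>lborel) = (\<Prod>b\<in>Basis. \<integral>t. f b t \<partial>lborel)"
    unfolding lborel_eq[where 'a='a]
    apply (subst integral_distr)
      apply measurable
    apply (subst eq)
    using product_integral_prod[of Basis f] assms by simp
qed

lemma integrable_pair_bounded_kernel:
  fixes f :: "'a::euclidean_space \<Rightarrow> complex" and g :: "'b::euclidean_space \<Rightarrow> complex"
  assumes f: "integrable lborel f" and g: "integrable lborel g"
    and K: "K \<in> borel_measurable (lborel \<Otimes>\<^sub>M lborel)" and C: "\<And>z. norm (K z) \<le> C"
  shows "integrable (lborel \<Otimes>\<^sub>M lborel) (\<lambda>(x, y). f x * g y * K (x, y))"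
proof -
  note [measurable] = borel_measurable_integrable[OF f] borel_measurable_integrable[OF g] K
  have "integrable (lborel \<Otimes>\<^sub>M lborel) (\<lambda>(x, y). f x * g y)"
  proof (rule lborel_pair.Fubini_integrable)
    show "integrable lborel (\<lambda>x. \<integral>y. norm (case (x, y) of (x, y) \<Rightarrow> f x * g y) \<partial>lborel)"
      using f by (simp add: norm_mult)
    show "AE x in lborel. integrable lborel (\<lambda>y. case (x, y) of (x, y) \<Rightarrow> f x * g y)"
      using g by simp
  qed measurable
  then have "integrable (lborel \<Otimes>\<^sub>M lborel) (\<lambda>z. C *\<^sub>R (case z of (x, y) \<Rightarrow> f x * g y))"
    by (rule integrable_scaleR_right)
  then show ?thesis
  proof (rule Bochner_Integration.integrable_bound)
    show "AE z in lborel \<Otimes>\<^sub>M lborel. norm (case z of (x, y) \<Rightarrow> f x * g y * K (x, y))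
        \<le> norm (C *\<^sub>R (case z of (x, y) \<Rightarrow> f x * g y))"
    proof (rule AE_I2)
      fix z :: "'a \<times> 'b"
      have "norm (K z) \<le> \<bar>C\<bar>" using C[of z] by linarith
      from mult_left_mono[OF this, of "norm (f (fst z) * g (snd z))"]
      show "norm (case z of (x, y) \<Rightarrow> f x * g y * K (x, y))
        \<le> norm (C *\<^sub>R (case z of (x, y) \<Rightarrow> f x * g y))"
        by (simp add: split_beta norm_mult mult.commute)
    qed
  qed measurable
qed

text \<open>Each factor is integrable in its own variable and the kernel is merely bounded;
  exponentials and derivatives of the symbol occur as kernels in this way.\<close>

lemma fubini_bounded_kernel:
  fixes f :: "'a::euclidean_space \<Rightarrow> complex" and g :: "'b::euclidean_space \<Rightarrow> complex"
  assumes f: "integrable lborel f" and g: "integrable lborel g"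
    and K: "(\<lambda>(x, y). K x y) \<in> borel_measurable (lborel \<Otimes>\<^sub>M lborel)" and C: "\<And>x y. norm (K x y) \<le> C"
  shows "(\<integral>x. f x * (\<integral>y. g y * K x y \<partial>lborel) \<partial>lborel) = (\<integral>y. g y * (\<integral>x. f x * K x y \<partial>lborel) \<partial>lborel)"
proof -
  have "integrable (lborel \<Otimes>\<^sub>M lborel) (\<lambda>(x, y). f x * g y * K x y)"
    using integrable_pair_bounded_kernel[OF f g K, of C] C by (simp add: split_beta)
  from lborel_pair.Fubini_integral[OF this]
  have "(\<integral>y. \<integral>x. f x * g y * K x y \<partial>lborel \<partial>lborel) = (\<integral>x. \<integral>y. f x * g y * K x y \<partial>lborel \<partial>lborel)" .
  moreover have "(\<integral>x. f x * g y * K x y \<partial>lborel) = g y * (\<integral>x. f x * K x y \<partial>lborel)" for y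
    by (subst integral_mult_right_zero[symmetric]) (simp add: mult_ac)
  moreover have "(\<integral>y. f x * g y * K x y \<partial>lborel) = f x * (\<integral>y. g y * K x y \<partial>lborel)" for x
    by (subst integral_mult_right_zero[symmetric]) (simp add: mult_ac)
  ultimately show ?thesis by simp
qed

lemma integrable_mult_bounded:
  fixes f K :: "'a \<Rightarrow> complex"
  assumes "integrable M f" "K \<in> borel_measurable M" "\<And>x. norm (K x) \<le> C"
  shows "integrable M (\<lambda>x. f x * K x)"
proof (rule Bochner_Integration.integrable_bound[OF integrable_scaleR_right[OF assms(1), of C]])
  show "(\<lambda>x. f x * K x) \<in> borel_measurable M" using assms by measurable
  show "AE x in M. norm (f x * K x) \<le> norm (C *\<^sub>R f x)"
  proof (rule AE_I2)
    fix x
    have "norm (K x) \<le> \<bar>C\<bar>" using assms(3)[of x] by linarith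
    from mult_left_mono[OF this, of "norm (f x)"]
    show "norm (f x * K x) \<le> norm (C *\<^sub>R f x)" by (simp add: norm_mult mult.commute)
  qed
qed

lemma nn_integral_lborel_translate:
  fixes f :: "'a::euclidean_space \<Rightarrow> ennreal"
  assumes [measurable]: "f \<in> borel_measurable borel"
  shows "(\<integral>\<^sup>+x. f (x + c) \<partial>lborel) = (\<integral>\<^sup>+x. f x \<partial>lborel)"
proof -
  have "(\<integral>\<^sup>+x. f x \<partial>lborel) = (\<integral>\<^sup>+x. f x \<partial>distr lborel borel ((+) c))"
    by (simp add: lborel_distr_plus)
  also have "\<dots> = (\<integral>\<^sup>+x. f (c + x) \<partial>lborel)" by (subst nn_integral_distr) auto
  finally show ?thesis by (simp add: add.commute)
qed

lemma lborel_distr_uminus_euclidean: "distr lborel borel uminus = (lborel :: 'a::euclidean_space measure)"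
  using lborel_affine[of "- 1" "0::'a"] by (simp add: density_1)

lemma nn_integral_lborel_reflect:
  fixes f :: "'a::euclidean_space \<Rightarrow> ennreal"
  assumes [measurable]: "f \<in> borel_measurable borel"
  shows "(\<integral>\<^sup>+x. f (c - x) \<partial>lborel) = (\<integral>\<^sup>+x. f x \<partial>lborel)"
proof -
  have "(\<integral>\<^sup>+x. f (x + c) \<partial>lborel) = (\<integral>\<^sup>+x. f (x + c) \<partial>distr lborel borel uminus)"
    by (simp add: lborel_distr_uminus_euclidean)
  also have "\<dots> = (\<integral>\<^sup>+x. f (c - x) \<partial>lborel)" by (subst nn_integral_distr) auto
  finally show ?thesis by (simp add: nn_integral_lborel_translate)
qed

lemma integrable_lborel_translate:
  fixes f :: "'a::euclidean_space \<Rightarrow> 'b::{banach,second_countable_topology}"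
  assumes "integrable lborel f"
  shows "integrable lborel (\<lambda>x. f (x + c))" "(\<integral>x. f (x + c) \<partial>lborel) = (\<integral>x. f x \<partial>lborel)"
proof -
  have [measurable]: "f \<in> borel_measurable borel" using assms by auto
  have "integrable (distr lborel borel ((+) c)) f" using assms by (simp add: lborel_distr_plus)
  then show "integrable lborel (\<lambda>x. f (x + c))"
    by (subst (asm) integrable_distr_eq) (auto simp: add.commute)
  have "(\<integral>x. f x \<partial>distr lborel borel ((+) c)) = (\<integral>x. f (c + x) \<partial>lborel)"
    by (subst integral_distr) auto
  then show "(\<integral>x. f (x + c) \<partial>lborel) = (\<integral>x. f x \<partial>lborel)"
    by (simp add: lborel_distr_plus add.commute)
qed

section \<open>Bessel's inequality for the Fourier transform\<close>

text \<open>The characteristic function of the standard normal law, rescaled by the substitution t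
  -> e t.\<close>

lemma gaussian_fourier_1:
  fixes e s :: real
  assumes e: "e > 0"
  shows "integrable lborel (\<lambda>t. exp (- (e * t)\<^sup>2 / 2) * cis (t * s))"
    and "(\<integral>t. exp (- (e * t)\<^sup>2 / 2) * cis (t * s) \<partial>lborel) = of_real (sqrt (2 * pi) / e * exp (- (s / e)\<^sup>2 / 2))"
proof -
  have c: "(\<integral>x. std_normal_density x *\<^sub>R cis (t * x) \<partial>lborel) = of_real (exp (- t\<^sup>2 / 2))" for t
  proof -
    have "char std_normal_distribution t = (\<integral>x. std_normal_density x *\<^sub>R cis (t * x) \<partial>lborel)"
      unfolding char_def
      by (subst integral_density) (auto simp: cis_conv_exp)
    then show ?thesis by (simp add: char_std_normal_distribution)
  qed
  have i: "integrable lborel (\<lambda>x. std_normal_density x *\<^sub>R cis (t * x))" for t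
    by (rule Bochner_Integration.integrable_bound[OF integrable_normal_density[of 1 0]])
       (auto simp: cis_conv_exp)
  have p: "sqrt (2 * pi) > 0" by simp
  have eq: "sqrt (2*pi) *\<^sub>R (std_normal_density (e * t) *\<^sub>R cis (s / e * (e * t)))
      = exp (- (e * t)\<^sup>2 / 2) * cis (t * s)" for t
    using e p unfolding std_normal_density_def by (simp add: scaleR_conv_of_real field_simps)
  have "integrable lborel (\<lambda>t. std_normal_density (0 + e * t) *\<^sub>R cis (s / e * (0 + e * t)))"
    using lborel_integrable_real_affine[OF i[of "s / e"], of e 0] e by simp
  then have "integrable lborel (\<lambda>t. sqrt (2*pi) *\<^sub>R (std_normal_density (e * t) *\<^sub>R cis (s / e * (e * t))))"
    unfolding add_0 by (rule integrable_scaleR_right)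
  then show "integrable lborel (\<lambda>t. exp (- (e * t)\<^sup>2 / 2) * cis (t * s))"
    by (simp only: eq)
  have "of_real (exp (- (s/e)\<^sup>2 / 2)) = e *\<^sub>R (\<integral>t. std_normal_density (e * t) *\<^sub>R cis (s / e * (e * t)) \<partial>lborel)"
    using lborel_integral_real_affine[of e "\<lambda>x. std_normal_density x *\<^sub>R cis (s / e * x)" 0] e c[of "s / e"] by simp
  then have "(sqrt (2*pi) / e) *\<^sub>R of_real (exp (- (s/e)\<^sup>2 / 2)) =
      sqrt (2 * pi) *\<^sub>R (\<integral>t. std_normal_density (e * t) *\<^sub>R cis (s / e * (e * t)) \<partial>lborel)"
    using e by simp
  also have "\<dots> = (\<integral>t. sqrt (2*pi) *\<^sub>R (std_normal_density (e * t) *\<^sub>R cis (s / e * (e * t))) \<partial>lborel)"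
    by (rule integral_scaleR_right[symmetric])
  finally show "(\<integral>t. exp (- (e * t)\<^sup>2 / 2) * cis (t * s) \<partial>lborel) = of_real (sqrt (2 * pi) / e * exp (- (s / e)\<^sup>2 / 2))"
    by (simp only: eq) (simp add: scaleR_conv_of_real)
qed

text \<open>This is exp(-e^2 |v|^2 / 2), written as a product over coordinates so that its integrals
  factor over \<open>Basis\<close>; \<open>gauss_ft e\<close> is its Fourier transform.\<close>

definition gauss :: "real \<Rightarrow> 'a::euclidean_space \<Rightarrow> real" where
  "gauss e v = (\<Prod>b\<in>Basis. exp (- (e * (v \<bullet> b))\<^sup>2 / 2))"

definition gauss_ft :: "real \<Rightarrow> 'a::euclidean_space \<Rightarrow> real" where
  "gauss_ft e s = (\<Prod>b\<in>Basis. sqrt (2 * pi) / e * exp (- ((s \<bullet> b) / e)\<^sup>2 / 2))"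

lemma cis_inner: "cis (v \<bullet> s) = (\<Prod>b\<in>Basis. cis ((v \<bullet> b) * (s \<bullet> b)))"
  by (subst euclidean_inner, induction rule: finite_induct[OF finite_Basis])
     (auto simp: cis_mult[symmetric])

lemma gauss_measurable [measurable]:
  "gauss e \<in> borel_measurable borel" "gauss_ft e \<in> borel_measurable borel"
  unfolding gauss_def gauss_ft_def by measurable

lemma cis_measurable [measurable]: "cis \<in> borel_measurable borel"
  by (intro borel_measurable_continuous_onI continuous_intros)

lemma cnj_measurable [measurable]: "cnj \<in> borel_measurable borel"
  by (intro borel_measurable_continuous_onI continuous_intros)

lemma gauss_fourier:
  assumes "e > 0"
  shows "integrable lborel (\<lambda>v. gauss e v * cis (v \<bullet> s))"
    and "(\<integral>v. gauss e v * cis (v \<bullet> s) \<partial>lborel) = of_real (gauss_ft e s)"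
proof -
  have eq: "gauss e v * cis (v \<bullet> s) =
      (\<Prod>b\<in>Basis. exp (- (e * (v \<bullet> b))\<^sup>2 / 2) * cis ((v \<bullet> b) * (s \<bullet> b)))" for v
    by (simp add: gauss_def prod.distrib cis_inner)
  show "integrable lborel (\<lambda>v. gauss e v * cis (v \<bullet> s))"
    unfolding eq by (rule integrable_lborel_prod) (rule gaussian_fourier_1[OF assms])
  have "(\<integral>v. gauss e v * cis (v \<bullet> s) \<partial>lborel) =
      (\<Prod>b\<in>Basis. (\<integral>t. exp (- (e * t)\<^sup>2 / 2) * cis (t * (s \<bullet> b)) \<partial>lborel))"
    unfolding eq by (rule integrable_lborel_prod) (rule gaussian_fourier_1[OF assms])
  then show "(\<integral>v. gauss e v * cis (v \<bullet> s) \<partial>lborel) = of_real (gauss_ft e s)"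
    by (simp only: gaussian_fourier_1(2)[OF assms] gauss_ft_def of_real_prod)
qed

text \<open>The mass is the same for every \<open>e\<close>; this is what makes
  \<open>bessel_gauss\<close> uniform in \<open>e\<close>.\<close>

lemma nn_integral_gauss_ft:
  assumes e: "e > 0"
  shows "(\<integral>\<^sup>+s. ennreal (gauss_ft e (s::'a::euclidean_space)) \<partial>lborel) = ennreal ((2 * pi) ^ DIM('a))"
proof -
  let ?g = "\<lambda>t. sqrt (2 * pi) / e * exp (- (t / e)\<^sup>2 / 2)"
  have "(\<integral>\<^sup>+s. ennreal (gauss_ft e (s::'a)) \<partial>lborel) = (\<integral>\<^sup>+s. (\<Prod>b\<in>Basis. ennreal (?g ((s::'a) \<bullet> b))) \<partial>lborel)"
    unfolding gauss_ft_def using e by (subst prod_ennreal) auto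
  also have "\<dots> = (\<Prod>b\<in>(Basis::'a set). \<integral>\<^sup>+t. ennreal (?g t) \<partial>lborel)"
    by (rule nn_integral_lborel_prod) auto
  also have "(\<integral>\<^sup>+t. ennreal (?g t) \<partial>lborel) = ennreal (2 * pi)"
  proof (rule nn_integral_eq_integrable[THEN iffD2])
    \<comment> \<open>A Gaussian of parameter 1 / e, read as the integrand of its Fourier integral
      at frequency 0.\<close>
    have g: "of_real (?g t) = of_real (sqrt (2*pi) / e) * (exp (- (1 / e * t)\<^sup>2 / 2) * cis (t * 0))" for t
      by simp
    have e': "1 / e > 0" using e by simp
    have "integrable lborel (\<lambda>t. complex_of_real (?g t))"
      unfolding g by (intro integrable_mult_right gaussian_fourier_1[OF e'])
    moreover from this have "integrable lborel ?g" by (simp only: complex_of_real_integrable_eq)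
    moreover have I: "(\<integral>t. complex_of_real (?g t) \<partial>lborel) = of_real (2 * pi)"
      unfolding g using e by (simp only: integral_mult_right_zero gaussian_fourier_1(2)[OF e'])
         (simp add: field_simps of_real_mult[symmetric] del: of_real_mult)
    ultimately show "integrable lborel ?g \<and> integral\<^sup>L lborel ?g = 2 * pi"
      using I[unfolded integral_complex_of_real of_real_eq_iff] by blast
  qed (use e in auto)
  finally show ?thesis by (simp add: ennreal_power)
qed

text \<open>The Gaussian makes the v-integral absolutely convergent, so that |H|^2 can be expanded
  into an integral over y and y' with the kernel \<open>gauss_ft e (y' - y)\<close>. This kernel is
  nonnegative and has mass (2 pi)^n in each variable, so Schur's test gives the bound.\<close>

lemma bessel_gauss:
  fixes h :: "'a::euclidean_space \<Rightarrow> complex"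
  assumes h: "integrable lborel h" and e: "e > 0"
  defines "H \<equiv> \<lambda>v. \<integral>y. h y * cis (- (y \<bullet> v)) \<partial>lborel"
  shows "(\<integral>\<^sup>+v. ennreal (gauss e v * (norm (H v))\<^sup>2) \<partial>lborel)
    \<le> ennreal ((2 * pi) ^ DIM('a)) * (\<integral>\<^sup>+y. ennreal ((norm (h y))\<^sup>2) \<partial>lborel)"
proof -
  note [measurable] = borel_measurable_integrable[OF h]
  have g0: "gauss e v \<ge> 0" "gauss_ft e v \<ge> 0" for v :: 'a
    unfolding gauss_def gauss_ft_def using e by (auto intro!: prod_nonneg)
  have gi: "integrable lborel (\<lambda>v::'a. complex_of_real (gauss e v))"
    using gauss_fourier(1)[OF e, of 0] by simp
  have Hm [measurable]: "H \<in> borel_measurable borel"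
    unfolding H_def by measurable
  define C where "C = (\<integral>y. norm (h y) \<partial>lborel)"
  have HC: "norm (H v) \<le> C" for v
    unfolding H_def C_def by (rule order_trans[OF integral_norm_bound]) (simp add: norm_mult)
  have Hg: "integrable lborel (\<lambda>v. gauss e v * cnj (H v))"
    by (rule integrable_mult_bounded[OF gi, where C=C]) (auto simp: HC)
  have I: "(\<integral>v. gauss e v * cnj (H v) * H v \<partial>lborel)
     = (\<integral>y. h y * (\<integral>v. gauss e v * cnj (H v) * cis (- (y \<bullet> v)) \<partial>lborel) \<partial>lborel)"
        using fubini_bounded_kernel[OF Hg h, of "\<lambda>v y. cis (- (y \<bullet> v))" 1] unfolding H_def by simp
  have J: "(\<integral>v. gauss e v * cnj (H v) * cis (- (y \<bullet> v)) \<partial>lborel)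
     = (\<integral>y'. cnj (h y') * gauss_ft e (y' - y) \<partial>lborel)" for y
  proof -
    have G: "integrable lborel (\<lambda>v. gauss e v * cis (- (y \<bullet> v)))"
      by (rule integrable_mult_bounded[OF gi, where C=1]) auto
    have "cnj (H v) = (\<integral>y'. cnj (h y') * cis (y' \<bullet> v) \<partial>lborel)" for v
      unfolding H_def by (rule trans[OF Bochner_Integration.integral_cnj[symmetric]], rule Bochner_Integration.integral_cong) (auto simp: cis_cnj)
    then have "(\<integral>v. gauss e v * cnj (H v) * cis (- (y \<bullet> v)) \<partial>lborel) =
        (\<integral>v. (gauss e v * cis (- (y \<bullet> v))) * (\<integral>y'. cnj (h y') * cis (y' \<bullet> v) \<partial>lborel) \<partial>lborel)"
      by (simp add: mult_ac)
    also have "\<dots> = (\<integral>y'. cnj (h y') * (\<integral>v. (gauss e v * cis (- (y \<bullet> v))) * cis (y' \<bullet> v) \<partial>lborel) \<partial>lborel)"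
      by (rule fubini_bounded_kernel[OF G _ _, where C=1]) (use h in auto)
    also have "(\<lambda>v. gauss e v * cis (- (y \<bullet> v)) * cis (y' \<bullet> v)) = (\<lambda>v. gauss e v * cis (v \<bullet> (y' - y)))" for y'
      by (simp add: cis_mult inner_diff_right inner_commute mult.assoc fun_eq_iff)
    then have "(\<integral>y'. cnj (h y') * (\<integral>v. (gauss e v * cis (- (y \<bullet> v))) * cis (y' \<bullet> v) \<partial>lborel) \<partial>lborel)
        = (\<integral>y'. cnj (h y') * gauss_ft e (y' - y) \<partial>lborel)"
      by (simp add: gauss_fourier(2)[OF e])
    finally show ?thesis .
  qed
  have E: "gauss e v * cnj (H v) * H v = complex_of_real (gauss e v * (norm (H v))\<^sup>2)" for v
    by (simp add: complex_norm_square mult_ac del: of_real_power)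
  have "integrable lborel (\<lambda>v. gauss e v * cnj (H v) * H v)"
    by (rule integrable_mult_bounded[OF Hg, where C=C]) (auto simp: HC)
  then have Ii: "integrable lborel (\<lambda>v. gauss e v * (norm (H v))\<^sup>2)"
    unfolding E by (simp only: complex_of_real_integrable_eq)
  have "(\<integral>\<^sup>+v. ennreal (gauss e v * (norm (H v))\<^sup>2) \<partial>lborel) = ennreal (\<integral>v. gauss e v * (norm (H v))\<^sup>2 \<partial>lborel)"
    by (rule nn_integral_eq_integral[OF Ii]) (auto simp: g0)
  also have "\<dots> \<le> ennreal (norm (\<integral>v. complex_of_real (gauss e v * (norm (H v))\<^sup>2) \<partial>lborel))"
    by (rule ennreal_leI) (simp only: integral_complex_of_real norm_of_real abs_ge_self)
  also have "\<dots> = ennreal (norm (\<integral>y. h y * (\<integral>y'. cnj (h y') * gauss_ft e (y' - y) \<partial>lborel) \<partial>lborel))"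
    unfolding E[symmetric] I J ..
  also have "\<dots> \<le> (\<integral>\<^sup>+y. \<integral>\<^sup>+y'. ennreal (norm (h y) * norm (h y') * gauss_ft e (y' - y)) \<partial>lborel \<partial>lborel)"
  proof (rule order_trans[OF norm_integral_le_nn_integral nn_integral_mono])
    fix y
    have "ennreal (norm (h y * (\<integral>y'. cnj (h y') * gauss_ft e (y' - y) \<partial>lborel)))
        = ennreal (norm (\<integral>y'. h y * (cnj (h y') * gauss_ft e (y' - y)) \<partial>lborel))"
      by (subst integral_mult_right_zero) simp
    also have "\<dots> \<le> (\<integral>\<^sup>+y'. ennreal (norm (h y * (cnj (h y') * gauss_ft e (y' - y)))) \<partial>lborel)"
      by (rule norm_integral_le_nn_integral)
    finally show "ennreal (norm (h y * (\<integral>y'. cnj (h y') * gauss_ft e (y' - y) \<partial>lborel)))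
       \<le> (\<integral>\<^sup>+y'. ennreal (norm (h y) * norm (h y') * gauss_ft e (y' - y)) \<partial>lborel)"
      by (simp add: norm_mult g0 mult_ac)
  qed
  also have "\<dots> \<le> (\<integral>\<^sup>+y. \<integral>\<^sup>+y'. (ennreal ((norm (h y))\<^sup>2 / 2) * ennreal (gauss_ft e (y' - y))
      + ennreal ((norm (h y'))\<^sup>2 / 2) * ennreal (gauss_ft e (y' - y))) \<partial>lborel \<partial>lborel)"
  proof (intro nn_integral_mono)
    fix y y'
    \<comment> \<open>One half of the bound integrates the kernel in y', the other half in
      y.\<close>
    have "norm (h y) * norm (h y') \<le> (norm (h y))\<^sup>2 / 2 + (norm (h y'))\<^sup>2 / 2"
      using sum_squares_bound[of "norm (h y)" "norm (h y')"] by (simp add: field_simps)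
    from mult_right_mono[OF this g0(2)[of "y' - y"]]
    show "ennreal (norm (h y) * norm (h y') * gauss_ft e (y' - y)) \<le> ennreal ((norm (h y))\<^sup>2 / 2) * ennreal (gauss_ft e (y' - y))
      + ennreal ((norm (h y'))\<^sup>2 / 2) * ennreal (gauss_ft e (y' - y))"
      by (simp add: g0 ennreal_mult[symmetric] ennreal_plus[symmetric] algebra_simps ennreal_leI del: ennreal_plus)
  qed
  also have "\<dots> = (\<integral>\<^sup>+y. \<integral>\<^sup>+y'. ennreal ((norm (h y))\<^sup>2 / 2) * ennreal (gauss_ft e (y' - y)) \<partial>lborel \<partial>lborel)
      + (\<integral>\<^sup>+y. \<integral>\<^sup>+y'. ennreal ((norm (h y'))\<^sup>2 / 2) * ennreal (gauss_ft e (y' - y)) \<partial>lborel \<partial>lborel)"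
    by (subst nn_integral_add[symmetric], measurable) (simp add: nn_integral_add)
  also have "(\<integral>\<^sup>+y. \<integral>\<^sup>+y'. ennreal ((norm (h y))\<^sup>2 / 2) * ennreal (gauss_ft e (y' - y)) \<partial>lborel \<partial>lborel)
      = (\<integral>\<^sup>+y. ennreal ((norm (h y))\<^sup>2 / 2) \<partial>lborel) * ennreal ((2 * pi) ^ DIM('a))"
    by (simp add: nn_integral_cmult nn_integral_multc
        nn_integral_lborel_translate[of "\<lambda>x. ennreal (gauss_ft e x)" "- c" for c, simplified] nn_integral_gauss_ft[OF e])
  also have "(\<integral>\<^sup>+y. \<integral>\<^sup>+y'. ennreal ((norm (h y'))\<^sup>2 / 2) * ennreal (gauss_ft e (y' - y)) \<partial>lborel \<partial>lborel)
      = (\<integral>\<^sup>+y'. \<integral>\<^sup>+y. ennreal ((norm (h y'))\<^sup>2 / 2) * ennreal (gauss_ft e (y' - y)) \<partial>lborel \<partial>lborel)"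
    by (rule lborel_pair.Fubini') measurable
  also have "\<dots> = (\<integral>\<^sup>+y. ennreal ((norm (h y))\<^sup>2 / 2) \<partial>lborel) * ennreal ((2 * pi) ^ DIM('a))"
    by (simp add: nn_integral_cmult nn_integral_multc
        nn_integral_lborel_reflect[of "\<lambda>x. ennreal (gauss_ft e x)"] nn_integral_gauss_ft[OF e])
  also have "(\<integral>\<^sup>+y. ennreal ((norm (h y))\<^sup>2 / 2) \<partial>lborel) * ennreal ((2 * pi) ^ DIM('a)) +
      (\<integral>\<^sup>+y. ennreal ((norm (h y))\<^sup>2 / 2) \<partial>lborel) * ennreal ((2 * pi) ^ DIM('a))
      = ennreal ((2 * pi) ^ DIM('a)) * (\<integral>\<^sup>+y. ennreal ((norm (h y))\<^sup>2) \<partial>lborel)"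
    by (subst distrib_right[symmetric], subst nn_integral_add[symmetric])
       (auto simp: ennreal_plus[symmetric] mult.commute simp del: ennreal_plus)
  finally show ?thesis .
qed

text \<open>Fatou's lemma for e = 1 / (k + 1) -> 0 in \<open>bessel_gauss\<close>. If h is not
  square integrable the right side is infinite, so integrability of h suffices. The factor (2 pi)^n
  reflects the unnormalised transform.\<close>

lemma bessel:
  fixes h :: "'a::euclidean_space \<Rightarrow> complex"
  assumes h: "integrable lborel h"
  shows "(\<integral>\<^sup>+v. ennreal ((norm (\<integral>y. h y * cis (- (y \<bullet> v)) \<partial>lborel))\<^sup>2) \<partial>lborel)
    \<le> ennreal ((2 * pi) ^ DIM('a)) * (\<integral>\<^sup>+y. ennreal ((norm (h y))\<^sup>2) \<partial>lborel)" (is "_ \<le> ?B")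
proof -
  note [measurable] = borel_measurable_integrable[OF h]
  define H where "H v = (\<integral>y. h y * cis (- (y \<bullet> v)) \<partial>lborel)" for v
  have Hm [measurable]: "H \<in> borel_measurable borel" unfolding H_def by measurable
  define e where "e k = inverse (real (Suc k))" for k
  have e0: "e k > 0" for k by (simp add: e_def)
  have lim: "(\<lambda>k. ennreal (gauss (e k) v * (norm (H v))\<^sup>2)) \<longlonglongrightarrow> ennreal ((norm (H v))\<^sup>2)" for v
  proof -
    have "e \<longlonglongrightarrow> 0" unfolding e_def by (rule LIMSEQ_inverse_real_of_nat)
    then have "(\<lambda>k. gauss (e k) v * (norm (H v))\<^sup>2) \<longlonglongrightarrow> (\<Prod>b\<in>(Basis::'a set). exp (- (0 * (v \<bullet> b))\<^sup>2 / 2)) * (norm (H v))\<^sup>2"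
      unfolding gauss_def by (intro tendsto_intros) auto
    then show ?thesis by (intro tendsto_ennrealI) simp
  qed
  have "(\<integral>\<^sup>+v. ennreal ((norm (H v))\<^sup>2) \<partial>lborel) = (\<integral>\<^sup>+v. liminf (\<lambda>k. ennreal (gauss (e k) v * (norm (H v))\<^sup>2)) \<partial>lborel)"
    using lim_imp_Liminf[OF _ lim] by simp
  also have "\<dots> \<le> liminf (\<lambda>k. \<integral>\<^sup>+v. ennreal (gauss (e k) v * (norm (H v))\<^sup>2) \<partial>lborel)"
    by (rule nn_integral_liminf) measurable
  also have "\<dots> \<le> ?B"
    using bessel_gauss[OF h e0] unfolding H_def
    by (intro Liminf_le) auto
  finally show ?thesis unfolding H_def .
qed

section \<open>Derivatives along lines\<close>

text \<open>Differentiability along one direction is all that integration by parts needs, and for a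
  Fourier transform it is easier to establish than a Frechet derivative.\<close>

definition dir_deriv :: "'a::real_normed_vector \<Rightarrow> ('a \<Rightarrow> complex) \<Rightarrow> ('a \<Rightarrow> complex) \<Rightarrow> bool" where
  "dir_deriv c u u' \<longleftrightarrow>
    (\<forall>p t. ((\<lambda>t. u (p + t *\<^sub>R c)) has_vector_derivative u' (p + t *\<^sub>R c)) (at t))"

lemma dir_derivD:
  "dir_deriv c u u' \<Longrightarrow> ((\<lambda>t. u (p + t *\<^sub>R c)) has_vector_derivative u' (p + t *\<^sub>R c)) (at t)"
  by (simp add: dir_deriv_def)

lemma has_derivative_imp_dir_deriv:
  assumes "\<And>p. (u has_derivative D p) (at p)" "\<And>p. D p c = u' p"
  shows "dir_deriv c u u'"
  unfolding dir_deriv_def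
proof (intro allI)
  fix p t
  have l: "((\<lambda>t. p + t *\<^sub>R c) has_derivative (\<lambda>s. s *\<^sub>R c)) (at t)"
    by (auto intro!: derivative_eq_intros)
  have "((\<lambda>t. u (p + t *\<^sub>R c)) has_derivative (\<lambda>s. D (p + t *\<^sub>R c) (s *\<^sub>R c))) (at t)"
    using has_derivative_compose[OF l assms(1)] .
  moreover have "D (p + t *\<^sub>R c) (s *\<^sub>R c) = s *\<^sub>R u' (p + t *\<^sub>R c)" for s
    using linear_scale[OF has_derivative_linear[OF assms(1)]] assms(2) by simp
  ultimately show "((\<lambda>t. u (p + t *\<^sub>R c)) has_vector_derivative u' (p + t *\<^sub>R c)) (at t)"
    by (simp add: has_vector_derivative_def)
qed

lemma dir_deriv_iter_deriv:
  assumes "smooth_fun f"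
  shows "dir_deriv d (iter_deriv ds f) (iter_deriv (d # ds) f)"
proof (rule has_derivative_imp_dir_deriv)
  show "(iter_deriv ds f has_derivative frechet_derivative (iter_deriv ds f) (at p)) (at p)" for p
    using assms unfolding smooth_fun_def by (simp add: frechet_derivative_works[symmetric])
qed simp

lemma continuous_iter_deriv:
  assumes "smooth_fun f"
  shows "continuous_on S (iter_deriv ds f)"
  using assms unfolding smooth_fun_def
  by (meson continuous_at_imp_continuous_on differentiable_imp_continuous_within)

lemma integral_dir_deriv:
  fixes u :: "'a::real_normed_vector \<Rightarrow> complex"
  assumes u: "dir_deriv c u u'" and c: "continuous_on UNIV u'" and ab: "a \<le> b"
  shows "(\<integral>t. indicator {a..b} t *\<^sub>R u' (p + t *\<^sub>R c) \<partial>lborel) = u (p + b *\<^sub>R c) - u (p + a *\<^sub>R c)"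
proof (rule integral_FTC_Icc[OF ab])
  show "((\<lambda>t. u (p + t *\<^sub>R c)) has_vector_derivative u' (p + t *\<^sub>R c)) (at t within {a..b})" for t
    using dir_derivD[OF u] by (rule has_vector_derivative_at_within)
  show "continuous_on {a..b} (\<lambda>t. u' (p + t *\<^sub>R c))"
    by (intro continuous_on_compose2[OF c] continuous_intros) auto
qed

text \<open>Translation invariance replaces decay at infinity: the integral of h(v + b) - h(v) is 0,
  and it equals the integral over t in [0, 1] of the integral of h'(v + t b), which does not depend
  on t.\<close>

lemma integral_dir_deriv_eq_0:
  fixes h :: "'a::euclidean_space \<Rightarrow> complex"
  assumes h: "dir_deriv b h h'" and i: "integrable lborel h" and i': "integrable lborel h'"
    and c: "continuous_on UNIV h'"
  shows "(\<integral>v. h' v \<partial>lborel) = 0"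
proof -
  have [measurable]: "h' \<in> borel_measurable borel" using i' by auto
  let ?F = "\<lambda>(t::real, v). indicator {0..1} t *\<^sub>R h' (v + t *\<^sub>R b)"
  have int: "integrable (lborel \<Otimes>\<^sub>M lborel) ?F"
  proof (rule lborel_pair.Fubini_integrable)
    have "(\<integral>v. norm (h' (v + c)) \<partial>lborel) = (\<integral>v. norm (h' v) \<partial>lborel)" for c
      by (rule integrable_lborel_translate(2)) (use i' in auto)
    then show "integrable lborel (\<lambda>t. \<integral>v. norm (?F (t, v)) \<partial>lborel)" by simp
    show "AE t in lborel. integrable lborel (\<lambda>v. ?F (t, v))"
      using integrable_lborel_translate(1)[OF i'] by simp
  qed measurable
  have "0 = (\<integral>v. h (v + b) \<partial>lborel) - (\<integral>v. h v \<partial>lborel)"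
    by (simp add: integrable_lborel_translate(2)[OF i])
  also have "\<dots> = (\<integral>v. h (v + b) - h v \<partial>lborel)"
    by (rule Bochner_Integration.integral_diff[symmetric]) (use integrable_lborel_translate(1)[OF i] i in auto)
  also have "\<dots> = (\<integral>v. (\<integral>t. indicator {0..1} t *\<^sub>R h' (v + t *\<^sub>R b) \<partial>lborel) \<partial>lborel)"
    by (subst integral_dir_deriv[OF h c]) auto
  also have "\<dots> = (\<integral>t. (\<integral>v. indicator {0..1} t *\<^sub>R h' (v + t *\<^sub>R b) \<partial>lborel) \<partial>lborel)"
    using lborel_pair.Fubini_integral[OF int] by simp
  also have "\<dots> = (\<integral>t. indicator {0..1::real} t *\<^sub>R (\<integral>v. h' v \<partial>lborel) \<partial>lborel)"
    by (simp add: integrable_lborel_translate(2)[OF i'])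
  also have "\<dots> = (\<integral>v. h' v \<partial>lborel)" by (subst integral_scaleR_left) auto
  finally show ?thesis by simp
qed

lemma has_vector_derivative_quadratic_bound:
  fixes F :: "real \<Rightarrow> complex"
  assumes "\<And>s. norm (F s - F t - (s - t) *\<^sub>R D) \<le> K * (s - t)\<^sup>2"
  shows "(F has_vector_derivative D) (at t)"
  unfolding has_vector_derivative_def has_derivative_at_within
proof (intro conjI bounded_linear_intros)
  have "((\<lambda>s. K * \<bar>s - t\<bar>) \<longlongrightarrow> K * \<bar>t - t\<bar>) (at t)" by (intro tendsto_intros)
  then have lim: "((\<lambda>s. K * \<bar>s - t\<bar>) \<longlongrightarrow> 0) (at t)" by simp
  show "((\<lambda>y. (F y - F t - (y - t) *\<^sub>R D) /\<^sub>R norm (y - t)) \<longlongrightarrow> 0) (at t)"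
  proof (rule Lim_null_comparison[OF _ lim])
    show "\<forall>\<^sub>F y in at t. norm ((F y - F t - (y - t) *\<^sub>R D) /\<^sub>R norm (y - t)) \<le> K * \<bar>y - t\<bar>"
    proof (rule eventually_at_filter[THEN iffD2], rule eventuallyI, intro impI)
      fix y :: real assume y: "y \<noteq> t"
      have "norm ((F y - F t - (y - t) *\<^sub>R D) /\<^sub>R norm (y - t)) = norm (F y - F t - (y - t) *\<^sub>R D) / \<bar>y - t\<bar>"
        by (simp add: divide_inverse mult.commute)
      also have "\<dots> \<le> K * \<bar>y - t\<bar>\<^sup>2 / \<bar>y - t\<bar>"
        using assms[of y] by (intro divide_right_mono) auto
      also have "\<dots> = K * \<bar>y - t\<bar>" using y by (simp add: power2_eq_square del: power2_abs abs_mult_self_eq)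
      finally show "norm ((F y - F t - (y - t) *\<^sub>R D) /\<^sub>R norm (y - t)) \<le> K * \<bar>y - t\<bar>" .
    qed
  qed
qed

section \<open>The weight\<close>

text \<open>Each factor is the squared modulus of the multiplier \<open>wfac\<close> for that
  coordinate. The product form also reduces integrability to dimension one.\<close>

definition weight :: "'a::euclidean_space \<Rightarrow> real" where
  "weight y = (\<Prod>b\<in>Basis. 1 / (1 + (y \<bullet> b)\<^sup>2))"

lemma weight_nonneg: "0 \<le> weight y" and weight_pos: "0 < weight y" and weight_le_1: "weight y \<le> 1"
  unfolding weight_def
  by (auto intro!: prod_nonneg prod_pos prod_le_1 simp: add_pos_nonneg)

lemma weight_measurable [measurable]: "weight \<in> borel_measurable borel"
  unfolding weight_def by measurable

lemma integrable_weight: "integrable lborel (weight :: 'a::euclidean_space \<Rightarrow> real)"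
proof -
  have "set_integrable lborel (einterval (-\<infinity>) \<infinity>) (\<lambda>x. inverse (1 + x\<^sup>2))"
    using integrable_I0i_1_div_plus_square integrable_inverse_1_plus_square by blast
  then have "integrable lborel (\<lambda>x::real. 1 / (1 + x\<^sup>2))"
    by (simp add: set_integrable_def inverse_eq_divide)
  then have "integrable lborel (\<lambda>x::real. complex_of_real (1 / (1 + x\<^sup>2)))"
    by (simp only: complex_of_real_integrable_eq)
  then have "integrable lborel (\<lambda>x::'a. \<Prod>b\<in>Basis. complex_of_real (1 / (1 + (x \<bullet> b)\<^sup>2)))"
    by (rule integrable_lborel_prod(1))
  then have "integrable lborel (\<lambda>x::'a. complex_of_real (weight x))"
    unfolding weight_def by simp
  then show ?thesis by (simp only: complex_of_real_integrable_eq)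
qed

lemma nn_integral_weight_finite: "(\<integral>\<^sup>+y. ennreal (weight (y::'a::euclidean_space)) \<partial>lborel) < \<infinity>"
  using integrable_weight[where 'a='a] by (simp add: integrable_iff_bounded weight_nonneg)

lemma integrable_weight_bound:
  fixes f :: "'a::euclidean_space \<Rightarrow> complex"
  assumes "f \<in> borel_measurable borel" and "\<And>x. norm (f x) \<le> C * weight x"
  shows "integrable lborel f"
proof -
  have "norm (f x) \<le> norm (C * weight x)" for x
    by (rule order_trans[OF assms(2)]) simp
  then have "AE x in lborel. norm (f x) \<le> norm (C * weight x)" by simp
  then show ?thesis
    using assms(1)
    by (intro Bochner_Integration.integrable_bound[OF integrable_mult_right[OF integrable_weight, of C]]) auto
qed

text \<open>Every factor 1 + (y . b)^2 is at most (1 + |y|)^2. The bound turns polynomial decay of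
  order 2n into an integrable majorant.\<close>

lemma weight_ge: "1 \<le> (1 + norm y) ^ (2 * DIM('a)) * weight (y::'a::euclidean_space)"
proof -
  have "(\<Prod>b\<in>(Basis::'a set). (1 + norm y)\<^sup>2 * (1 / (1 + (y \<bullet> b)\<^sup>2))) \<ge> 1"
  proof (rule prod_ge_1)
    fix b :: 'a assume "b \<in> Basis"
    then have "\<bar>y \<bullet> b\<bar> \<le> norm y" by (rule Basis_le_norm)
    then have "(y \<bullet> b)\<^sup>2 \<le> (norm y)\<^sup>2" by (metis abs_ge_zero power2_abs power_mono)
    then have "1 + (y \<bullet> b)\<^sup>2 \<le> (1 + norm y)\<^sup>2" by (simp add: power2_sum add_increasing2)
    then show "1 \<le> (1 + norm y)\<^sup>2 * (1 / (1 + (y \<bullet> b)\<^sup>2))"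
      by (simp add: add_pos_nonneg)
  qed
  then show ?thesis by (simp add: weight_def prod.distrib prod_dividef power_mult)
qed

text \<open>The coordinate of largest modulus dominates every factor of 1 / \<open>weight\<close>.
  Pure powers of single coordinates are the right majorant because on the Fourier side they come
  from repeated derivatives in one direction, without mixed derivatives.\<close>

lemma weight_ge_coordinates:
  "1 \<le> 2 ^ DIM('a) * (1 + (\<Sum>b\<in>Basis. \<bar>y \<bullet> b\<bar> ^ (2 * DIM('a)))) * weight (y::'a::euclidean_space)"
proof -
  define M where "M = Max ((\<lambda>b. (y \<bullet> b)\<^sup>2) ` Basis)"
  have M: "(y \<bullet> b)\<^sup>2 \<le> M" if "b \<in> Basis" for b
    unfolding M_def using that by (intro Max_ge) auto
  have "M \<in> (\<lambda>b. (y \<bullet> b)\<^sup>2) ` Basis" unfolding M_def by (rule Max_in) auto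
  then obtain c where c: "c \<in> Basis" "M = (y \<bullet> c)\<^sup>2" by auto
  have M0: "M \<ge> 0" using c by simp
  have "(1 + M) ^ DIM('a) \<le> (2 * max 1 M) ^ DIM('a)" using M0 by (intro power_mono) auto
  also have "\<dots> = 2 ^ DIM('a) * (max 1 M) ^ DIM('a)" by (rule power_mult_distrib)
  also have "(max 1 M) ^ DIM('a) \<le> 1 + M ^ DIM('a)" using M0 by (simp add: max_def)
  also have "M ^ DIM('a) = \<bar>y \<bullet> c\<bar> ^ (2 * DIM('a))" using c by (simp add: power_mult)
  also have "\<dots> \<le> (\<Sum>b\<in>Basis. \<bar>y \<bullet> b\<bar> ^ (2 * DIM('a)))"
    using c by (intro member_le_sum) auto
  finally have 1: "(1 + M) ^ DIM('a) \<le> 2 ^ DIM('a) * (1 + (\<Sum>b\<in>Basis. \<bar>y \<bullet> b\<bar> ^ (2 * DIM('a))))"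
    by simp
  have "1 \<le> (\<Prod>b\<in>(Basis::'a set). (1 + M) * (1 / (1 + (y \<bullet> b)\<^sup>2)))"
    using M M0 by (intro prod_ge_1) (simp add: add_pos_nonneg)
  also have "\<dots> = (1 + M) ^ DIM('a) * weight y" by (simp add: weight_def prod.distrib prod_dividef)
  also have "\<dots> \<le> 2 ^ DIM('a) * (1 + (\<Sum>b\<in>Basis. \<bar>y \<bullet> b\<bar> ^ (2 * DIM('a)))) * weight y"
    using 1 by (intro mult_right_mono weight_nonneg)
  finally show ?thesis .
qed

section \<open>Fourier transforms of rapidly decreasing functions\<close>

text \<open>Decay without derivatives: a class that is stable under multiplication by polynomials,
  as differentiating a Fourier transform requires, and large enough to contain all derivatives of
  Schwartz functions.\<close>

definition rapid :: "('a::euclidean_space \<Rightarrow> complex) \<Rightarrow> bool" where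
  "rapid f \<longleftrightarrow> f \<in> borel_measurable borel \<and> (\<forall>k::nat. \<exists>C. \<forall>x. (1 + norm x) ^ k * norm (f x) \<le> C)"

lemma rapid_measurable: "rapid f \<Longrightarrow> f \<in> borel_measurable borel"
  by (simp add: rapid_def)

lemma rapid_integrable:
  fixes f :: "'a::euclidean_space \<Rightarrow> complex"
  assumes "rapid f"
  shows "integrable lborel f"
proof -
  from assms obtain C where C: "\<And>x. (1 + norm x) ^ (2 * DIM('a)) * norm (f x) \<le> C"
    unfolding rapid_def by blast
  have "norm (f x) \<le> C * weight x" for x
  proof -
    have "norm (f x) \<le> norm (f x) * ((1 + norm x) ^ (2 * DIM('a)) * weight x)"
      using mult_left_mono[OF weight_ge[of x] norm_ge_zero[of "f x"]] by simp
    also have "\<dots> = ((1 + norm x) ^ (2 * DIM('a)) * norm (f x)) * weight x" by simp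
    also have "\<dots> \<le> C * weight x" by (intro mult_right_mono C weight_nonneg)
    finally show ?thesis .
  qed
  with rapid_measurable[OF assms] show ?thesis by (rule integrable_weight_bound)
qed

lemma rapid_moment:
  assumes f: "rapid f" and [measurable]: "\<phi> \<in> borel_measurable borel"
    and b: "\<And>x. norm (\<phi> x) \<le> (1 + norm x) ^ j"
  shows "rapid (\<lambda>x. \<phi> x * f x)"
  unfolding rapid_def
proof (intro conjI allI)
  have [measurable]: "f \<in> borel_measurable borel" using f by (rule rapid_measurable)
  show "(\<lambda>x. \<phi> x * f x) \<in> borel_measurable borel" by measurable
  fix k
  from f obtain C where C: "\<And>x. (1 + norm x) ^ (k + j) * norm (f x) \<le> C"
    unfolding rapid_def by blast
  show "\<exists>C. \<forall>x. (1 + norm x) ^ k * norm (\<phi> x * f x) \<le> C"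
  proof (intro exI allI)
    fix x
    have "(1 + norm x) ^ k * norm (\<phi> x * f x) = (1 + norm x) ^ k * norm (f x) * norm (\<phi> x)"
      by (simp add: norm_mult)
    also have "\<dots> \<le> (1 + norm x) ^ k * norm (f x) * (1 + norm x) ^ j"
      by (intro mult_left_mono b) auto
    also have "\<dots> \<le> C" using C[of x] by (simp add: power_add mult_ac)
    finally show "(1 + norm x) ^ k * norm (\<phi> x * f x) \<le> C" .
  qed
qed

lemma rapid_inner_power:
  assumes "rapid f" "norm b \<le> 1"
  shows "rapid (\<lambda>x. of_real (x \<bullet> b) ^ j * f x)"
proof (rule rapid_moment[OF assms(1)])
  fix x
  have "\<bar>x \<bullet> b\<bar> \<le> norm x * norm b" by (rule Cauchy_Schwarz_ineq2)
  also have "\<dots> \<le> norm x" using assms(2) by (simp add: mult_left_le)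
  also have "\<dots> \<le> 1 + norm x" by simp
  finally show "norm (of_real (x \<bullet> b) ^ j :: complex) \<le> (1 + norm x) ^ j"
    by (simp add: norm_power power_mono)
qed measurable

lemma norm_cis_diff: "norm (cis t - 1) \<le> \<bar>t\<bar>"
  using iexp_approx1[of t 0] by (simp add: cis_conv_exp)

lemma norm_cis_diff2: "norm (cis t - 1 - \<i> * of_real t) \<le> t\<^sup>2"
proof -
  have "norm (cis t - 1 - \<i> * of_real t) \<le> \<bar>t\<bar> ^ 2 / fact 2"
    using iexp_approx1[of t 1] by (simp add: cis_conv_exp numeral_2_eq_2 algebra_simps)
  then have "norm (cis t - 1 - \<i> * of_real t) \<le> t\<^sup>2 / 2" by simp
  also have "\<dots> \<le> t\<^sup>2" by simp
  finally show ?thesis .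
qed

lemma fourier_integrand_integrable:
  assumes "rapid f"
  shows "integrable lborel (\<lambda>y. f y * cis (- (y \<bullet> \<xi>)))"
  by (rule integrable_mult_bounded[OF rapid_integrable[OF assms], where C=1]) auto

text \<open>The transform is Lipschitz, the constant being the first absolute moment of f.\<close>

lemma continuous_fourier:
  assumes f: "rapid f"
  shows "continuous_on S (fourier f)"
proof -
  have n: "rapid (\<lambda>y. of_real (norm y) * f y)" by (rule rapid_moment[OF f, of _ 1]) auto
  define K where "K = (\<integral>y. norm (complex_of_real (norm y) * f y) \<partial>lborel)"
  have "norm (fourier f \<xi> - fourier f \<eta>) \<le> K * norm (\<xi> - \<eta>)" for \<xi> \<eta>
  proof -
    have "fourier f \<xi> - fourier f \<eta> = (\<integral>y. f y * cis (- (y \<bullet> \<xi>)) - f y * cis (- (y \<bullet> \<eta>)) \<partial>lborel)"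
      unfolding fourier_def by (rule Bochner_Integration.integral_diff[symmetric]) (rule fourier_integrand_integrable[OF f])+
    also have "norm \<dots> \<le> (\<integral>y. norm (f y * cis (- (y \<bullet> \<xi>)) - f y * cis (- (y \<bullet> \<eta>))) \<partial>lborel)"
      by (rule integral_norm_bound)
    also have "\<dots> \<le> (\<integral>y. norm (complex_of_real (norm y) * f y) * norm (\<xi> - \<eta>) \<partial>lborel)"
    proof (rule integral_mono)
      fix y
      have "f y * cis (- (y \<bullet> \<xi>)) - f y * cis (- (y \<bullet> \<eta>)) = f y * cis (- (y \<bullet> \<eta>)) * (cis (- (y \<bullet> (\<xi> - \<eta>))) - 1)"
        by (simp add: algebra_simps cis_mult inner_diff_right)
      also have "norm \<dots> \<le> norm (f y) * \<bar>y \<bullet> (\<xi> - \<eta>)\<bar>"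
        using norm_cis_diff[of "- (y \<bullet> (\<xi> - \<eta>))"] by (simp add: norm_mult mult_left_mono)
      also have "\<dots> \<le> norm (f y) * (norm y * norm (\<xi> - \<eta>))"
        by (intro mult_left_mono Cauchy_Schwarz_ineq2) auto
      finally show "norm (f y * cis (- (y \<bullet> \<xi>)) - f y * cis (- (y \<bullet> \<eta>))) \<le> norm (complex_of_real (norm y) * f y) * norm (\<xi> - \<eta>)"
        by (simp add: norm_mult mult_ac)
    qed (use rapid_integrable[OF n] fourier_integrand_integrable[OF f] in auto)
    also have "\<dots> = K * norm (\<xi> - \<eta>)" unfolding K_def by simp
    finally show ?thesis .
  qed
  \<comment> \<open>A strictly positive constant is needed, because e is divided by it
    below.\<close>
  then have l: "norm (fourier f \<xi> - fourier f \<eta>) \<le> (\<bar>K\<bar> + 1) * norm (\<xi> - \<eta>)" for \<xi> \<eta>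
    by (rule order_trans) (intro mult_right_mono, auto)
  show ?thesis
  proof (rule continuous_onI)
    fix \<xi> and e :: real assume e: "e > 0"
    show "\<exists>d>0. \<forall>x'\<in>S. dist x' \<xi> < d \<longrightarrow> dist (fourier f x') (fourier f \<xi>) \<le> e"
    proof (intro exI[of _ "e / (\<bar>K\<bar> + 1)"] conjI ballI impI)
      fix x' assume "dist x' \<xi> < e / (\<bar>K\<bar> + 1)"
      then have "(\<bar>K\<bar> + 1) * norm (x' - \<xi>) \<le> e" by (simp add: dist_norm field_simps)
      then show "dist (fourier f x') (fourier f \<xi>) \<le> e" using l[of x' \<xi>] by (simp add: dist_norm)
    qed (use e in auto)
  qed
qed

lemma cis_linearise:
  fixes F c r :: complex and u w :: real
  shows "F * (c * r) - F * c - u *\<^sub>R ((- \<i> * of_real w * F) * c) = F * c * (r - 1 - \<i> * of_real (- (u * w)))"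
  by (simp add: scaleR_conv_of_real algebra_simps)

text \<open>Expanding the phase to second order leaves an error bounded by (s - t)^2 times the
  second moment of f along b, which is finite; this is the quadratic bound that yields the
  derivative.\<close>

lemma dir_deriv_fourier:
  assumes f: "rapid f" and b: "norm b \<le> 1"
  shows "dir_deriv b (fourier f) (fourier (\<lambda>y. - \<i> * of_real (y \<bullet> b) * f y))"
  unfolding dir_deriv_def
proof (intro allI has_vector_derivative_quadratic_bound)
  have r1: "rapid (\<lambda>y. of_real (y \<bullet> b) ^ 1 * f y)" and r2: "rapid (\<lambda>y. of_real (y \<bullet> b) ^ 2 * f y)"
    by (rule rapid_inner_power[OF f b])+
  define K where "K = (\<integral>y. norm (complex_of_real (y \<bullet> b) ^ 2 * f y) \<partial>lborel)"
  fix p t s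
  let ?q = "p + t *\<^sub>R b"
  have i1: "integrable lborel (\<lambda>y. (- \<i> * of_real (y \<bullet> b) * f y) * cis (- (y \<bullet> ?q)))"
    using integrable_mult_right[OF fourier_integrand_integrable[OF r1, of ?q], of "- \<i>"] by (simp add: mult_ac)
  let ?A = "\<lambda>y. f y * cis (- (y \<bullet> (p + s *\<^sub>R b)))" and ?B = "\<lambda>y. f y * cis (- (y \<bullet> ?q))"
  let ?D = "\<lambda>y. (s - t) *\<^sub>R ((- \<i> * of_real (y \<bullet> b) * f y) * cis (- (y \<bullet> ?q)))"
  have iA: "integrable lborel ?A" and iB: "integrable lborel ?B"
    by (rule fourier_integrand_integrable[OF f])+
  have iD: "integrable lborel ?D" by (rule integrable_scaleR_right[OF i1])
  have "(\<integral>y. ?A y - ?B y - ?D y \<partial>lborel) = (\<integral>y. ?A y \<partial>lborel) - (\<integral>y. ?B y \<partial>lborel) - (\<integral>y. ?D y \<partial>lborel)"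
    by (subst Bochner_Integration.integral_diff[OF Bochner_Integration.integrable_diff[OF iA iB] iD],
        subst Bochner_Integration.integral_diff[OF iA iB], rule refl)
  then have eq: "norm (fourier f (p + s *\<^sub>R b) - fourier f ?q - (s - t) *\<^sub>R fourier (\<lambda>y. - \<i> * of_real (y \<bullet> b) * f y) ?q)
    = norm (\<integral>y. ?A y - ?B y - ?D y \<partial>lborel)"
    unfolding fourier_def by (simp only: integral_scaleR_right)
  have "norm (\<integral>y. ?A y - ?B y - ?D y \<partial>lborel) \<le> (\<integral>y. norm (?A y - ?B y - ?D y) \<partial>lborel)"
    by (rule integral_norm_bound)
  also have "\<dots> \<le> (\<integral>y. norm (complex_of_real (y \<bullet> b) ^ 2 * f y) * (s - t)\<^sup>2 \<partial>lborel)"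
  proof (rule integral_mono)
    fix y
    let ?r = "- ((s - t) * (y \<bullet> b))"
    have "cis (- (y \<bullet> (p + s *\<^sub>R b))) = cis (- (y \<bullet> ?q)) * cis ?r"
      unfolding cis_mult by (rule arg_cong[where f=cis]) (simp add: inner_add_right left_diff_distrib)
    then have e: "?A y - ?B y - ?D y = f y * cis (- (y \<bullet> ?q)) * (cis ?r - 1 - \<i> * of_real ?r)"
      by (simp only: cis_linearise)
    have "norm (cis (- (y \<bullet> ?q))) = 1" by simp
    then have "norm (?A y - ?B y - ?D y) = norm (f y) * norm (cis ?r - 1 - \<i> * of_real ?r)"
      unfolding e norm_mult by simp
    also have "\<dots> \<le> norm (f y) * ?r\<^sup>2"
      by (intro mult_left_mono norm_cis_diff2) auto
    finally show "norm (?A y - ?B y - ?D y) \<le> norm (complex_of_real (y \<bullet> b) ^ 2 * f y) * (s - t)\<^sup>2"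
      by (simp add: norm_mult norm_power power_mult_distrib mult_ac)
  next
    show "integrable lborel (\<lambda>y. norm (?A y - ?B y - ?D y))"
      by (intro integrable_norm Bochner_Integration.integrable_diff iA iB iD)
    show "integrable lborel (\<lambda>y. norm (complex_of_real (y \<bullet> b) ^ 2 * f y) * (s - t)\<^sup>2)"
      by (intro integrable_mult_left integrable_norm rapid_integrable[OF r2])
  qed
  also have "\<dots> = K * (s - t)\<^sup>2" unfolding K_def by simp
  finally show "norm (fourier f (p + s *\<^sub>R b) - fourier f ?q - (s - t) *\<^sub>R fourier (\<lambda>y. - \<i> * of_real (y \<bullet> b) * f y) ?q) \<le> K * (s - t)\<^sup>2" unfolding eq .
qed

section \<open>Schwartz functions\<close>

lemma iter_deriv_append: "iter_deriv ds (iter_deriv es f) = iter_deriv (ds @ es) f"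
  by (induction ds) auto

text \<open>Applied with \<open>m = 1 / (1 + i((y - x0) \<bullet> b))\<close>: since \<open>\<partial>\<^sub>d m = - i(d \<bullet> b) m\<^sup>2\<close>, these sums are closed under
  differentiation, which shows that \<open>m f\<close> is a Schwartz function without a Leibniz rule for higher derivatives.\<close>

inductive weighted_span :: "('a::real_normed_vector \<Rightarrow> complex) \<Rightarrow> (('a \<Rightarrow> complex) \<Rightarrow> bool) \<Rightarrow> ('a \<Rightarrow> complex) \<Rightarrow> bool"
  for m P where
  base: "P f \<Longrightarrow> weighted_span m P (\<lambda>y. c * m y ^ j * f y)"
| add: "weighted_span m P f \<Longrightarrow> weighted_span m P g \<Longrightarrow> weighted_span m P (\<lambda>y. f y + g y)"

text \<open>The inverse of a complex linear weight: 1 + i t is smooth, has modulus at least 1, so no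
  singularity appears, and multiplication by it is a first-order differential operator on the
  Fourier side.\<close>

definition wfac :: "'a::euclidean_space \<Rightarrow> 'a \<Rightarrow> 'a \<Rightarrow> complex" where
  "wfac x0 b y = inverse (1 + \<i> * of_real ((y - x0) \<bullet> b))"

lemma wfac_denominator_neq_0: "1 + \<i> * complex_of_real t \<noteq> 0"
  by (simp add: complex_eq_iff)

lemma norm_wfac: "(norm (wfac x0 b y))\<^sup>2 = 1 / (1 + ((y - x0) \<bullet> b)\<^sup>2)"
proof -
  have "(norm (1 + \<i> * complex_of_real t))\<^sup>2 = 1 + t\<^sup>2" for t
    by (simp add: cmod_power2)
  then show ?thesis unfolding wfac_def norm_inverse power_inverse by (simp add: inverse_eq_divide)
qed

lemma norm_wfac_le_1: "norm (wfac x0 b y) \<le> 1"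
proof -
  have "(norm (wfac x0 b y))\<^sup>2 \<le> 1" unfolding norm_wfac by (simp add: add_pos_nonneg)
  then show ?thesis by (simp add: power_le_one_iff abs_le_square_iff[symmetric] flip: abs_square_le_1)
qed

lemma wfac_derivative:
  "(wfac x0 b has_derivative (\<lambda>d. - \<i> * of_real (d \<bullet> b) * wfac x0 b y ^ 2)) (at y)"
proof -
  have "((\<lambda>y. inverse (1 + \<i> * complex_of_real ((y - x0) \<bullet> b))) has_derivative
     (\<lambda>d. - (inverse (1 + \<i> * of_real ((y - x0) \<bullet> b)) * (\<i> * of_real (d \<bullet> b)) * inverse (1 + \<i> * of_real ((y - x0) \<bullet> b))))) (at y)"
    by (rule Deriv.has_derivative_inverse) (auto intro!: derivative_eq_intros simp: wfac_denominator_neq_0)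
  then show ?thesis unfolding wfac_def by (simp add: power2_eq_square mult_ac)
qed

lemma weighted_span_deriv:
  assumes h: "weighted_span (wfac x0 b) P h"
    and P: "\<And>f y. P f \<Longrightarrow> f differentiable (at y)"
    and Pd: "\<And>f. P f \<Longrightarrow> P (\<lambda>y. frechet_derivative f (at y) d)"
  shows "h differentiable (at y)"
    and "weighted_span (wfac x0 b) P (\<lambda>y. frechet_derivative h (at y) d)"
proof -
  have "(\<forall>y. h differentiable (at y)) \<and> weighted_span (wfac x0 b) P (\<lambda>y. frechet_derivative h (at y) d)"
    using h
  proof induction
    case (base f c j)
    let ?m = "wfac x0 b"
    have f': "(f has_derivative frechet_derivative f (at y)) (at y)" for y
      using P[OF base] by (simp add: frechet_derivative_works[symmetric])
    have D: "((\<lambda>y. c * ?m y ^ j * f y) has_derivative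
      (\<lambda>e. (c * (of_nat j * (- \<i> * of_real (e \<bullet> b) * ?m y ^ 2) * ?m y ^ (j - 1))) * f y + c * ?m y ^ j * frechet_derivative f (at y) e)) (at y)" for y
      by (rule derivative_eq_intros wfac_derivative f' refl | simp add: algebra_simps)+
    have "(\<lambda>y. frechet_derivative (\<lambda>y. c * ?m y ^ j * f y) (at y) d) =
      (\<lambda>y. (c * of_nat j * (- \<i> * of_real (d \<bullet> b))) * ?m y ^ (j + 1) * f y + c * ?m y ^ j * frechet_derivative f (at y) d)"
    proof
      fix y
      \<comment> \<open>For j = 0 the exponent \<open>j - 1\<close> is cut off at 0, but the term
        then carries the factor j = 0.\<close>
      have "?m y ^ 2 * ?m y ^ (j - 1) = ?m y ^ (j + 1)" if "j \<noteq> 0"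
        using that by (cases j) (auto simp: power2_eq_square)
      then show "frechet_derivative (\<lambda>y. c * ?m y ^ j * f y) (at y) d =
         (c * of_nat j * (- \<i> * of_real (d \<bullet> b))) * ?m y ^ (j + 1) * f y + c * ?m y ^ j * frechet_derivative f (at y) d"
        unfolding frechet_derivative_at[OF D, symmetric] by (cases "j = 0") (auto simp: mult_ac)
    qed
    moreover have "weighted_span ?m P (\<lambda>y. (c * of_nat j * (- \<i> * of_real (d \<bullet> b))) * ?m y ^ (j + 1) * f y + c * ?m y ^ j * frechet_derivative f (at y) d)"
      by (intro weighted_span.intros base Pd[OF base])
    ultimately have "weighted_span ?m P (\<lambda>y. frechet_derivative (\<lambda>y. c * ?m y ^ j * f y) (at y) d)"
      by (simp only:)
    then show ?case using D unfolding differentiable_def by blast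
  next
    case (add f g)
    have f': "(f has_derivative frechet_derivative f (at y)) (at y)"
      and g': "(g has_derivative frechet_derivative g (at y)) (at y)" for y
      using add.IH by (simp_all add: frechet_derivative_works[symmetric])
    have "(\<lambda>y. frechet_derivative (\<lambda>y. f y + g y) (at y) d) =
       (\<lambda>y. frechet_derivative f (at y) d + frechet_derivative g (at y) d)"
      using frechet_derivative_at[OF has_derivative_add[OF f' g'], symmetric] by simp
    then show ?case
      using add.IH has_derivative_add[OF f' g'] by (auto simp: differentiable_def intro!: weighted_span.intros)
  qed
  then show "h differentiable (at y)" and "weighted_span (wfac x0 b) P (\<lambda>y. frechet_derivative h (at y) d)"
    by auto
qed

text \<open>\<open>D\<close> limits the directions of differentiation, since
  \<open>smooth_fun\<close> is stable under all derivatives while the decay in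
  \<open>schwartz\<close> is only required for lists of basis vectors.\<close>

lemma weighted_span_iter_deriv:
  assumes h: "weighted_span (wfac x0 b) P h" and ds: "ds \<in> lists D"
    and P: "\<And>f y. P f \<Longrightarrow> f differentiable (at y)"
    and Pd: "\<And>f d. P f \<Longrightarrow> d \<in> D \<Longrightarrow> P (\<lambda>y. frechet_derivative f (at y) d)"
  shows "weighted_span (wfac x0 b) P (iter_deriv ds h)"
  using ds
proof (induction ds)
  case (Cons d ds)
  then show ?case
    using weighted_span_deriv(2)[of x0 b P "iter_deriv ds h" d] P Pd by simp
qed (simp add: h)

lemma smooth_fun_deriv: "smooth_fun f \<Longrightarrow> smooth_fun (\<lambda>y. frechet_derivative f (at y) d)"
  unfolding smooth_fun_def using iter_deriv_append[of _ "[d]" f] by simp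

lemma schwartz_deriv: "schwartz f \<Longrightarrow> d \<in> Basis \<Longrightarrow> schwartz (\<lambda>y. frechet_derivative f (at y) d)"
  unfolding schwartz_def using iter_deriv_append[of _ "[d]" f] by (auto intro: smooth_fun_deriv)

lemma smooth_fun_differentiable: "smooth_fun f \<Longrightarrow> f differentiable (at y)"
  unfolding smooth_fun_def by (metis iter_deriv.simps(1))

lemma schwartz_smooth: "schwartz f \<Longrightarrow> smooth_fun f"
  by (simp add: schwartz_def)

lemma schwartz_imp_rapid:
  fixes f :: "real^'n::finite \<Rightarrow> complex"
  assumes "schwartz f" "ds \<in> lists Basis"
  shows "rapid (iter_deriv ds f)"
  unfolding rapid_def
  using assms continuous_iter_deriv[of f UNIV ds]
  by (auto simp: schwartz_def intro: borel_measurable_continuous_onI)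

lemma schwartz_rapid: "schwartz f \<Longrightarrow> rapid f"
  using schwartz_imp_rapid[of f "[]"] by simp

text \<open>The span argument is run twice: over \<open>smooth_fun\<close> with all directions, to
  obtain smoothness, and over \<open>schwartz\<close> with basis directions, to obtain decay. In the
  second run each generator is rapidly decreasing because \<open>wfac\<close> is bounded by
  1.\<close>

lemma schwartz_wfac_mult:
  fixes f :: "real^'n::finite \<Rightarrow> complex"
  assumes f: "schwartz f"
  shows "schwartz (\<lambda>y. wfac x0 b y * f y)"
proof -
  let ?h = "\<lambda>y. wfac x0 b y * f y"
  have base: "weighted_span (wfac x0 b) P ?h" if "P f" for P
    using weighted_span.base[of P f "wfac x0 b" 1 1, OF that] by simp
  have sm: "weighted_span (wfac x0 b) smooth_fun (iter_deriv ds ?h)" for ds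
    by (rule weighted_span_iter_deriv[where D=UNIV])
       (use f in \<open>auto intro!: base smooth_fun_deriv smooth_fun_differentiable simp: schwartz_def\<close>)
  have "smooth_fun ?h"
    unfolding smooth_fun_def
    using weighted_span_deriv(1)[OF sm smooth_fun_differentiable smooth_fun_deriv] by blast
  moreover have "rapid (iter_deriv ds ?h)" if "ds \<in> lists Basis" for ds
  proof -
    have "weighted_span (wfac x0 b) schwartz (iter_deriv ds ?h)"
      by (rule weighted_span_iter_deriv[OF base[where P=schwartz, OF f] that])
         (auto intro: schwartz_deriv smooth_fun_differentiable[OF schwartz_smooth])
    then show ?thesis
    proof induction
      case (base f c j)
      have [measurable]: "wfac x0 b \<in> borel_measurable borel" unfolding wfac_def by measurable
      have "rapid (\<lambda>y. wfac x0 b y ^ j * f y)"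
        by (rule rapid_moment[OF schwartz_rapid[OF base], of _ 0])
           (auto simp: norm_power power_le_one norm_wfac_le_1)
      then show ?case unfolding rapid_def
      proof (intro conjI allI; elim conjE)
        fix k
        assume "\<forall>k::nat. \<exists>C. \<forall>x. (1 + norm x) ^ k * norm (wfac x0 b x ^ j * f x) \<le> C"
        then obtain C where C: "\<And>x. (1 + norm x) ^ k * norm (wfac x0 b x ^ j * f x) \<le> C" by blast
        have "(1 + norm x) ^ k * norm (c * wfac x0 b x ^ j * f x) \<le> norm c * C" for x
          using mult_left_mono[OF C[of x] norm_ge_zero[of c]] by (simp add: norm_mult mult_ac)
        then show "\<exists>C. \<forall>x. (1 + norm x) ^ k * norm (c * wfac x0 b x ^ j * f x) \<le> C" by blast
      next
        assume "(\<lambda>y. wfac x0 b y ^ j * f y) \<in> borel_measurable borel"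
        then have "(\<lambda>y. c * (wfac x0 b y ^ j * f y)) \<in> borel_measurable borel" by measurable
        then show "(\<lambda>y. c * wfac x0 b y ^ j * f y) \<in> borel_measurable borel" by (simp add: mult_ac)
      qed
    next
      case (add f g)
      then have [measurable]: "f \<in> borel_measurable borel" "g \<in> borel_measurable borel"
        by (simp_all add: rapid_measurable)
      show ?case unfolding rapid_def
      proof (intro conjI allI)
        fix k
        obtain C D where C: "\<And>x. (1 + norm x) ^ k * norm (f x) \<le> C" and D: "\<And>x. (1 + norm x) ^ k * norm (g x) \<le> D"
          using add.IH unfolding rapid_def by meson
        have "(1 + norm x) ^ k * norm (f x + g x) \<le> C + D" for x
        proof -
          have "(1 + norm x) ^ k * norm (f x + g x) \<le> (1 + norm x) ^ k * (norm (f x) + norm (g x))"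
            by (intro mult_left_mono norm_triangle_ineq) auto
          also have "\<dots> \<le> C + D" using C[of x] D[of x] by (simp add: distrib_left)
          finally show ?thesis .
        qed
        then show "\<exists>C. \<forall>x. (1 + norm x) ^ k * norm (f x + g x) \<le> C" by blast
      qed measurable
    qed
  qed
  ultimately show ?thesis unfolding schwartz_def rapid_def by blast
qed

section \<open>Derivatives and decay of the Fourier transform of a Schwartz function\<close>

lemma dir_deriv_mult:
  assumes "dir_deriv c u u'" "dir_deriv c w w'"
  shows "dir_deriv c (\<lambda>v. u v * w v) (\<lambda>v. u v * w' v + u' v * w v)"
  unfolding dir_deriv_def
  by (intro allI has_vector_derivative_mult dir_derivD assms)

lemma dir_deriv_cis: "dir_deriv c (\<lambda>v. cis (X \<bullet> v)) (\<lambda>v. \<i> * of_real (X \<bullet> c) * cis (X \<bullet> v))"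
proof (rule has_derivative_imp_dir_deriv)
  show "((\<lambda>v. cis (X \<bullet> v)) has_derivative (\<lambda>d. (X \<bullet> d) *\<^sub>R (\<i> * cis (X \<bullet> p)))) (at p)" for p
    by (rule has_derivative_compose[of "\<lambda>v. X \<bullet> v" "\<lambda>d. X \<bullet> d" p UNIV cis "\<lambda>t. t *\<^sub>R (\<i> * cis (X \<bullet> p))"])
       (auto intro!: derivative_eq_intros simp: cis_conv_exp scaleR_conv_of_real mult_ac
         has_derivative_bounded_linear bounded_linear_inner_right bounded_linear_imp_has_derivative)
qed (simp add: scaleR_conv_of_real)

text \<open>Integration by parts: f times the character is integrable together with its
  b-derivative, so that derivative has integral 0.\<close>

lemma fourier_deriv:
  assumes f: "rapid f" and f': "rapid f'" and d: "dir_deriv b f f'"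
    and c: "continuous_on UNIV f" "continuous_on UNIV f'"
  shows "fourier f' \<xi> = \<i> * of_real (\<xi> \<bullet> b) * fourier f \<xi>"
proof -
  let ?h = "\<lambda>y. f y * cis (- \<xi> \<bullet> y)"
  let ?h' = "\<lambda>y. f y * (\<i> * of_real (- \<xi> \<bullet> b) * cis (- \<xi> \<bullet> y)) + f' y * cis (- \<xi> \<bullet> y)"
  note i = fourier_integrand_integrable[OF f, of \<xi>] fourier_integrand_integrable[OF f', of \<xi>]
  have i1: "integrable lborel (\<lambda>y. f y * (\<i> * of_real (- \<xi> \<bullet> b) * cis (- \<xi> \<bullet> y)))"
    using integrable_mult_right[OF i(1), of "\<i> * of_real (- \<xi> \<bullet> b)"] by (simp add: inner_commute mult_ac)
  have i2: "integrable lborel (\<lambda>y. f' y * cis (- \<xi> \<bullet> y))"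
    using i(2) by (simp add: inner_commute)
  have "(\<integral>y. ?h' y \<partial>lborel) = 0"
  proof (rule integral_dir_deriv_eq_0)
    show "dir_deriv b ?h ?h'" by (rule dir_deriv_mult[OF d dir_deriv_cis])
    show "integrable lborel ?h" using i(1) by (simp add: inner_commute)
    show "integrable lborel ?h'" by (rule Bochner_Integration.integrable_add[OF i1 i2])
    show "continuous_on UNIV ?h'" by (intro continuous_intros c)
  qed
  then have "(\<integral>y. f y * (\<i> * of_real (- \<xi> \<bullet> b) * cis (- \<xi> \<bullet> y)) \<partial>lborel) + (\<integral>y. f' y * cis (- \<xi> \<bullet> y) \<partial>lborel) = 0"
    by (subst (asm) Bochner_Integration.integral_add[OF i1 i2])
  moreover have "(\<integral>y. f' y * cis (- \<xi> \<bullet> y) \<partial>lborel) = fourier f' \<xi>"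
    by (simp add: fourier_def inner_commute)
  moreover have "(\<integral>y. f y * (\<i> * of_real (- \<xi> \<bullet> b) * cis (- \<xi> \<bullet> y)) \<partial>lborel)
      = (\<integral>y. (\<i> * of_real (- \<xi> \<bullet> b)) * (f y * cis (- \<xi> \<bullet> y)) \<partial>lborel)"
    by (simp add: mult_ac)
  moreover have "\<dots> = (\<i> * of_real (- \<xi> \<bullet> b)) * fourier f \<xi>"
    unfolding fourier_def by (subst integral_mult_right_zero) (simp add: inner_commute)
  ultimately show ?thesis by (simp add: add_eq_0_iff)
qed

lemma norm_fourier_le: "norm (fourier f \<xi>) \<le> (\<integral>y. norm (f y) \<partial>lborel)"
  unfolding fourier_def by (rule order_trans[OF integral_norm_bound]) (simp add: norm_mult)

lemma fourier_iter_deriv: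
  fixes f :: "real^'n::finite \<Rightarrow> complex"
  assumes f: "schwartz f" and b: "b \<in> Basis"
  shows "fourier (iter_deriv (replicate k b) f) \<xi> = (\<i> * of_real (\<xi> \<bullet> b)) ^ k * fourier f \<xi>"
proof (induction k)
  case (Suc k)
  have l: "replicate j b \<in> lists Basis" for j using b by (induction j) auto
  have sm: "smooth_fun f" using f by (simp add: schwartz_def)
  have "fourier (iter_deriv (b # replicate k b) f) \<xi> = \<i> * of_real (\<xi> \<bullet> b) * fourier (iter_deriv (replicate k b) f) \<xi>"
    by (rule fourier_deriv)
       (use schwartz_imp_rapid[OF f l] schwartz_imp_rapid[OF f l[of "Suc k"]] dir_deriv_iter_deriv[OF sm]
         continuous_iter_deriv[OF sm] continuous_iter_deriv[OF sm, of UNIV "b # replicate k b"] in auto)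
  with Suc show ?case by simp
qed simp

text \<open>Each coordinate power of \<xi> comes from a repeated derivative of f, and
  \<open>weight_ge_coordinates\<close> combines them. The order 2n is the total degree of the
  polynomial 1 / \<open>weight\<close>.\<close>

lemma fourier_decay:
  fixes f :: "real^'n::finite \<Rightarrow> complex"
  assumes f: "schwartz f"
  shows "\<exists>C. \<forall>\<xi>. norm (fourier f \<xi>) \<le> C * weight \<xi>"
proof -
  let ?d = "DIM(real^'n)"
  define I where "I h = (\<integral>y. norm (h y) \<partial>lborel)" for h :: "real^'n \<Rightarrow> complex"
  define C where "C = 2 ^ ?d * (I f + (\<Sum>b\<in>Basis. I (iter_deriv (replicate (2 * ?d) b) f)))"
  have "norm (fourier f \<xi>) \<le> C * weight \<xi>" for \<xi>
  proof -
    have 1: "\<bar>\<xi> \<bullet> b\<bar> ^ (2 * ?d) * norm (fourier f \<xi>) \<le> I (iter_deriv (replicate (2 * ?d) b) f)" if "b \<in> Basis" for b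
      using norm_fourier_le[of "iter_deriv (replicate (2 * ?d) b) f" \<xi>] fourier_iter_deriv[OF f that, of "2 * ?d" \<xi>]
      by (simp add: norm_mult norm_power I_def)
    have "norm (fourier f \<xi>) \<le> norm (fourier f \<xi>) * (2 ^ ?d * (1 + (\<Sum>b\<in>Basis. \<bar>\<xi> \<bullet> b\<bar> ^ (2 * ?d))) * weight \<xi>)"
      using mult_left_mono[OF weight_ge_coordinates[of \<xi>] norm_ge_zero[of "fourier f \<xi>"]] by simp
    also have "\<dots> = 2 ^ ?d * (norm (fourier f \<xi>) + (\<Sum>b\<in>Basis. \<bar>\<xi> \<bullet> b\<bar> ^ (2 * ?d) * norm (fourier f \<xi>))) * weight \<xi>"
      by (simp add: sum_distrib_left algebra_simps del: DIM_cart)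
    also have "\<dots> \<le> C * weight \<xi>"
      unfolding C_def using 1 norm_fourier_le[of f \<xi>]
      by (intro mult_right_mono mult_left_mono add_mono sum_mono weight_nonneg) (auto simp: I_def)
    finally show ?thesis .
  qed
  then show ?thesis by blast
qed

lemma integrable_fourier:
  fixes f :: "real^'n::finite \<Rightarrow> complex"
  assumes "schwartz f"
  shows "integrable lborel (fourier f)"
  using fourier_decay[OF assms] continuous_fourier[OF schwartz_rapid[OF assms], of UNIV]
  by (auto intro: integrable_weight_bound borel_measurable_continuous_onI)

lemma fourier_measurable:
  "schwartz f \<Longrightarrow> fourier f \<in> borel_measurable borel"
  using continuous_fourier[OF schwartz_rapid, of f UNIV] by (auto intro: borel_measurable_continuous_onI)

section \<open>Oscillatory integrals with weights\<close>

text \<open>\<open>\<beta>\<close> is a symbol with its space variable frozen and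
  \<open>\<Phi>\<close> the Fourier transform of a function on the doubled space; the point X of
  that space need not lie on the diagonal.\<close>

definition osc :: "('a::euclidean_space \<Rightarrow> complex) \<Rightarrow> ('a \<Rightarrow> complex) \<Rightarrow> 'a \<Rightarrow> complex" where
  "osc \<beta> \<Phi> X = (\<integral>v. \<beta> v * \<Phi> v * cis (X \<bullet> v) \<partial>lborel)"

lemma integrable_osc:
  assumes "integrable lborel \<Phi>" "continuous_on UNIV \<beta>" "\<And>v. norm (\<beta> v) \<le> B"
  shows "integrable lborel (\<lambda>v. \<beta> v * \<Phi> v * cis (X \<bullet> v))"
proof -
  have [measurable]: "\<beta> \<in> borel_measurable borel" using assms(2) by (rule borel_measurable_continuous_onI)
  have "integrable lborel (\<lambda>v. \<Phi> v * (\<beta> v * cis (X \<bullet> v)))"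
    by (rule integrable_mult_bounded[OF assms(1), where C=B]) (auto simp: norm_mult assms)
  then show ?thesis by (simp add: mult_ac)
qed

text \<open>Multiplying a function by the linear weight \<open>1 + i(y \<bullet> b - c)\<close> turns its Fourier transform \<open>\<Phi>\<close> into
  \<open>\<Phi>1 = (1 - ic)\<Phi> - \<partial>\<^sub>b\<Phi>\<close>; integration by parts moves the derivative onto the symbol and the phase.\<close>

lemma osc_step:
  fixes \<beta> \<Phi> :: "'a::euclidean_space \<Rightarrow> complex" and c :: real
  assumes \<beta>: "dir_deriv b \<beta> \<beta>'" "continuous_on UNIV \<beta>" "continuous_on UNIV \<beta>'"
    and B: "\<And>v. norm (\<beta> v) \<le> B" "\<And>v. norm (\<beta>' v) \<le> B'"
    and \<Phi>: "integrable lborel \<Phi>" "continuous_on UNIV \<Phi>"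
    and \<Phi>1: "integrable lborel \<Phi>1" "continuous_on UNIV \<Phi>1"
    and d: "dir_deriv b \<Phi> (\<lambda>v. (1 - \<i> * of_real c) * \<Phi> v - \<Phi>1 v)"
  shows "osc \<beta> \<Phi>1 X = (1 + \<i> * of_real (X \<bullet> b - c)) * osc \<beta> \<Phi> X + osc \<beta>' \<Phi> X"
proof -
  let ?e = "\<lambda>v. cis (X \<bullet> v)"
  define h' where "h' v = (\<beta> v * \<Phi> v) * (\<i> * of_real (X \<bullet> b) * ?e v)
     + (\<beta> v * ((1 - \<i> * of_real c) * \<Phi> v - \<Phi>1 v) + \<beta>' v * \<Phi> v) * ?e v" for v
  note i1 = integrable_osc[OF \<Phi>(1) \<beta>(2) B(1), of X] and i2 = integrable_osc[OF \<Phi>1(1) \<beta>(2) B(1), of X]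
    and i3 = integrable_osc[OF \<Phi>(1) \<beta>(3) B(2), of X]
  let ?k = "1 + \<i> * of_real (X \<bullet> b - c)"
  have eq: "h' v = ?k * (\<beta> v * \<Phi> v * ?e v) - \<beta> v * \<Phi>1 v * ?e v + \<beta>' v * \<Phi> v * ?e v" for v
    unfolding h'_def of_real_diff by algebra
  have i12: "integrable lborel (\<lambda>v. ?k * (\<beta> v * \<Phi> v * ?e v) - \<beta> v * \<Phi>1 v * ?e v)"
    by (rule Bochner_Integration.integrable_diff[OF integrable_mult_right[OF i1] i2])
  have "(\<integral>v. h' v \<partial>lborel) = 0"
  proof (rule integral_dir_deriv_eq_0)
    show "dir_deriv b (\<lambda>v. \<beta> v * \<Phi> v * ?e v) h'"
      unfolding h'_def by (intro dir_deriv_mult dir_deriv_cis \<beta> d)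
    show "integrable lborel (\<lambda>v. \<beta> v * \<Phi> v * ?e v)" by (rule i1)
    show "integrable lborel h'"
      unfolding eq by (rule Bochner_Integration.integrable_add[OF i12 i3])
    show "continuous_on UNIV h'" unfolding h'_def by (intro continuous_intros \<beta> \<Phi> \<Phi>1)
  qed
  also have "(\<integral>v. h' v \<partial>lborel) = ?k * osc \<beta> \<Phi> X - osc \<beta> \<Phi>1 X + osc \<beta>' \<Phi> X"
    unfolding eq osc_def
    by (simp only: Bochner_Integration.integral_add[OF i12 i3]
        Bochner_Integration.integral_diff[OF integrable_mult_right[OF i1] i2] integral_mult_right_zero)
  finally show ?thesis by (simp add: algebra_simps)
qed

section \<open>Weights on the two factors of a tensor product\<close>

definition ftens :: "(real^'n::finite \<Rightarrow> complex) \<Rightarrow> (real^'n \<Rightarrow> complex) \<Rightarrow> (real^'n) \<times> (real^'n) \<Rightarrow> complex" where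
  "ftens f g v = fourier f (fst v) * fourier g (snd v)"

lemma integrable_ftens:
  assumes "schwartz f" "schwartz g"
  shows "integrable lborel (ftens f g)"
  using integrable_pair_bounded_kernel[OF integrable_fourier[OF assms(1)] integrable_fourier[OF assms(2)], of "\<lambda>_. 1" 1]
  unfolding lborel_prod by (simp add: ftens_def[abs_def] split_beta')

lemma continuous_ftens:
  assumes "schwartz f" "schwartz g"
  shows "continuous_on S (ftens f g)"
  unfolding ftens_def[abs_def]
  by (intro continuous_intros continuous_on_compose2[OF continuous_fourier[OF schwartz_rapid, of _ UNIV]] assms) auto

text \<open>Since f = (1 + i(y - x0) . e) f1, and multiplication by -i(y . e) becomes the derivative
  along e, the transform of f is (1 - i x0 . e) times that of f1 minus its e-derivative. This is the
  derivative assumption of \<open>osc_step\<close> with c = x0 . e.\<close>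

lemma dir_deriv_fourier_wfac:
  fixes f :: "real^'n::finite \<Rightarrow> complex" and x0 :: "real^'n"
  assumes f: "schwartz f" and e: "e \<in> Basis"
  defines "f1 \<equiv> \<lambda>y. wfac x0 e y * f y"
  shows "dir_deriv e (fourier f1) (\<lambda>\<xi>. (1 - \<i> * of_real (x0 \<bullet> e)) * fourier f1 \<xi> - fourier f \<xi>)"
proof -
  have f1: "schwartz f1" unfolding f1_def by (rule schwartz_wfac_mult[OF f])
  let ?k = "1 - \<i> * of_real (x0 \<bullet> e)"
  have "- \<i> * of_real (y \<bullet> e) * f1 y = ?k * f1 y - f y" for y
  proof -
    have "(1 + \<i> * of_real ((y - x0) \<bullet> e)) * f1 y = f y"
      unfolding f1_def wfac_def using wfac_denominator_neq_0[of "(y - x0) \<bullet> e"] by simp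
    then show ?thesis unfolding inner_diff_left of_real_diff by (auto simp: algebra_simps dest: sym)
  qed
  then have eq: "- \<i> * of_real (y \<bullet> e) * f1 y * z = ?k * (f1 y * z) - f y * z" for y z
    by (simp only: left_diff_distrib mult.assoc)
  have "fourier (\<lambda>y. - \<i> * of_real (y \<bullet> e) * f1 y) \<xi> = ?k * fourier f1 \<xi> - fourier f \<xi>" for \<xi>
    unfolding fourier_def eq
    by (subst Bochner_Integration.integral_diff[OF integrable_mult_right[OF fourier_integrand_integrable[OF schwartz_rapid[OF f1]]]
        fourier_integrand_integrable[OF schwartz_rapid[OF f]]]) (simp only: integral_mult_right_zero)
  then have "fourier (\<lambda>y. - \<i> * of_real (y \<bullet> e) * f1 y) = (\<lambda>\<xi>. ?k * fourier f1 \<xi> - fourier f \<xi>)"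
    by (rule ext)
  with dir_deriv_fourier[OF schwartz_rapid[OF f1], of e] e show ?thesis by (simp only: norm_Basis order_refl)
qed

lemma dir_deriv_ftens_fst:
  fixes e :: "real^'n::finite"
  assumes "dir_deriv e (fourier f) F'"
  shows "dir_deriv (e, 0) (ftens f g) (\<lambda>v. F' (fst v) * fourier g (snd v))"
  unfolding dir_deriv_def ftens_def
  by (auto intro!: has_vector_derivative_mult_left dir_derivD[OF assms])

lemma dir_deriv_ftens_snd:
  fixes e :: "real^'n::finite"
  assumes "dir_deriv e (fourier g) G'"
  shows "dir_deriv (0, e) (ftens f g) (\<lambda>v. fourier f (fst v) * G' (snd v))"
  unfolding dir_deriv_def ftens_def
  by (auto intro!: has_vector_derivative_mult_right dir_derivD[OF assms])

lemma osc_step_fst: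
  fixes f g :: "real^'n::finite \<Rightarrow> complex"
  assumes f: "schwartz f" and g: "schwartz g" and e: "e \<in> Basis"
    and \<beta>: "dir_deriv (e, 0) \<beta> \<beta>'" "continuous_on UNIV \<beta>" "continuous_on UNIV \<beta>'"
    and B: "\<And>v. norm (\<beta> v) \<le> B" "\<And>v. norm (\<beta>' v) \<le> B'"
  shows "osc \<beta> (ftens f g) (x, x') = (1 + \<i> * of_real ((x - x0) \<bullet> e)) * osc \<beta> (ftens (\<lambda>y. wfac x0 e y * f y) g) (x, x')
     + osc \<beta>' (ftens (\<lambda>y. wfac x0 e y * f y) g) (x, x')"
proof -
  note f1 = schwartz_wfac_mult[OF f, of x0 e]
  have d: "dir_deriv (e, 0) (ftens (\<lambda>y. wfac x0 e y * f y) g)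
     (\<lambda>v. (1 - \<i> * of_real (x0 \<bullet> e)) * ftens (\<lambda>y. wfac x0 e y * f y) g v - ftens f g v)"
    using dir_deriv_ftens_fst[OF dir_deriv_fourier_wfac[OF f e, of x0], of g]
    by (simp add: ftens_def left_diff_distrib mult.assoc)
  show ?thesis
    using osc_step[OF \<beta> B integrable_ftens[OF f1 g] continuous_ftens[OF f1 g]
        integrable_ftens[OF f g] continuous_ftens[OF f g] d, of "(x, x')"]
    by (simp add: inner_diff_left)
qed

lemma osc_step_snd:
  fixes f g :: "real^'n::finite \<Rightarrow> complex"
  assumes f: "schwartz f" and g: "schwartz g" and e: "e \<in> Basis"
    and \<beta>: "dir_deriv (0, e) \<beta> \<beta>'" "continuous_on UNIV \<beta>" "continuous_on UNIV \<beta>'"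
    and B: "\<And>v. norm (\<beta> v) \<le> B" "\<And>v. norm (\<beta>' v) \<le> B'"
  shows "osc \<beta> (ftens f g) (x, x') = (1 + \<i> * of_real ((x' - x0) \<bullet> e)) * osc \<beta> (ftens f (\<lambda>y. wfac x0 e y * g y)) (x, x')
     + osc \<beta>' (ftens f (\<lambda>y. wfac x0 e y * g y)) (x, x')"
proof -
  note g1 = schwartz_wfac_mult[OF g, of x0 e]
  have d: "dir_deriv (0, e) (ftens f (\<lambda>y. wfac x0 e y * g y))
     (\<lambda>v. (1 - \<i> * of_real (x0 \<bullet> e)) * ftens f (\<lambda>y. wfac x0 e y * g y) v - ftens f g v)"
    using dir_deriv_ftens_snd[OF dir_deriv_fourier_wfac[OF g e, of x0], of f]
    by (simp add: ftens_def right_diff_distrib mult_ac)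
  show ?thesis
    using osc_step[OF \<beta> B integrable_ftens[OF f g1] continuous_ftens[OF f g1]
        integrable_ftens[OF f g] continuous_ftens[OF f g] d, of "(x, x')"]
    by (simp add: inner_diff_left)
qed

section \<open>Symbol derivatives, frozen operators and the exchange of weights for frequency
  derivatives\<close>

locale bounded_symbol =
  fixes a :: "real^'n::finite \<Rightarrow> real^'n \<Rightarrow> real^'n \<Rightarrow> complex" and \<rho> :: real
  assumes rho_pos: "0 < \<rho>" and symbol: "bisymbol 0 \<rho> 0 a"
begin

definition D :: "'n triple list \<Rightarrow> 'n triple \<Rightarrow> complex" where
  "D ds = iter_deriv ds (uncurry3 a)"

lemma smooth: "smooth_fun (uncurry3 a)"
  using symbol by (simp add: bisymbol_def)

lemma continuous_D: "continuous_on S (D ds)"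
  unfolding D_def by (rule continuous_iter_deriv[OF smooth])

lemma D_measurable [measurable]: "D ds \<in> borel_measurable borel"
  by (rule borel_measurable_continuous_onI[OF continuous_D])

lemma dir_deriv_D: "dir_deriv d (D ds) (D (d # ds))"
  unfolding D_def by (rule dir_deriv_iter_deriv[OF smooth])

lemma D_decay:
  assumes "ds \<in> lists Basis"
  shows "\<exists>C\<ge>0. \<forall>x \<xi> \<eta>. norm (D ds (x, \<xi>, \<eta>)) \<le> C * (1 + (norm \<xi>)\<^sup>2 + (norm \<eta>)\<^sup>2) powr (- \<rho> * n_xieta ds / 2)"
proof -
  from symbol assms obtain C where C: "\<And>x \<xi> \<eta>. norm (D ds (x, \<xi>, \<eta>)) \<le> C * (1 + (norm \<xi>)\<^sup>2 + (norm \<eta>)\<^sup>2) powr (- \<rho> * n_xieta ds / 2)"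
    unfolding bisymbol_def D_def by fastforce
  \<comment> \<open>At the origin the base of the power is 1, so the bound there reads norm <=
    C.\<close>
  have "C \<ge> 0" using order_trans[OF norm_ge_zero C[of 0 0 0]] by simp
  then show ?thesis using C by blast
qed

lemma D_bounded:
  assumes "ds \<in> lists Basis"
  obtains C where "\<And>p. norm (D ds p) \<le> C"
proof -
  obtain C where
    C: "C \<ge> 0" "\<And>x \<xi> \<eta>. norm (D ds (x, \<xi>, \<eta>)) \<le> C * (1 + (norm \<xi>)\<^sup>2 + (norm \<eta>)\<^sup>2) powr (- \<rho> * n_xieta ds / 2)"
    using D_decay[OF assms] by blast
  have "norm (D ds p) \<le> C" for p
  proof -
    obtain x \<xi> \<eta> where p: "p = (x, \<xi>, \<eta>)" by (metis prod_cases3)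
    have "(1 + (norm \<xi>)\<^sup>2 + (norm \<eta>)\<^sup>2) powr (- \<rho> * n_xieta ds / 2) \<le> (1 + (norm \<xi>)\<^sup>2 + (norm \<eta>)\<^sup>2) powr 0"
      using rho_pos by (intro powr_mono) (auto simp: add_nonneg_nonneg)
    also have "\<dots> = 1"
    proof -
      have "1 + (norm \<xi>)\<^sup>2 + (norm \<eta>)\<^sup>2 > 0" by (intro add_pos_nonneg) auto
      then show ?thesis by simp
    qed
    finally have "C * (1 + (norm \<xi>)\<^sup>2 + (norm \<eta>)\<^sup>2) powr (- \<rho> * n_xieta ds / 2) \<le> C * 1"
      using C(1) by (intro mult_left_mono)
    with C(2)[of x \<xi> \<eta>] show ?thesis unfolding p by simp
  qed
  then show thesis using that by blast
qed

definition freq_basis :: "'n triple set" where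
  "freq_basis = (\<lambda>e. (0, e, 0)) ` Basis \<union> (\<lambda>e. (0, 0, e)) ` Basis"

lemma freq_basis_subset: "freq_basis \<subseteq> Basis"
  unfolding freq_basis_def Basis_prod_def by auto

lemma finite_freq_basis: "finite freq_basis"
  unfolding freq_basis_def by auto

text \<open>As \<open>wfac x0 0 = 1\<close>, only one of the two functions changes when \<open>d\<close> is in \<open>freq_basis\<close>.\<close>

definition upd :: "real^'n \<Rightarrow> 'n triple \<Rightarrow> (real^'n \<Rightarrow> complex) \<times> (real^'n \<Rightarrow> complex) \<Rightarrow> (real^'n \<Rightarrow> complex) \<times> (real^'n \<Rightarrow> complex)" where
  "upd x0 d s = (\<lambda>y. wfac x0 (fst (snd d)) y * fst s y, \<lambda>y. wfac x0 (snd (snd d)) y * snd s y)"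

text \<open>The space variable of the symbol is frozen at \<open>z\<close>, while the phase is evaluated at the diagonal point
  \<open>(x, x)\<close>; the bilinear operator is the case \<open>z = x\<close>.\<close>

definition oscD :: "real^'n \<Rightarrow> real^'n \<Rightarrow> 'n triple list \<Rightarrow> (real^'n \<Rightarrow> complex) \<times> (real^'n \<Rightarrow> complex) \<Rightarrow> complex" where
  "oscD z x ds s = osc (\<lambda>v. D ds (z, v)) (ftens (fst s) (snd s)) (x, x)"

lemma dir_deriv_D_slice: "dir_deriv (e, e') (\<lambda>v. D ds (z, v)) (\<lambda>v. D ((0, e, e') # ds) (z, v))"
  unfolding dir_deriv_def
proof (intro allI)
  fix p :: "(real^'n) \<times> (real^'n)" and t :: real
  show "((\<lambda>t. D ds (z, p + t *\<^sub>R (e, e'))) has_vector_derivative D ((0, e, e') # ds) (z, p + t *\<^sub>R (e, e'))) (at t)"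
    using dir_derivD[OF dir_deriv_D[of "(0, e, e')" ds], of "(z, p)" t] by simp
qed

lemma continuous_D_slice: "continuous_on UNIV (\<lambda>v. D ds (z, v))"
  by (intro continuous_on_compose2[OF continuous_D[of UNIV]] continuous_intros) auto

text \<open>One weight is bought with one frequency derivative of the symbol. The multiplier 1 + i(x
  - x0) . e produced by the phase has modulus at most 2, because x stays within distance 1 of
  x0.\<close>

lemma oscD_step:
  assumes d: "d \<in> freq_basis" and s: "schwartz (fst s)" "schwartz (snd s)" and x: "norm (x - x0) \<le> 1"
    and ds: "ds \<in> lists Basis"
  shows "norm (oscD z x ds s) \<le> 2 * norm (oscD z x ds (upd x0 d s)) + norm (oscD z x (d # ds) (upd x0 d s))"
proof -
  have dds: "d # ds \<in> lists Basis" using d ds freq_basis_subset by auto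
  obtain B where B: "\<And>p. norm (D ds p) \<le> B" using D_bounded[OF ds] by blast
  obtain B' where B': "\<And>p. norm (D (d # ds) p) \<le> B'" using D_bounded[OF dds] by blast
  have le2: "norm (1 + \<i> * complex_of_real ((x - x0) \<bullet> e)) \<le> 2" if "e \<in> Basis" for e
  proof -
    have "norm (1 + \<i> * complex_of_real ((x - x0) \<bullet> e)) \<le> 1 + \<bar>(x - x0) \<bullet> e\<bar>"
      by (rule order_trans[OF norm_triangle_ineq]) (simp add: norm_mult)
    also have "\<dots> \<le> 2" using Basis_le_norm[OF that, of "x - x0"] x by linarith
    finally show ?thesis .
  qed
  have "\<exists>e\<in>Basis. oscD z x ds s = (1 + \<i> * complex_of_real ((x - x0) \<bullet> e)) * oscD z x ds (upd x0 d s) + oscD z x (d # ds) (upd x0 d s)"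
    using d unfolding freq_basis_def
  proof (elim UnE imageE)
    fix e :: "real^'n" assume e: "e \<in> Basis" and d: "d = (0, e, 0)"
    have u: "upd x0 d s = (\<lambda>y. wfac x0 e y * fst s y, snd s)" by (simp add: upd_def d wfac_def)
    show ?thesis
      unfolding oscD_def u fst_conv snd_conv
      using osc_step_fst[OF s e dir_deriv_D_slice continuous_D_slice continuous_D_slice B B'[unfolded d]] d
      by (auto intro!: bexI[OF _ e])
  next
    fix e :: "real^'n" assume e: "e \<in> Basis" and d: "d = (0, 0, e)"
    have u: "upd x0 d s = (fst s, \<lambda>y. wfac x0 e y * snd s y)" by (simp add: upd_def d wfac_def)
    show ?thesis
      unfolding oscD_def u fst_conv snd_conv
      using osc_step_snd[OF s e dir_deriv_D_slice continuous_D_slice continuous_D_slice B B'[unfolded d]] d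
      by (auto intro!: bexI[OF _ e])
  qed
  then obtain e where e: "e \<in> Basis" and
    eq: "oscD z x ds s = (1 + \<i> * complex_of_real ((x - x0) \<bullet> e)) * oscD z x ds (upd x0 d s) + oscD z x (d # ds) (upd x0 d s)"
    by blast
  have "norm (oscD z x ds s) \<le> norm (1 + \<i> * complex_of_real ((x - x0) \<bullet> e)) * norm (oscD z x ds (upd x0 d s)) + norm (oscD z x (d # ds) (upd x0 d s))"
    unfolding eq by (rule order_trans[OF norm_triangle_ineq]) (simp add: norm_mult)
  also have "\<dots> \<le> 2 * norm (oscD z x ds (upd x0 d s)) + norm (oscD z x (d # ds) (upd x0 d s))"
    by (intro add_mono mult_right_mono le2 e) auto
  finally show ?thesis .
qed

definition freq_lists :: "nat \<Rightarrow> 'n triple list set" where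
  "freq_lists m = {J. set J \<subseteq> freq_basis \<and> length J \<le> m}"

lemma finite_freq_lists: "finite (freq_lists m)"
  unfolding freq_lists_def by (rule finite_lists_length_le[OF finite_freq_basis])

lemma schwartz_upd: "schwartz (fst s) \<Longrightarrow> schwartz (snd s) \<Longrightarrow> schwartz (fst (upd x0 d s)) \<and> schwartz (snd (upd x0 d s))"
  unfolding upd_def by (simp add: schwartz_wfac_mult)

text \<open>Each entry of \<open>es\<close> leaves either a multiplier of size 2 or a further
  derivative with factor 1, whence 3 = 2 + 1. Summing over all frequency lists of bounded length,
  instead of sublists of \<open>es\<close>, reduces the bookkeeping to inclusions between index
  sets.\<close>

lemma oscD_expansion:
  assumes "set es \<subseteq> freq_basis" "schwartz (fst s)" "schwartz (snd s)" "ds \<in> lists Basis" and x: "norm (x - x0) \<le> 1"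
  shows "norm (oscD z x ds s) \<le> 3 ^ length es * (\<Sum>J\<in>freq_lists (length es). norm (oscD z x (J @ ds) (fold (upd x0) es s)))"
  using assms(1-4)
proof (induction es arbitrary: s ds)
  case Nil
  have "freq_lists 0 = {[]}" by (auto simp: freq_lists_def)
  then show ?case by simp
next
  case (Cons d es)
  define m where "m = length es"
  define N where "N J = norm (oscD z x J (fold (upd x0) es (upd x0 d s)))" for J
  have d: "d \<in> freq_basis" and es: "set es \<subseteq> freq_basis" using Cons.prems by auto
  have dds: "d # ds \<in> lists Basis" using d Cons.prems freq_basis_subset by auto
  note sc = schwartz_upd[OF Cons.prems(2,3), of x0 d]
  have 1: "norm (oscD z x ds (upd x0 d s)) \<le> 3 ^ m * (\<Sum>J\<in>freq_lists m. N (J @ ds))"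
    unfolding m_def N_def using Cons.IH[OF es _ _ Cons.prems(4)] sc by blast
  also have "\<dots> \<le> 3 ^ m * (\<Sum>J\<in>freq_lists (Suc m). N (J @ ds))"
    by (intro mult_left_mono sum_mono2 finite_freq_lists) (auto simp: freq_lists_def N_def)
  finally have 1: "norm (oscD z x ds (upd x0 d s)) \<le> 3 ^ m * (\<Sum>J\<in>freq_lists (Suc m). N (J @ ds))" .
  have "norm (oscD z x (d # ds) (upd x0 d s)) \<le> 3 ^ m * (\<Sum>J\<in>freq_lists m. N (J @ d # ds))"
    unfolding m_def N_def using Cons.IH[OF es _ _ dds] sc by blast
  \<comment> \<open>The extra derivative d is absorbed into the index: \<open>J @ d # ds\<close> is
    \<open>(J @ [d]) @ ds\<close>.\<close>
  also have "(\<Sum>J\<in>freq_lists m. N (J @ d # ds)) = (\<Sum>J\<in>(\<lambda>J. J @ [d]) ` freq_lists m. N (J @ ds))"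
    by (subst sum.reindex) (auto simp: inj_on_def)
  also have "3 ^ m * \<dots> \<le> 3 ^ m * (\<Sum>J\<in>freq_lists (Suc m). N (J @ ds))"
    using d by (intro mult_left_mono sum_mono2 finite_freq_lists) (auto simp: freq_lists_def N_def)
  finally have 2: "norm (oscD z x (d # ds) (upd x0 d s)) \<le> 3 ^ m * (\<Sum>J\<in>freq_lists (Suc m). N (J @ ds))" .
  have "norm (oscD z x ds s) \<le> 2 * norm (oscD z x ds (upd x0 d s)) + norm (oscD z x (d # ds) (upd x0 d s))"
    by (rule oscD_step[OF d Cons.prems(2,3) x Cons.prems(4)])
  also have "\<dots> \<le> 3 ^ Suc m * (\<Sum>J\<in>freq_lists (Suc m). N (J @ ds))" using 1 2 by simp
  finally show ?case by (simp add: m_def N_def)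
qed

lemma fold_upd:
  assumes "distinct bs" "set bs \<subseteq> Basis"
  shows "fold (upd x0) (map (\<lambda>e. (0, e, 0)) bs) s = (\<lambda>y. (\<Prod>b\<in>set bs. wfac x0 b y) * fst s y, snd s)"
    and "fold (upd x0) (map (\<lambda>e. (0, 0, e)) bs) s = (fst s, \<lambda>y. (\<Prod>b\<in>set bs. wfac x0 b y) * snd s y)"
  using assms
proof (induction bs arbitrary: s)
  case (Cons b bs)
  have u: "upd x0 (0, b, 0) s = (\<lambda>y. wfac x0 b y * fst s y, snd s)"
    "upd x0 (0, 0, b) s = (fst s, \<lambda>y. wfac x0 b y * snd s y)" for s by (simp_all add: upd_def wfac_def)
  { case 1 then show ?case using Cons.IH(1)[of "upd x0 (0, b, 0) s"] by (simp add: u mult_ac) }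
  { case 2 then show ?case using Cons.IH(2)[of "upd x0 (0, 0, b) s"] by (simp add: u mult_ac) }
qed simp_all

text \<open>All coordinate weights at once, so that by \<open>norm_wall\<close> the square of the
  modulus is |f|^2 times an integrable function centred at x0.\<close>

definition wall :: "real^'n \<Rightarrow> (real^'n \<Rightarrow> complex) \<Rightarrow> real^'n \<Rightarrow> complex" where
  "wall x0 f y = (\<Prod>b\<in>Basis. wfac x0 b y) * f y"

lemma norm_wall: "(norm (wall x0 f y))\<^sup>2 = (norm (f y))\<^sup>2 * weight (y - x0)"
  unfolding wall_def weight_def
  by (simp add: norm_mult power_mult_distrib norm_wfac prod_norm[symmetric] prod_power_distrib)

lemma schwartz_wall:
  assumes "schwartz f"
  shows "schwartz (wall x0 f)"
proof -
  have "schwartz (\<lambda>y. (\<Prod>b\<in>S. wfac x0 b y) * f y)" if "finite S" for S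
    using that
  proof induction
    case (insert b S)
    then show ?case using schwartz_wfac_mult[OF insert.IH, of x0 b] by (simp add: mult.assoc)
  qed (use assms in simp)
  then show ?thesis unfolding wall_def[abs_def] by simp
qed

text \<open>There are 2n weights to place, n on each function, and 3^(2n) = 9^n.\<close>

lemma oscD_weighted:
  assumes s: "schwartz f" "schwartz g" and ds: "ds \<in> lists Basis" and x: "norm (x - x0) \<le> 1"
  shows "norm (oscD z x ds (f, g)) \<le> 9 ^ CARD('n) *
    (\<Sum>J\<in>freq_lists (2 * CARD('n)). norm (oscD z x (J @ ds) (wall x0 f, wall x0 g)))"
proof -
  obtain bs :: "(real^'n) list" where bs: "set bs = Basis" "distinct bs"
    using finite_distinct_list[OF finite_Basis] by blast
  have l: "length bs = CARD('n)" using bs distinct_card[OF bs(2)] by simp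
  define es where "es = map (\<lambda>e. (0::real^'n, e, 0::real^'n)) bs @ map (\<lambda>e. (0, 0, e)) bs"
  have le: "length es = 2 * CARD('n)" by (simp add: es_def l)
  have "set es \<subseteq> freq_basis" using bs by (auto simp: es_def freq_basis_def)
  from oscD_expansion[OF this _ _ ds x, of "(f, g)" z] s
  have "norm (oscD z x ds (f, g)) \<le> 3 ^ (2 * CARD('n)) *
    (\<Sum>J\<in>freq_lists (2 * CARD('n)). norm (oscD z x (J @ ds) (fold (upd x0) es (f, g))))" by (simp add: le)
  moreover have "fold (upd x0) es (f, g) = (wall x0 f, wall x0 g)"
    unfolding es_def by (simp add: fold_upd bs wall_def[abs_def])
  ultimately show ?thesis by (simp add: power_mult)
qed

end

section \<open>The \<open>L\<^sup>2\<close> estimate\<close>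

text \<open>At a diagonal point the phase is x . (\<xi> + \<eta>). The substitution \<zeta> = \<xi>
  + \<eta> therefore collects the 2n frequency variables into a transform in n variables, to which
  Bessel's inequality in x applies.\<close>

lemma osc_diagonal:
  fixes F G :: "real^'n::finite \<Rightarrow> complex"
  assumes F: "integrable lborel F" and G: "integrable lborel G"
    and K: "K \<in> borel_measurable borel" and C: "\<And>v. norm (K v) \<le> C"
  defines "H \<equiv> \<lambda>\<zeta>. \<integral>\<eta>. K (\<zeta> - \<eta>, \<eta>) * F (\<zeta> - \<eta>) * G \<eta> \<partial>lborel"
  shows "integrable lborel H"
    and "osc K (\<lambda>v. F (fst v) * G (snd v)) (x, x) = (\<integral>\<zeta>. H \<zeta> * cis (x \<bullet> \<zeta>) \<partial>lborel)"
proof -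
  note [measurable] = borel_measurable_integrable[OF F] borel_measurable_integrable[OF G] K
  have mF: "(\<lambda>z. F (snd z - fst z)) \<in> borel_measurable (lborel \<Otimes>\<^sub>M lborel)"
    using borel_measurable_integrable[OF F] by measurable
  have mK: "(\<lambda>z. K (snd z - fst z, fst z)) \<in> borel_measurable (lborel \<Otimes>\<^sub>M lborel)"
    by measurable
  have tr: "(\<integral>\<zeta>. h (\<zeta> - \<eta>) \<partial>lborel) = (\<integral>\<zeta>. h \<zeta> \<partial>lborel)" if "integrable lborel h" for h :: "real^'n \<Rightarrow> 'z::{banach,second_countable_topology}" and \<eta>
    using integrable_lborel_translate(2)[OF that, of "- \<eta>"] by simp
  have tri: "integrable lborel (\<lambda>\<zeta>. h (\<zeta> - \<eta>))" if "integrable lborel h" for h :: "real^'n \<Rightarrow> complex" and \<eta>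
    using integrable_lborel_translate(1)[OF that, of "- \<eta>"] by simp
  have i0: "integrable (lborel \<Otimes>\<^sub>M lborel) (\<lambda>(\<eta>, \<zeta>). G \<eta> * F (\<zeta> - \<eta>))"
  proof (rule lborel_pair.Fubini_integrable)
    show "(\<lambda>(\<eta>, \<zeta>). G \<eta> * F (\<zeta> - \<eta>)) \<in> borel_measurable (lborel \<Otimes>\<^sub>M lborel)"
      using mF unfolding split_beta by measurable
    have "(\<integral>\<zeta>. norm (G \<eta> * F (\<zeta> - \<eta>)) \<partial>lborel) = norm (G \<eta>) * (\<integral>\<zeta>. norm (F \<zeta>) \<partial>lborel)" for \<eta>
      using tr[of "\<lambda>\<zeta>. norm (F \<zeta>)" \<eta>] F by (simp add: norm_mult)
    then show "integrable lborel (\<lambda>\<eta>. \<integral>\<zeta>. norm (case (\<eta>, \<zeta>) of (\<eta>, \<zeta>) \<Rightarrow> G \<eta> * F (\<zeta> - \<eta>)) \<partial>lborel)"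
      using G by simp
    show "AE \<eta> in lborel. integrable lborel (\<lambda>\<zeta>. case (\<eta>, \<zeta>) of (\<eta>, \<zeta>) \<Rightarrow> G \<eta> * F (\<zeta> - \<eta>))"
      using tri[OF F] by simp
  qed
  have i1: "integrable (lborel \<Otimes>\<^sub>M lborel) (\<lambda>(\<eta>, \<zeta>). K (\<zeta> - \<eta>, \<eta>) * F (\<zeta> - \<eta>) * G \<eta>)"
    using integrable_mult_bounded[OF i0 mK, of C] C by (simp add: split_beta' mult_ac)
  have i2: "integrable (lborel \<Otimes>\<^sub>M lborel) (\<lambda>(\<eta>, \<zeta>). K (\<zeta> - \<eta>, \<eta>) * F (\<zeta> - \<eta>) * G \<eta> * cis (x \<bullet> \<zeta>))"
    using integrable_mult_bounded[OF i1, of "\<lambda>z. cis (x \<bullet> snd z)" 1] by (simp add: split_beta')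
  show "integrable lborel H"
    unfolding H_def using lborel_pair.integrable_snd[OF i1] .
  have mKc: "(\<lambda>v. K v * cis (x \<bullet> (fst v + snd v))) \<in> borel_measurable borel"
    by (intro borel_measurable_times K borel_measurable_continuous_onI continuous_intros)
  have i3: "integrable (lborel \<Otimes>\<^sub>M lborel) (\<lambda>(\<xi>, \<eta>). F \<xi> * G \<eta> * (K (\<xi>, \<eta>) * cis (x \<bullet> (\<xi> + \<eta>))))"
    using mKc integrable_pair_bounded_kernel[OF F G, of "\<lambda>v. K v * cis (x \<bullet> (fst v + snd v))" C] C
    by (simp add: split_beta' norm_mult lborel_prod)
  have i4: "integrable lborel (\<lambda>\<xi>. F \<xi> * (K (\<xi>, \<eta>) * cis (x \<bullet> (\<xi> + \<eta>))))" for \<eta>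
    by (rule integrable_mult_bounded[OF F, where C=C]) (auto simp: norm_mult C)
  have "osc K (\<lambda>v. F (fst v) * G (snd v)) (x, x) =
      integral\<^sup>L (lborel \<Otimes>\<^sub>M lborel) (\<lambda>(\<xi>, \<eta>). F \<xi> * G \<eta> * (K (\<xi>, \<eta>) * cis (x \<bullet> (\<xi> + \<eta>))))"
    unfolding osc_def lborel_prod[symmetric] by (simp add: split_beta' inner_prod_def inner_add_right mult_ac)
  also have "\<dots> = (\<integral>\<eta>. \<integral>\<xi>. F \<xi> * G \<eta> * (K (\<xi>, \<eta>) * cis (x \<bullet> (\<xi> + \<eta>))) \<partial>lborel \<partial>lborel)"
    by (rule lborel_pair.integral_snd[OF i3, symmetric])
  also have "\<dots> = (\<integral>\<eta>. \<integral>\<zeta>. K (\<zeta> - \<eta>, \<eta>) * F (\<zeta> - \<eta>) * G \<eta> * cis (x \<bullet> \<zeta>) \<partial>lborel \<partial>lborel)"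
  proof (rule Bochner_Integration.integral_cong[OF refl])
    fix \<eta>
    have "(\<integral>\<xi>. F \<xi> * G \<eta> * (K (\<xi>, \<eta>) * cis (x \<bullet> (\<xi> + \<eta>))) \<partial>lborel)
        = (\<integral>\<xi>. G \<eta> * (F \<xi> * (K (\<xi>, \<eta>) * cis (x \<bullet> (\<xi> + \<eta>)))) \<partial>lborel)" by (simp add: mult_ac)
    also have "\<dots> = (\<integral>\<zeta>. G \<eta> * (F (\<zeta> - \<eta>) * (K (\<zeta> - \<eta>, \<eta>) * cis (x \<bullet> (\<zeta> - \<eta> + \<eta>)))) \<partial>lborel)"
      by (rule tr[symmetric]) (rule integrable_mult_right[OF i4])
    finally show "(\<integral>\<xi>. F \<xi> * G \<eta> * (K (\<xi>, \<eta>) * cis (x \<bullet> (\<xi> + \<eta>))) \<partial>lborel)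
       = (\<integral>\<zeta>. K (\<zeta> - \<eta>, \<eta>) * F (\<zeta> - \<eta>) * G \<eta> * cis (x \<bullet> \<zeta>) \<partial>lborel)" by (simp add: mult_ac)
  qed
  also have "\<dots> = (\<integral>\<zeta>. \<integral>\<eta>. K (\<zeta> - \<eta>, \<eta>) * F (\<zeta> - \<eta>) * G \<eta> * cis (x \<bullet> \<zeta>) \<partial>lborel \<partial>lborel)"
    using lborel_pair.Fubini_integral[OF i2] by simp
  also have "\<dots> = (\<integral>\<zeta>. H \<zeta> * cis (x \<bullet> \<zeta>) \<partial>lborel)" unfolding H_def by simp
  finally show "osc K (\<lambda>v. F (fst v) * G (snd v)) (x, x) = (\<integral>\<zeta>. H \<zeta> * cis (x \<bullet> \<zeta>) \<partial>lborel)" .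
qed

text \<open>Bessel in x for fixed z, Cauchy-Schwarz in \<eta> for H, then A removes the symbol. What
  remains is the integral of W, the convolution of the squared moduli of both transforms. Each of
  the three factors (2 pi)^n is one use of Bessel's inequality: in x, for f and for g.\<close>

lemma L2_estimate:
  fixes u :: "'n::finite triple \<Rightarrow> complex"
  assumes [measurable]: "u \<in> borel_measurable borel" and B: "\<And>p. norm (u p) \<le> B"
    and A: "\<And>\<zeta>. (\<integral>\<^sup>+z\<in>S. (\<integral>\<^sup>+\<eta>. ennreal ((norm (u (z, \<zeta> - \<eta>, \<eta>)))\<^sup>2) \<partial>lborel) \<partial>lborel) \<le> A"
    and S [measurable]: "S \<in> sets borel"
    and f: "schwartz f" and g: "schwartz g"
  shows "(\<integral>\<^sup>+z\<in>S. (\<integral>\<^sup>+x. ennreal ((norm (osc (\<lambda>v. u (z, v)) (ftens f g) (x, x)))\<^sup>2) \<partial>lborel) \<partial>lborel)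
    \<le> ennreal ((2 * pi) ^ CARD('n)) ^ 3 * A * (\<integral>\<^sup>+y. ennreal ((norm (f y))\<^sup>2) \<partial>lborel) * (\<integral>\<^sup>+y. ennreal ((norm (g y))\<^sup>2) \<partial>lborel)"
proof -
  let ?P = "ennreal ((2 * pi) ^ CARD('n))"
  note [measurable] = fourier_measurable[OF f] fourier_measurable[OF g]
  let ?F = "fourier f" and ?G = "fourier g"
  define H where "H z \<zeta> = (\<integral>\<eta>. u (z, \<zeta> - \<eta>, \<eta>) * ?F (\<zeta> - \<eta>) * ?G \<eta> \<partial>lborel)" for z \<zeta>
  define W where "W \<zeta> = (\<integral>\<^sup>+\<eta>. ennreal ((norm (?F (\<zeta> - \<eta>)))\<^sup>2) * ennreal ((norm (?G \<eta>))\<^sup>2) \<partial>lborel)" for \<zeta>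
  have bessel': "(\<integral>\<^sup>+v. ennreal ((norm (fourier h v))\<^sup>2) \<partial>lborel) \<le> ?P * (\<integral>\<^sup>+y. ennreal ((norm (h y))\<^sup>2) \<partial>lborel)"
    if "schwartz h" for h :: "real^'n \<Rightarrow> complex"
    using bessel[OF rapid_integrable[OF schwartz_rapid[OF that]]] unfolding fourier_def by simp
  have 1: "(\<integral>\<^sup>+x. ennreal ((norm (osc (\<lambda>v. u (z, v)) (ftens f g) (x, x)))\<^sup>2) \<partial>lborel)
     \<le> ?P * (\<integral>\<^sup>+\<zeta>. ennreal ((norm (H z \<zeta>))\<^sup>2) \<partial>lborel)" for z
  proof -
    have m: "(\<lambda>v. u (z, v)) \<in> borel_measurable borel" by measurable
    note o = osc_diagonal[OF integrable_fourier[OF f] integrable_fourier[OF g] m B, folded H_def[of z]]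
    note [measurable] = borel_measurable_integrable[OF o(1)]
    let ?J = "\<lambda>x. ennreal ((norm (\<integral>\<zeta>. H z \<zeta> * cis (- (\<zeta> \<bullet> x)) \<partial>lborel))\<^sup>2)"
    \<comment> \<open>\<open>bessel\<close> has the opposite sign in the phase; the reflection x ->
      0 - x accounts for it.\<close>
    have "osc (\<lambda>v. u (z, v)) (ftens f g) (x, x) = (\<integral>\<zeta>. H z \<zeta> * cis (- (\<zeta> \<bullet> (0 - x))) \<partial>lborel)" for x
      using o(2)[of x] unfolding ftens_def[abs_def] by (simp add: inner_commute)
    then have "(\<integral>\<^sup>+x. ennreal ((norm (osc (\<lambda>v. u (z, v)) (ftens f g) (x, x)))\<^sup>2) \<partial>lborel) = (\<integral>\<^sup>+x. ?J (0 - x) \<partial>lborel)"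
      by simp
    also have "\<dots> = (\<integral>\<^sup>+x. ?J x \<partial>lborel)"
      by (rule nn_integral_lborel_reflect) measurable
    also have "\<dots> \<le> ?P * (\<integral>\<^sup>+\<zeta>. ennreal ((norm (H z \<zeta>))\<^sup>2) \<partial>lborel)"
      using bessel[OF o(1)] by simp
    finally show ?thesis .
  qed
  have 2: "ennreal ((norm (H z \<zeta>))\<^sup>2) \<le> (\<integral>\<^sup>+\<eta>. ennreal ((norm (u (z, \<zeta> - \<eta>, \<eta>)))\<^sup>2) \<partial>lborel) * W \<zeta>" for z \<zeta>
  proof -
    have "ennreal ((norm (H z \<zeta>))\<^sup>2) = (ennreal (norm (H z \<zeta>)))\<^sup>2" by (simp add: ennreal_power)
    also have "\<dots> \<le> (\<integral>\<^sup>+\<eta>. ennreal (norm (u (z, \<zeta> - \<eta>, \<eta>) * ?F (\<zeta> - \<eta>) * ?G \<eta>)) \<partial>lborel)\<^sup>2"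
      unfolding H_def by (intro power_mono norm_integral_le_nn_integral) auto
    also have "\<dots> = (\<integral>\<^sup>+\<eta>. ennreal (norm (u (z, \<zeta> - \<eta>, \<eta>))) * ennreal (norm (?F (\<zeta> - \<eta>)) * norm (?G \<eta>)) \<partial>lborel)\<^sup>2"
      by (simp add: norm_mult ennreal_mult[symmetric] mult.assoc)
    also have "\<dots> \<le> (\<integral>\<^sup>+\<eta>. (ennreal (norm (u (z, \<zeta> - \<eta>, \<eta>))))\<^sup>2 \<partial>lborel) * (\<integral>\<^sup>+\<eta>. (ennreal (norm (?F (\<zeta> - \<eta>)) * norm (?G \<eta>)))\<^sup>2 \<partial>lborel)"
      by (rule Cauchy_Schwarz_nn_integral) measurable
    also have "\<dots> = (\<integral>\<^sup>+\<eta>. ennreal ((norm (u (z, \<zeta> - \<eta>, \<eta>)))\<^sup>2) \<partial>lborel) * W \<zeta>"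
      unfolding W_def by (simp add: ennreal_power power_mult_distrib ennreal_mult[symmetric])
    finally show ?thesis .
  qed
  have [measurable]: "W \<in> borel_measurable borel" unfolding W_def by measurable
  have W: "(\<integral>\<^sup>+\<zeta>. W \<zeta> \<partial>lborel) \<le> (?P * (\<integral>\<^sup>+y. ennreal ((norm (f y))\<^sup>2) \<partial>lborel)) * (?P * (\<integral>\<^sup>+y. ennreal ((norm (g y))\<^sup>2) \<partial>lborel))"
  proof -
    have "(\<integral>\<^sup>+\<zeta>. W \<zeta> \<partial>lborel) = (\<integral>\<^sup>+\<eta>. \<integral>\<^sup>+\<zeta>. ennreal ((norm (?F (\<zeta> - \<eta>)))\<^sup>2) * ennreal ((norm (?G \<eta>))\<^sup>2) \<partial>lborel \<partial>lborel)"
      unfolding W_def by (rule lborel_pair.Fubini') measurable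
    also have "\<dots> = (\<integral>\<^sup>+\<zeta>. ennreal ((norm (?F \<zeta>))\<^sup>2) \<partial>lborel) * (\<integral>\<^sup>+\<eta>. ennreal ((norm (?G \<eta>))\<^sup>2) \<partial>lborel)"
      using nn_integral_lborel_translate[of "\<lambda>\<zeta>. ennreal ((norm (?F \<zeta>))\<^sup>2)" "- \<eta>" for \<eta>]
      by (simp add: nn_integral_multc nn_integral_cmult)
    also have "\<dots> \<le> (?P * (\<integral>\<^sup>+y. ennreal ((norm (f y))\<^sup>2) \<partial>lborel)) * (?P * (\<integral>\<^sup>+y. ennreal ((norm (g y))\<^sup>2) \<partial>lborel))"
      by (intro mult_mono bessel' f g) auto
    finally show ?thesis .
  qed
  have "(\<integral>\<^sup>+z\<in>S. (\<integral>\<^sup>+x. ennreal ((norm (osc (\<lambda>v. u (z, v)) (ftens f g) (x, x)))\<^sup>2) \<partial>lborel) \<partial>lborel)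
     \<le> (\<integral>\<^sup>+z. \<integral>\<^sup>+\<zeta>. ?P * ((\<integral>\<^sup>+\<eta>. ennreal ((norm (u (z, \<zeta> - \<eta>, \<eta>)))\<^sup>2) \<partial>lborel) * indicator S z) * W \<zeta> \<partial>lborel \<partial>lborel)"
  proof (rule nn_integral_mono)
    fix z
    have "(\<integral>\<^sup>+x. ennreal ((norm (osc (\<lambda>v. u (z, v)) (ftens f g) (x, x)))\<^sup>2) \<partial>lborel) * indicator S z
      \<le> (?P * (\<integral>\<^sup>+\<zeta>. (\<integral>\<^sup>+\<eta>. ennreal ((norm (u (z, \<zeta> - \<eta>, \<eta>)))\<^sup>2) \<partial>lborel) * W \<zeta> \<partial>lborel)) * indicator S z"
      by (intro mult_right_mono order_trans[OF 1] mult_left_mono nn_integral_mono 2) auto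
    also have "\<dots> = (\<integral>\<^sup>+\<zeta>. ?P * ((\<integral>\<^sup>+\<eta>. ennreal ((norm (u (z, \<zeta> - \<eta>, \<eta>)))\<^sup>2) \<partial>lborel) * indicator S z) * W \<zeta> \<partial>lborel)"
      by (subst nn_integral_cmult[symmetric], measurable, subst nn_integral_multc[symmetric], measurable) (simp add: mult_ac)
    finally show "(\<integral>\<^sup>+x. ennreal ((norm (osc (\<lambda>v. u (z, v)) (ftens f g) (x, x)))\<^sup>2) \<partial>lborel) * indicator S z
      \<le> (\<integral>\<^sup>+\<zeta>. ?P * ((\<integral>\<^sup>+\<eta>. ennreal ((norm (u (z, \<zeta> - \<eta>, \<eta>)))\<^sup>2) \<partial>lborel) * indicator S z) * W \<zeta> \<partial>lborel)" .
  qed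
  \<comment> \<open>A bounds the z-integral for each fixed \<zeta>, so the z-integral has to be
    moved inside.\<close>
  also have "\<dots> = (\<integral>\<^sup>+\<zeta>. \<integral>\<^sup>+z. ?P * ((\<integral>\<^sup>+\<eta>. ennreal ((norm (u (z, \<zeta> - \<eta>, \<eta>)))\<^sup>2) \<partial>lborel) * indicator S z) * W \<zeta> \<partial>lborel \<partial>lborel)"
    by (rule lborel_pair.Fubini') measurable
  also have "\<dots> = (\<integral>\<^sup>+\<zeta>. ?P * (\<integral>\<^sup>+z\<in>S. (\<integral>\<^sup>+\<eta>. ennreal ((norm (u (z, \<zeta> - \<eta>, \<eta>)))\<^sup>2) \<partial>lborel) \<partial>lborel) * W \<zeta> \<partial>lborel)"
    by (subst nn_integral_multc, measurable, subst nn_integral_cmult, measurable)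
  also have "\<dots> \<le> (\<integral>\<^sup>+\<zeta>. ?P * A * W \<zeta> \<partial>lborel)"
    by (intro nn_integral_mono mult_right_mono mult_left_mono A) auto
  also have "\<dots> = ?P * A * (\<integral>\<^sup>+\<zeta>. W \<zeta> \<partial>lborel)" by (rule nn_integral_cmult) measurable
  also have "\<dots> \<le> ?P * A * ((?P * (\<integral>\<^sup>+y. ennreal ((norm (f y))\<^sup>2) \<partial>lborel)) * (?P * (\<integral>\<^sup>+y. ennreal ((norm (g y))\<^sup>2) \<partial>lborel)))"
    by (intro mult_left_mono W) auto
  finally show ?thesis by (simp add: mult_ac power3_eq_cube)
qed

section \<open>Derivatives controlled by the function and one higher derivative\<close>

text \<open>Each derivative lowers the order of a zero by at most one.\<close>

lemma higher_pderiv_root: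
  fixes p :: "'a::{idom,semiring_char_0} poly"
  assumes "[:- c, 1:] ^ (n + k) dvd p" "0 < n"
  shows "poly ((pderiv ^^ k) p) c = 0"
proof -
  have "[:- c, 1:] ^ n dvd (pderiv ^^ k) p" using assms(1)
  proof (induction k arbitrary: n)
    case (Suc k)
    then have "[:- c, 1:] ^ Suc n dvd (pderiv ^^ k) p" using Suc.IH[of "Suc n"] by simp
    then obtain q where q: "(pderiv ^^ k) p = [:- c, 1:] ^ Suc n * q" by blast
    have "pderiv ([:- c, 1:] ^ Suc n * q) = [:- c, 1:] ^ n * ([:- c, 1:] * pderiv q + smult (1 + of_nat n) q)"
      unfolding pderiv_mult pderiv_power_Suc by (simp add: pderiv_pCons algebra_simps)
    then show ?case using q by simp
  qed simp
  then have "[:- c, 1:] dvd (pderiv ^^ k) p" using assms(2) by (meson dvd_power dvd_trans)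
  then show ?thesis by (simp add: poly_eq_0_iff_dvd)
qed

lemma poly_higher_pderiv_0: "poly ((pderiv ^^ k) p) 0 = fact k * coeff p k" for p :: "real poly"
  by (simp add: poly_0_coeff_0 coeff_higher_pderiv pochhammer_fact)

text \<open>Integrating \<open>h\<^sub>M k\<close> by parts \<open>M\<close> times, where \<open>k(t) = t\<^sup>m (1 - t\<^sup>2)\<^sup>M\<close> and \<open>M = m + 2\<close>: all boundary
  terms vanish except for the one with \<open>h\<^sub>1(0)\<close>.\<close>

lemma landau_kernel:
  obtains \<psi> \<kappa> :: "real \<Rightarrow> real" where "continuous_on UNIV \<psi>" "continuous_on UNIV \<kappa>"
    "\<And>h :: nat \<Rightarrow> real \<Rightarrow> complex. (\<And>k t. (h k has_vector_derivative h (Suc k) t) (at t)) \<Longrightarrow>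
      h 1 0 = (\<integral>t. indicator {0..1} t *\<^sub>R (\<psi> t *\<^sub>R h 0 t + \<kappa> t *\<^sub>R h (m + 2) t) \<partial>lborel)"
proof -
  define M where "M = m + 2"
  define P where "P = (monom 1 m * [:1, 0, - 1:] ^ M :: real poly)"
  define k where "k j t = poly ((pderiv ^^ j) P) t" for j t
  have k': "(k j has_real_derivative k (Suc j) t) (at t)" for j t
    unfolding k_def by (simp add: poly_DERIV)
  have k1: "k j 1 = 0" if "j < M" for j
  proof -
    have "[:- 1, 1:] dvd [:1, 0, - 1 :: real:]"
      by (simp add: poly_eq_0_iff_dvd[symmetric])
    then have "[:- 1, 1:] ^ M dvd P" unfolding P_def by (intro dvd_mult dvd_power_same)
    then show ?thesis unfolding k_def using that
      by (intro higher_pderiv_root[where n="M - j"]) auto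
  qed
  \<comment> \<open>The reason for 1 - t^2 instead of 1 - t: without a linear term the derivative of
    order m + 1 of the kernel vanishes at 0, which removes the boundary term with h_0(0). The
    boundary term with h_1(0) belongs to order m.\<close>
  have c1: "coeff ([:1, 0, - 1 :: real:] ^ i) 0 = 1 \<and> coeff ([:1, 0, - 1 :: real:] ^ i) 1 = 0" for i
    by (induction i) (auto simp: coeff_mult)
  have k0: "k j 0 = (if j = m then fact m else 0)" if "j < M" for j
  proof -
    have "j < m \<or> j = m \<or> j = m + 1" using that by (auto simp: M_def)
    then show ?thesis
      unfolding k_def poly_higher_pderiv_0 P_def using c1[of M] by (auto simp: coeff_monom_mult)
  qed
  show thesis
  proof (rule that[of "\<lambda>t. (- 1) ^ m * (- 1) ^ M / fact m * k M t" "\<lambda>t. - ((- 1) ^ m) / fact m * k 0 t"])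
    show "continuous_on UNIV (\<lambda>t. (- 1) ^ m * (- 1) ^ M / fact m * k M t)"
      and "continuous_on UNIV (\<lambda>t. - ((- 1) ^ m) / fact m * k 0 t)"
      unfolding k_def by (intro continuous_intros)+
    fix h :: "nat \<Rightarrow> real \<Rightarrow> complex"
    assume h: "\<And>k t. (h k has_vector_derivative h (Suc k) t) (at t)"
    have hc: "continuous_on S (h j)" for S j
      using h by (meson continuous_at_imp_continuous_on has_vector_derivative_continuous)
    define T where "T j t = ((- 1) ^ j * k j t) *\<^sub>R h (M - j) t" for j t
    \<comment> \<open>The collected boundary terms of the repeated integration by parts; the
      derivative of S telescopes to the first and last integrands.\<close>
    define S where "S t = (\<Sum>j<M. ((- 1) ^ j * k j t) *\<^sub>R h (M - 1 - j) t)" for t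
    have S': "(S has_vector_derivative (T 0 t - T M t)) (at t)" for t
    proof -
      have "(S has_vector_derivative (\<Sum>j<M. T j t - T (Suc j) t)) (at t)"
        unfolding S_def[abs_def]
      proof (rule has_vector_derivative_sum)
        fix j assume j: "j \<in> {..<M}"
        have "((\<lambda>t. (- 1) ^ j * k j t) has_real_derivative (- 1) ^ j * k (Suc j) t) (at t)"
          by (rule DERIV_cmult[OF k'])
        from has_vector_derivative_scaleR[OF this h[of "M - 1 - j"]]
        show "((\<lambda>t. ((- 1) ^ j * k j t) *\<^sub>R h (M - 1 - j) t) has_vector_derivative (T j t - T (Suc j) t)) (at t)"
          using j by (simp add: T_def Suc_diff_Suc)
      qed
      moreover have "(\<Sum>j<M. T j t - T (Suc j) t) = T 0 t - T M t" by (rule sum_lessThan_telescope')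
      ultimately show ?thesis by (simp only:)
    qed
    have "continuous_on {0..1} (\<lambda>t. T 0 t - T M t)"
      unfolding T_def k_def by (intro continuous_intros hc)
    then have "(\<integral>t. indicator {0..1} t *\<^sub>R (T 0 t - T M t) \<partial>lborel) = S 1 - S 0"
      by (intro integral_FTC_Icc has_vector_derivative_at_within[OF S']) auto
    also have "S 1 = 0" unfolding S_def using k1 by simp
    also have "S 0 = (\<Sum>j<M. if j = m then ((- 1) ^ m * fact m) *\<^sub>R h 1 0 else 0)"
      unfolding S_def using k0 by (intro sum.cong refl) (auto simp: M_def)
    also have "\<dots> = ((- 1) ^ m * fact m) *\<^sub>R h 1 0" by (simp add: M_def)
    finally have I: "(\<integral>t. indicator {0..1} t *\<^sub>R (T 0 t - T M t) \<partial>lborel) = - (((- 1) ^ m * fact m) *\<^sub>R h 1 0)" by simp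
    have "h 1 0 = (- ((- 1) ^ m) / fact m) *\<^sub>R (\<integral>t. indicator {0..1} t *\<^sub>R (T 0 t - T M t) \<partial>lborel)"
      unfolding I by (simp add: power_mult_distrib[symmetric])
    also have "\<dots> = (\<integral>t. (- ((- 1) ^ m) / fact m) *\<^sub>R (indicator {0..1} t *\<^sub>R (T 0 t - T M t)) \<partial>lborel)"
      by (rule integral_scaleR_right[symmetric])
    also have "\<dots> = (\<integral>t. indicator {0..1} t *\<^sub>R (((- 1) ^ m * (- 1) ^ M / fact m * k M t) *\<^sub>R h 0 t + (- ((- 1) ^ m) / fact m * k 0 t) *\<^sub>R h (m + 2) t) \<partial>lborel)"
      unfolding T_def by (intro Bochner_Integration.integral_cong refl) (simp add: M_def algebra_simps)
    finally show "h 1 0 = (\<integral>t. indicator {0..1} t *\<^sub>R (((- 1) ^ m * (- 1) ^ M / fact m * k M t) *\<^sub>R h 0 t + (- ((- 1) ^ m) / fact m * k 0 t) *\<^sub>R h (m + 2) t) \<partial>lborel)" .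
  qed
qed

lemma nn_integral_square_le_interval:
  assumes [measurable]: "f \<in> borel_measurable borel" and d: "d \<ge> 0"
  shows "(\<integral>\<^sup>+t. indicator {0..d} t * f t \<partial>lborel)\<^sup>2 \<le> ennreal d * (\<integral>\<^sup>+t. indicator {0..d} t * (f t)\<^sup>2 \<partial>lborel)"
proof -
  have "(\<integral>\<^sup>+t. indicator {0..d} t * f t \<partial>lborel) = (\<integral>\<^sup>+t. indicator {0..d} t * (indicator {0..d} t * f t) \<partial>lborel)"
    by (intro nn_integral_cong) (auto simp: indicator_def)
  then have "(\<integral>\<^sup>+t. indicator {0..d} t * f t \<partial>lborel)\<^sup>2 \<le> (\<integral>\<^sup>+t. (indicator {0..d} t)\<^sup>2 \<partial>lborel) * (\<integral>\<^sup>+t. (indicator {0..d} t * f t)\<^sup>2 \<partial>lborel)"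
    using Cauchy_Schwarz_nn_integral[of "indicator {0..d}" lborel "\<lambda>t. indicator {0..d} t * f t"] by simp
  also have "(\<integral>\<^sup>+t. (indicator {0..d} t)\<^sup>2 \<partial>lborel) = (\<integral>\<^sup>+t. indicator {0..d} t \<partial>lborel)"
    by (intro nn_integral_cong) (auto simp: indicator_def)
  also have "\<dots> = ennreal d" using d by simp
  also have "(\<integral>\<^sup>+t. (indicator {0..d} t * f t)\<^sup>2 \<partial>lborel) = (\<integral>\<^sup>+t. indicator {0..d} t * (f t)\<^sup>2 \<partial>lborel)"
    by (intro nn_integral_cong) (auto simp: indicator_def)
  finally show ?thesis .
qed

lemma add_square_le_ennreal: "(a + b)\<^sup>2 \<le> 2 * (a\<^sup>2 + b\<^sup>2 :: ennreal)"
proof (cases "a = \<infinity> \<or> b = \<infinity>")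
  case False
  then obtain r s where "a = ennreal r" "b = ennreal s" "r \<ge> 0" "s \<ge> 0"
    by (metis ennreal_cases infinity_ennreal_def)
  moreover have "(r + s)\<^sup>2 \<le> 2 * (r\<^sup>2 + s\<^sup>2)" using sum_squares_bound[of r s] by (simp add: power2_sum)
  moreover have "(2::ennreal) * ennreal x = ennreal (2 * x)" if "x \<ge> 0" for x
    using that by (simp add: ennreal_mult)
  ultimately show ?thesis
    by (simp add: ennreal_power ennreal_plus[symmetric] ennreal_leI del: ennreal_plus)
qed (auto simp: power2_eq_square ennreal_mult_top ennreal_top_mult)

text \<open>The kernels do not depend on h, so K depends on m only, and the inequality can
  afterwards be integrated over the base point of a line. In 2 L^2, L bounds both kernels on [0, 1]
  and 2 comes from the square of a sum.\<close>

lemma landau_pointwise: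
  obtains K :: real where "K \<ge> 0"
    "\<And>h :: nat \<Rightarrow> real \<Rightarrow> complex. (\<And>k t. (h k has_vector_derivative h (Suc k) t) (at t)) \<Longrightarrow>
      ennreal ((norm (h 1 0))\<^sup>2) \<le> ennreal K * (\<integral>\<^sup>+t. indicator {0..1} t *
        (ennreal ((norm (h 0 t))\<^sup>2) + ennreal ((norm (h (m + 2) t))\<^sup>2)) \<partial>lborel)"
proof -
  obtain \<psi> \<kappa> :: "real \<Rightarrow> real" where c: "continuous_on UNIV \<psi>" "continuous_on UNIV \<kappa>"
    and id: "\<And>h :: nat \<Rightarrow> real \<Rightarrow> complex. (\<And>k t. (h k has_vector_derivative h (Suc k) t) (at t)) \<Longrightarrow>
      h 1 0 = (\<integral>t. indicator {0..1} t *\<^sub>R (\<psi> t *\<^sub>R h 0 t + \<kappa> t *\<^sub>R h (m + 2) t) \<partial>lborel)"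
    using landau_kernel[of m thesis] by blast
  have "bounded (\<psi> ` {0..1})" "bounded (\<kappa> ` {0..1})"
    using c by (auto intro!: compact_imp_bounded compact_continuous_image continuous_on_subset[of UNIV])
  then obtain A B where "\<forall>x\<in>\<psi> ` {0..1}. norm x \<le> A" "\<forall>x\<in>\<kappa> ` {0..1}. norm x \<le> B"
    unfolding bounded_iff by blast
  then have A: "\<And>t. t \<in> {0..1} \<Longrightarrow> \<bar>\<psi> t\<bar> \<le> A" and B: "\<And>t. t \<in> {0..1} \<Longrightarrow> \<bar>\<kappa> t\<bar> \<le> B"
    by auto
  define L where "L = max A B"
  have L: "\<bar>\<psi> t\<bar> \<le> L" "\<bar>\<kappa> t\<bar> \<le> L" if "t \<in> {0..1}" for t
    using A[OF that] B[OF that] by (auto simp: L_def)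
  have L0: "L \<ge> 0" using L(1)[of 0] by simp
  show thesis
  proof (rule that[of "2 * L\<^sup>2"])
    fix h :: "nat \<Rightarrow> real \<Rightarrow> complex"
    assume h: "\<And>k t. (h k has_vector_derivative h (Suc k) t) (at t)"
    have "continuous_on UNIV (h j)" for j
      using h by (meson continuous_at_imp_continuous_on has_vector_derivative_continuous)
    then have [measurable]: "h j \<in> borel_measurable borel" for j by (rule borel_measurable_continuous_onI)
    have "ennreal (norm (h 1 0)) \<le> (\<integral>\<^sup>+t. ennreal (norm (indicator {0..1} t *\<^sub>R (\<psi> t *\<^sub>R h 0 t + \<kappa> t *\<^sub>R h (m + 2) t))) \<partial>lborel)"
      unfolding id[of h, OF h] by (rule norm_integral_le_nn_integral)
    also have "\<dots> \<le> (\<integral>\<^sup>+t. indicator {0..1} t * (ennreal L * (ennreal (norm (h 0 t)) + ennreal (norm (h (m + 2) t)))) \<partial>lborel)"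
    proof (rule nn_integral_mono)
      fix t :: real
      show "ennreal (norm (indicator {0..1} t *\<^sub>R (\<psi> t *\<^sub>R h 0 t + \<kappa> t *\<^sub>R h (m + 2) t)))
        \<le> indicator {0..1} t * (ennreal L * (ennreal (norm (h 0 t)) + ennreal (norm (h (m + 2) t))))"
      proof (cases "t \<in> {0..1}")
        case True
        have "norm (\<psi> t *\<^sub>R h 0 t + \<kappa> t *\<^sub>R h (m + 2) t) \<le> \<bar>\<psi> t\<bar> * norm (h 0 t) + \<bar>\<kappa> t\<bar> * norm (h (m + 2) t)"
          by (rule order_trans[OF norm_triangle_ineq]) simp
        also have "\<dots> \<le> L * norm (h 0 t) + L * norm (h (m + 2) t)"
          by (intro add_mono mult_right_mono L True) auto
        finally have "ennreal (norm (\<psi> t *\<^sub>R h 0 t + \<kappa> t *\<^sub>R h (m + 2) t)) \<le> ennreal (L * (norm (h 0 t) + norm (h (m + 2) t)))"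
          by (intro ennreal_leI) (simp add: distrib_left)
        then show ?thesis using True L0 by (simp add: ennreal_mult ennreal_plus)
      qed simp
    qed
    finally have "(ennreal (norm (h 1 0)))\<^sup>2 \<le> \<dots>\<^sup>2" by (rule power_mono) simp
    also have "\<dots> \<le> ennreal 1 * (\<integral>\<^sup>+t. indicator {0..1} t * (ennreal L * (ennreal (norm (h 0 t)) + ennreal (norm (h (m + 2) t))))\<^sup>2 \<partial>lborel)"
      by (rule nn_integral_square_le_interval) simp_all
    also have "\<dots> \<le> (\<integral>\<^sup>+t. ennreal (2 * L\<^sup>2) * (indicator {0..1} t * (ennreal ((norm (h 0 t))\<^sup>2) + ennreal ((norm (h (m + 2) t))\<^sup>2))) \<partial>lborel)"
      unfolding ennreal_1 mult_1_left
    proof (rule nn_integral_mono)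
      fix t :: real
      have "(ennreal L * (ennreal (norm (h 0 t)) + ennreal (norm (h (m + 2) t))))\<^sup>2
        \<le> (ennreal L)\<^sup>2 * (2 * ((ennreal (norm (h 0 t)))\<^sup>2 + (ennreal (norm (h (m + 2) t)))\<^sup>2))"
        unfolding power_mult_distrib by (intro mult_left_mono add_square_le_ennreal) simp
      also have "\<dots> = ennreal (2 * L\<^sup>2) * (ennreal ((norm (h 0 t))\<^sup>2) + ennreal ((norm (h (m + 2) t))\<^sup>2))"
        using L0 by (simp add: ennreal_power ennreal_mult algebra_simps)
      finally show "indicator {0..1} t * (ennreal L * (ennreal (norm (h 0 t)) + ennreal (norm (h (m + 2) t))))\<^sup>2
        \<le> ennreal (2 * L\<^sup>2) * (indicator {0..1} t * (ennreal ((norm (h 0 t))\<^sup>2) + ennreal ((norm (h (m + 2) t))\<^sup>2)))"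
        by (auto simp: indicator_def)
    qed
    also have "\<dots> = ennreal (2 * L\<^sup>2) * (\<integral>\<^sup>+t. indicator {0..1} t * (ennreal ((norm (h 0 t))\<^sup>2) + ennreal ((norm (h (m + 2) t))\<^sup>2)) \<partial>lborel)"
      by (rule nn_integral_cmult) measurable
    finally show "ennreal ((norm (h 1 0))\<^sup>2) \<le> ennreal (2 * L\<^sup>2) * (\<integral>\<^sup>+t. indicator {0..1} t *
        (ennreal ((norm (h 0 t))\<^sup>2) + ennreal ((norm (h (m + 2) t))\<^sup>2)) \<partial>lborel)"
      by (simp add: ennreal_power)
  qed simp
qed

lemma ball_fst_borel_measurable [measurable]:
  "(\<lambda>w. indicator (ball x0 1) (fst w) :: ennreal) \<in> borel_measurable (borel :: ('a::euclidean_space \<times> 'b::euclidean_space) measure)"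
proof -
  have "(fst :: 'a \<times> 'b \<Rightarrow> 'a) \<in> borel_measurable borel"
    by (intro borel_measurable_continuous_onI continuous_intros)
  then show ?thesis by (rule measurable_compose) (rule borel_measurable_indicator, simp)
qed

lemma nn_integral_lborel_swap:
  fixes H :: "'a::euclidean_space \<Rightarrow> 'b::euclidean_space \<Rightarrow> ennreal"
  assumes "(\<lambda>z. H (fst z) (snd z)) \<in> borel_measurable borel"
  shows "(\<integral>\<^sup>+w. \<integral>\<^sup>+t. H w t \<partial>lborel \<partial>lborel) = (\<integral>\<^sup>+t. \<integral>\<^sup>+w. H w t \<partial>lborel \<partial>lborel)"
  using lborel_pair.Fubini[of "\<lambda>z. H (fst z) (snd z)"] assms by (simp add: lborel_prod)

lemma ball_fst_mult_borel_measurable: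
  fixes h :: "'a::euclidean_space \<times> 'b::euclidean_space \<Rightarrow> complex"
  assumes [measurable]: "h \<in> borel_measurable borel"
  shows "(\<lambda>w. indicator (ball x0 1) (fst w) * ennreal ((norm (h w))\<^sup>2)) \<in> borel_measurable borel"
  by (intro borel_measurable_times_ennreal ball_fst_borel_measurable) measurable

section \<open>Uniform slice bounds for the frequency derivatives of the symbol\<close>

context bounded_symbol
begin

text \<open>The integral of the hypothesis, written over pairs (x, \<eta>): a translation in \<eta>
  is then a translation of the product space, and Fubini with the Landau variable is a single
  exchange. \<open>slice_eq_iterated\<close> recovers the iterated form.\<close>

definition slice :: "'n triple list \<Rightarrow> real^'n \<Rightarrow> real^'n \<Rightarrow> ennreal" where
  "slice ds x0 \<zeta> = (\<integral>\<^sup>+w. indicator (ball x0 1) (fst w) * ennreal ((norm (D ds (fst w, \<zeta> - snd w, snd w)))\<^sup>2) \<partial>lborel)"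

definition slice_bounded :: "'n triple list \<Rightarrow> bool" where
  "slice_bounded ds \<longleftrightarrow> (\<exists>C::real. \<forall>x0 \<zeta>. slice ds x0 \<zeta> \<le> ennreal C)"

lemma D_slice_measurable [measurable]:
  "(\<lambda>w. D ds (fst w, \<zeta> - snd w, snd w)) \<in> borel_measurable borel"
  by (intro borel_measurable_continuous_onI continuous_on_compose2[OF continuous_D[of UNIV]] continuous_intros) auto

lemma slice_eq_iterated:
  "slice ds x0 \<zeta> = (\<integral>\<^sup>+x\<in>ball x0 1. (\<integral>\<^sup>+\<eta>. ennreal ((norm (D ds (x, \<zeta> - \<eta>, \<eta>)))\<^sup>2) \<partial>lborel) \<partial>lborel)"
proof -
  let ?h = "\<lambda>w. indicator (ball x0 1) (fst w) * ennreal ((norm (D ds (fst w, \<zeta> - snd w, snd w)))\<^sup>2)"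
  have "?h \<in> borel_measurable borel" by (rule ball_fst_mult_borel_measurable[OF D_slice_measurable])
  then have m: "?h \<in> borel_measurable (lborel \<Otimes>\<^sub>M lborel)" by (simp add: lborel_prod)
  have c: "(\<lambda>\<eta>. D ds (x, \<zeta> - \<eta>, \<eta>)) \<in> borel_measurable borel" for x
    by (intro borel_measurable_continuous_onI continuous_on_compose2[OF continuous_D[of UNIV]] continuous_intros) auto
  have "slice ds x0 \<zeta> = (\<integral>\<^sup>+x. \<integral>\<^sup>+\<eta>. ?h (x, \<eta>) \<partial>lborel \<partial>lborel)"
    unfolding slice_def lborel_prod[symmetric] using lborel.nn_integral_fst[OF m] by simp
  also have "\<dots> = (\<integral>\<^sup>+x\<in>ball x0 1. (\<integral>\<^sup>+\<eta>. ennreal ((norm (D ds (x, \<zeta> - \<eta>, \<eta>)))\<^sup>2) \<partial>lborel) \<partial>lborel)"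
    using c by (intro nn_integral_cong) (simp add: nn_integral_cmult mult.commute)
  finally show ?thesis .
qed

text \<open>A step in the \<xi> direction changes \<zeta> by t e. A step in the \<eta> direction has
  the same effect once \<eta> + t e is taken as the new variable of integration. So a bound uniform
  in \<zeta> survives every frequency translation.\<close>

lemma slice_shift:
  assumes "c \<in> freq_basis"
  shows "\<exists>\<zeta>'. (\<integral>\<^sup>+w. indicator (ball x0 1) (fst w) * ennreal ((norm (D ds ((fst w, \<zeta> - snd w, snd w) + t *\<^sub>R c)))\<^sup>2) \<partial>lborel) = slice ds x0 \<zeta>'"
  using assms unfolding freq_basis_def
proof (elim UnE imageE)
  fix e :: "real^'n" assume c: "c = (0, e, 0)"
  have "(x, \<zeta> - \<eta>, \<eta>) + t *\<^sub>R c = (x, (\<zeta> + t *\<^sub>R e) - \<eta>, \<eta>)" for x \<eta> by (simp add: c)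
  then show ?thesis unfolding slice_def by auto
next
  fix e :: "real^'n" assume c: "c = (0, 0, e)"
  let ?h = "\<lambda>w. indicator (ball x0 1) (fst w) * ennreal ((norm (D ds (fst w, (\<zeta> + t *\<^sub>R e) - snd w, snd w)))\<^sup>2)"
  have "(x, \<zeta> - \<eta>, \<eta>) + t *\<^sub>R c = (x, (\<zeta> + t *\<^sub>R e) - (\<eta> + t *\<^sub>R e), \<eta> + t *\<^sub>R e)" for x \<eta> by (simp add: c)
  then have "(\<integral>\<^sup>+w. indicator (ball x0 1) (fst w) * ennreal ((norm (D ds ((fst w, \<zeta> - snd w, snd w) + t *\<^sub>R c)))\<^sup>2) \<partial>lborel)
     = (\<integral>\<^sup>+w. ?h (w + (0, t *\<^sub>R e)) \<partial>lborel)" by simp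
  also have "\<dots> = slice ds x0 (\<zeta> + t *\<^sub>R e)"
    unfolding slice_def
    by (rule nn_integral_lborel_translate) (rule ball_fst_mult_borel_measurable[OF D_slice_measurable])
  finally show ?thesis by blast
qed

text \<open>The Landau inequality on the segment from p in direction c bounds the first c-derivative
  at p by the function and its derivative of order m + 2 along the segment. Integrating over the
  slice and exchanging the integrals turns each t into a shifted slice, with the same
  constants.\<close>

lemma slice_bounded_Cons:
  assumes c: "c \<in> freq_basis" and 0: "slice_bounded ds" and 1: "slice_bounded (replicate (m + 2) c @ ds)"
  shows "slice_bounded (c # ds)"
proof -
  define E where "E = replicate (m + 2) c @ ds"
  from 0 obtain C0 where C0: "\<And>x0 \<zeta>. slice ds x0 \<zeta> \<le> ennreal C0" unfolding slice_bounded_def by blast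
  from 1 obtain C1 where C1: "\<And>x0 \<zeta>. slice E x0 \<zeta> \<le> ennreal C1" unfolding slice_bounded_def E_def by blast
  obtain K :: real where K: "K \<ge> 0"
    "\<And>h :: nat \<Rightarrow> real \<Rightarrow> complex. (\<And>k t. (h k has_vector_derivative h (Suc k) t) (at t)) \<Longrightarrow>
      ennreal ((norm (h 1 0))\<^sup>2) \<le> ennreal K * (\<integral>\<^sup>+t. indicator {0..1} t *
        (ennreal ((norm (h 0 t))\<^sup>2) + ennreal ((norm (h (m + 2) t))\<^sup>2)) \<partial>lborel)"
    using landau_pointwise[of m thesis] by blast
  have pw: "ennreal ((norm (D (c # ds) p))\<^sup>2) \<le> ennreal K * (\<integral>\<^sup>+t. indicator {0..1} t *
        (ennreal ((norm (D ds (p + t *\<^sub>R c)))\<^sup>2) + ennreal ((norm (D E (p + t *\<^sub>R c)))\<^sup>2)) \<partial>lborel)" for p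
    using K(2)[of "\<lambda>k t. D (replicate k c @ ds) (p + t *\<^sub>R c)"] dir_derivD[OF dir_deriv_D[of c]]
    by (simp add: E_def)
  have "slice (c # ds) x0 \<zeta> \<le> ennreal K * (ennreal C0 + ennreal C1)" for x0 \<zeta>
  proof -
    let ?p = "\<lambda>w. (fst w, \<zeta> - snd w, snd w) :: 'n triple"
    let ?u = "\<lambda>F w t. indicator (ball x0 1) (fst w) * ennreal ((norm (D F (?p w + t *\<^sub>R c)))\<^sup>2)"
    have "(\<lambda>z. D F (?p (fst z) + snd z *\<^sub>R c)) \<in> borel_measurable borel" for F
      by (intro borel_measurable_continuous_onI continuous_on_compose2[OF continuous_D[of UNIV]] continuous_intros) auto
    then have mD: "(\<lambda>z. ennreal ((norm (D F (?p (fst z) + snd z *\<^sub>R c)))\<^sup>2)) \<in> borel_measurable borel" for F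
      by (rule measurable_compose[of _ _ borel "\<lambda>c. ennreal ((norm c)\<^sup>2)"]) measurable
    have fb: "(fst :: ((real^'n) \<times> (real^'n)) \<times> real \<Rightarrow> _) \<in> borel_measurable borel"
      "(snd :: ((real^'n) \<times> (real^'n)) \<times> real \<Rightarrow> _) \<in> borel_measurable borel"
      by (intro borel_measurable_continuous_onI continuous_intros)+
    have mB: "(\<lambda>z. indicator (ball x0 1) (fst (fst z)) :: ennreal) \<in> borel_measurable (borel :: (((real^'n) \<times> (real^'n)) \<times> real) measure)"
      by (rule measurable_compose[OF fb(1) ball_fst_borel_measurable])
    have mI: "(\<lambda>z. indicator {0..1} (snd z) :: ennreal) \<in> borel_measurable (borel :: (((real^'n) \<times> (real^'n)) \<times> real) measure)"
      by (rule measurable_compose[OF fb(2)]) (rule borel_measurable_indicator, simp)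
    have mw [measurable]: "(\<lambda>w. D F (?p w + t *\<^sub>R c)) \<in> borel_measurable borel"
      and mt [measurable]: "(\<lambda>t. D F (?p w + t *\<^sub>R c)) \<in> borel_measurable borel" for F t w
      by (intro borel_measurable_continuous_onI continuous_on_compose2[OF continuous_D[of UNIV]] continuous_intros; auto)+
    have sh: "(\<integral>\<^sup>+w. ?u F w t \<partial>lborel) \<le> ennreal C" if "\<And>x0 \<zeta>. slice F x0 \<zeta> \<le> ennreal C" for F t C
      using slice_shift[OF c, of x0 F \<zeta> t] that by auto
    have "slice (c # ds) x0 \<zeta> \<le> (\<integral>\<^sup>+w. \<integral>\<^sup>+t. ennreal K * (indicator {0..1} t * (?u ds w t + ?u E w t)) \<partial>lborel \<partial>lborel)"
      unfolding slice_def
    proof (rule nn_integral_mono)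
      fix w :: "(real^'n) \<times> (real^'n)"
      have "indicator (ball x0 1) (fst w) * ennreal ((norm (D (c # ds) (?p w)))\<^sup>2) \<le>
        indicator (ball x0 1) (fst w) * (ennreal K * (\<integral>\<^sup>+t. indicator {0..1} t *
        (ennreal ((norm (D ds (?p w + t *\<^sub>R c)))\<^sup>2) + ennreal ((norm (D E (?p w + t *\<^sub>R c)))\<^sup>2)) \<partial>lborel))"
        by (intro mult_left_mono pw) auto
      also have "\<dots> = (\<integral>\<^sup>+t. ennreal K * (indicator {0..1} t * (?u ds w t + ?u E w t)) \<partial>lborel)"
        by (subst nn_integral_cmult, measurable, subst mult.left_commute, subst nn_integral_cmult[symmetric], measurable)
           (simp add: algebra_simps)
      finally show "indicator (ball x0 1) (fst w) * ennreal ((norm (D (c # ds) (?p w)))\<^sup>2) \<le> (\<integral>\<^sup>+t. ennreal K * (indicator {0..1} t * (?u ds w t + ?u E w t)) \<partial>lborel)" .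
    qed
    also have "\<dots> = (\<integral>\<^sup>+t. \<integral>\<^sup>+w. ennreal K * (indicator {0..1} t * (?u ds w t + ?u E w t)) \<partial>lborel \<partial>lborel)"
      by (rule nn_integral_lborel_swap)
         (intro borel_measurable_times_ennreal borel_measurable_add borel_measurable_const mB mI mD)
    also have "\<dots> \<le> (\<integral>\<^sup>+t. ennreal K * (indicator {0..1::real} t * (ennreal C0 + ennreal C1)) \<partial>lborel)"
    proof (rule nn_integral_mono)
      fix t :: real
      have "(\<integral>\<^sup>+w. ennreal K * (indicator {0..1} t * (?u ds w t + ?u E w t)) \<partial>lborel)
        = ennreal K * (indicator {0..1} t * ((\<integral>\<^sup>+w. ?u ds w t \<partial>lborel) + (\<integral>\<^sup>+w. ?u E w t \<partial>lborel)))"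
        by (simp add: nn_integral_cmult nn_integral_add)
      also have "\<dots> \<le> ennreal K * (indicator {0..1} t * (ennreal C0 + ennreal C1))"
        by (intro mult_left_mono add_mono sh C0 C1) auto
      finally show "(\<integral>\<^sup>+w. ennreal K * (indicator {0..1} t * (?u ds w t + ?u E w t)) \<partial>lborel)
        \<le> ennreal K * (indicator {0..1} t * (ennreal C0 + ennreal C1))" .
    qed
    also have "\<dots> = ennreal K * (ennreal C0 + ennreal C1)"
      by (simp add: nn_integral_cmult nn_integral_multc)
    finally show ?thesis .
  qed
  \<comment> \<open>\<open>ennreal\<close> sends negative reals to 0, so passing to nonnegative
    parts of the constants changes nothing.\<close>
  also have "ennreal K * (ennreal C0 + ennreal C1) = ennreal K * (ennreal (max 0 C0) + ennreal (max 0 C1))"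
    by (simp add: max_def ennreal_neg)
  also have "\<dots> = ennreal (K * (max 0 C0 + max 0 C1))"
    using K(1) by (simp add: ennreal_mult ennreal_plus)
  finally show ?thesis unfolding slice_bounded_def by blast
qed

text \<open>Squaring cancels the 1/2 in the exponent: with q = 1 + |\<xi>|^2 + |\<eta>|^2 and k =
  \<open>n_xieta ds\<close> the square is at most C^2 q^(-\<rho> k). For \<rho> k >= n this is at
  most C^2 (1 + |\<eta>|^2)^(-n), which is below C^2 \<open>weight \<eta>\<close> factor by factor,
  uniformly in x and \<xi>; the ball has finite volume.\<close>

lemma slice_bounded_high_order:
  assumes ds: "ds \<in> lists Basis" and n: "CARD('n) \<le> \<rho> * n_xieta ds"
  shows "slice_bounded ds"
proof -
  from D_decay[OF ds] obtain C where C: "C \<ge> 0"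
    "\<And>x \<xi> \<eta>. norm (D ds (x, \<xi>, \<eta>)) \<le> C * (1 + (norm \<xi>)\<^sup>2 + (norm \<eta>)\<^sup>2) powr (- \<rho> * n_xieta ds / 2)" by blast
  have b: "ennreal ((norm (D ds (x, \<xi>, \<eta>)))\<^sup>2) \<le> ennreal (C\<^sup>2) * ennreal (weight \<eta>)" for x \<xi> \<eta>
  proof -
    let ?q = "1 + (norm \<xi>)\<^sup>2 + (norm \<eta>)\<^sup>2"
    have q: "?q \<ge> 1 + (norm \<eta>)\<^sup>2" by simp
    have q1: "1 + (norm \<eta>)\<^sup>2 > 0" by (intro add_pos_nonneg) auto
    have q0: "?q > 0" by (intro add_pos_nonneg) auto
    have "(norm (D ds (x, \<xi>, \<eta>)))\<^sup>2 \<le> (C * ?q powr (- \<rho> * n_xieta ds / 2))\<^sup>2"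
      by (intro power_mono C) auto
    also have "\<dots> = C\<^sup>2 * ?q powr (- \<rho> * n_xieta ds)"
      by (simp add: power_mult_distrib power2_eq_square powr_add[symmetric])
    also have "?q powr (- \<rho> * n_xieta ds) \<le> ?q powr (- real CARD('n))"
      using n q0 q1 by (intro powr_mono) auto
    also have "\<dots> = 1 / ?q ^ CARD('n)" using q0 by (simp add: powr_minus powr_realpow divide_inverse)
    also have "\<dots> \<le> 1 / (1 + (norm \<eta>)\<^sup>2) ^ CARD('n)"
      using q q0 q1 by (intro divide_left_mono power_mono mult_pos_pos zero_less_power) auto
    also have "\<dots> = (\<Prod>b\<in>(Basis :: (real^'n) set). 1 / (1 + (norm \<eta>)\<^sup>2))" by (simp add: power_one_over)
    also have "\<dots> \<le> weight \<eta>"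
      unfolding weight_def
    proof (rule prod_mono)
      fix b :: "real^'n" assume "b \<in> Basis"
      then have "\<bar>\<eta> \<bullet> b\<bar> \<le> norm \<eta>" by (rule Basis_le_norm)
      then have "(\<eta> \<bullet> b)\<^sup>2 \<le> (norm \<eta>)\<^sup>2" by (metis abs_ge_zero power2_abs power_mono)
      then show "0 \<le> 1 / (1 + (norm \<eta>)\<^sup>2) \<and> 1 / (1 + (norm \<eta>)\<^sup>2) \<le> 1 / (1 + (\<eta> \<bullet> b)\<^sup>2)"
        by (auto intro!: divide_left_mono mult_pos_pos add_pos_nonneg)
    qed
    finally show ?thesis
      using C(1) by (simp add: ennreal_mult[symmetric] weight_nonneg ennreal_leI mult_left_mono)
  qed
  define I where "I = enn2real (\<integral>\<^sup>+\<eta>. ennreal (weight (\<eta>::real^'n)) \<partial>lborel)"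
  have I: "(\<integral>\<^sup>+\<eta>. ennreal (weight (\<eta>::real^'n)) \<partial>lborel) = ennreal I"
    unfolding I_def using nn_integral_weight_finite[where 'a="real^'n"] by (simp add: less_top)
  define V where "V = measure lborel (ball (0::real^'n) 1)"
  have V: "emeasure lborel (ball x0 1) = ennreal V" for x0 :: "real^'n"
    unfolding V_def by (simp add: emeasure_eq_ennreal_measure content_ball emeasure_ball)
  have "slice ds x0 \<zeta> \<le> ennreal (C\<^sup>2 * I * V)" for x0 \<zeta>
  proof -
    have "slice ds x0 \<zeta> \<le> (\<integral>\<^sup>+x\<in>ball x0 1. (\<integral>\<^sup>+\<eta>. ennreal (C\<^sup>2) * ennreal (weight (\<eta>::real^'n)) \<partial>lborel) \<partial>lborel)"
      unfolding slice_eq_iterated by (intro nn_integral_mono mult_right_mono b) auto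
    also have "\<dots> = ennreal (C\<^sup>2) * ennreal I * emeasure lborel (ball x0 1)"
      by (simp add: nn_integral_cmult I nn_integral_cmult_indicator)
    also have "\<dots> = ennreal (C\<^sup>2 * I * V)" unfolding V by (simp add: ennreal_mult I_def V_def)
    finally show ?thesis .
  qed
  then show ?thesis unfolding slice_bounded_def by blast
qed

lemma n_xieta_replicate_freq: "c \<in> freq_basis \<Longrightarrow> n_xieta (replicate k c @ ds) \<ge> k"
  unfolding n_xieta_def freq_basis_def by auto

text \<open>Each new direction c is added by \<open>slice_bounded_Cons\<close>. Its high-order
  premise is automatic for m >= n / \<rho>, because the m + 2 copies of c alone supply enough
  decay.\<close>

lemma slice_bounded_append:
  assumes "slice_bounded ds" "ds \<in> lists Basis" "set J \<subseteq> freq_basis"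
  shows "slice_bounded (J @ ds)"
  using assms(3)
proof (induction J)
  case (Cons c J)
  then have c: "c \<in> freq_basis" and J: "J @ ds \<in> lists Basis"
    using freq_basis_subset assms(2) by auto
  obtain m :: nat where m: "real CARD('n) / \<rho> \<le> m" using real_arch_simple by blast
  have "slice_bounded (replicate (m + 2) c @ J @ ds)"
  proof (rule slice_bounded_high_order)
    show "replicate (m + 2) c @ J @ ds \<in> lists Basis" using c J freq_basis_subset by auto
    have "CARD('n) \<le> \<rho> * m" using m rho_pos by (simp add: field_simps)
    also have "\<dots> \<le> \<rho> * n_xieta (replicate (m + 2) c @ J @ ds)"
      using n_xieta_replicate_freq[OF c, of "m + 2" "J @ ds"] rho_pos by (intro mult_left_mono) auto
    finally show "CARD('n) \<le> \<rho> * n_xieta (replicate (m + 2) c @ J @ ds)" .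
  qed
  from slice_bounded_Cons[OF c Cons.IH this] Cons.prems show ?case by simp
qed (use assms in simp)

end

section \<open>A Sobolev inequality on small cubes\<close>

text \<open>The integral over the cube of side d with corner z, spanned by the listed directions. It
  is iterated one direction at a time, in step with the induction that proves the Sobolev
  inequality.\<close>

fun box_integral :: "real \<Rightarrow> 'a::euclidean_space list \<Rightarrow> ('a \<Rightarrow> ennreal) \<Rightarrow> 'a \<Rightarrow> ennreal" where
  "box_integral d [] G z = G z"
| "box_integral d (b # bs) G z = (\<integral>\<^sup>+t. indicator {0..d} t * box_integral d bs G (z + t *\<^sub>R b) \<partial>lborel)"

lemma box_integral_measurable [measurable]:
  assumes [measurable]: "G \<in> borel_measurable borel"
  shows "box_integral d bs G \<in> borel_measurable borel"
proof (induction bs)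
  case (Cons b bs)
  note [measurable] = Cons.IH
  have "(\<lambda>z. \<integral>\<^sup>+t. indicator {0..d} t * box_integral d bs G (z + t *\<^sub>R b) \<partial>lborel) \<in> borel_measurable borel"
    by measurable
  then show ?case by (simp add: box_integral.simps(2)[abs_def])
qed simp

lemma box_integral_eq_product:
  fixes bs :: "'a::euclidean_space list"
  assumes [measurable]: "G \<in> borel_measurable borel" and "distinct bs"
  shows "box_integral d bs G z = (\<integral>\<^sup>+y. G (z + (\<Sum>b\<in>set bs. y b *\<^sub>R b)) * (\<Prod>b\<in>set bs. indicator {0..d} (y b))
    \<partial>(\<Pi>\<^sub>M b\<in>set bs. lborel))"
  using assms(2)
proof (induction bs arbitrary: z)
  case Nil
  interpret product_sigma_finite "\<lambda>b::'a. lborel :: real measure" by standard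
  show ?case by (simp add: PiM_empty nn_integral_count_space_finite)
next
  case (Cons b bs)
  interpret product_sigma_finite "\<lambda>b::'a. lborel :: real measure" by standard
  let ?M = "\<Pi>\<^sub>M b\<in>set bs. (lborel :: real measure)"
  from Cons.prems have b: "b \<notin> set bs" and d: "distinct bs" by auto
  have "(\<integral>\<^sup>+y. G (z + (\<Sum>b\<in>set (b # bs). y b *\<^sub>R b)) * (\<Prod>b\<in>set (b # bs). indicator {0..d} (y b)) \<partial>(\<Pi>\<^sub>M b\<in>set (b # bs). lborel))
    = (\<integral>\<^sup>+t. \<integral>\<^sup>+y. G (z + (\<Sum>c\<in>insert b (set bs). (y(b := t)) c *\<^sub>R c)) * (\<Prod>c\<in>insert b (set bs). indicator {0..d} ((y(b := t)) c)) \<partial>?M \<partial>lborel)"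
    unfolding list.set by (rule product_nn_integral_insert_rev) (use b in \<open>auto\<close>)
  also have "\<dots> = (\<integral>\<^sup>+t. \<integral>\<^sup>+y. indicator {0..d} t * (G ((z + t *\<^sub>R b) + (\<Sum>c\<in>set bs. y c *\<^sub>R c)) * (\<Prod>c\<in>set bs. indicator {0..d} (y c))) \<partial>?M \<partial>lborel)"
  proof (intro nn_integral_cong)
    fix t y
    have s: "(\<Sum>c\<in>set bs. (y(b := t)) c *\<^sub>R c) = (\<Sum>c\<in>set bs. y c *\<^sub>R c)"
      and p: "(\<Prod>c\<in>set bs. indicator {0..d} ((y(b := t)) c) :: ennreal) = (\<Prod>c\<in>set bs. indicator {0..d} (y c))"
      using b by (auto intro!: sum.cong prod.cong)
    show "G (z + (\<Sum>c\<in>insert b (set bs). (y(b := t)) c *\<^sub>R c)) * (\<Prod>c\<in>insert b (set bs). indicator {0..d} ((y(b := t)) c))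
      = indicator {0..d} t * (G ((z + t *\<^sub>R b) + (\<Sum>c\<in>set bs. y c *\<^sub>R c)) * (\<Prod>c\<in>set bs. indicator {0..d} (y c)))"
      using b by (simp only: sum.insert prod.insert finite_set not_False_eq_True s p fun_upd_same) (simp add: add.assoc mult_ac)
  qed
  also have "\<dots> = (\<integral>\<^sup>+t. indicator {0..d} t * box_integral d bs G (z + t *\<^sub>R b) \<partial>lborel)"
    unfolding Cons.IH[OF d] by (intro nn_integral_cong nn_integral_cmult) measurable
  finally show ?case by simp
qed

lemma box_integral_le_cball:
  fixes G :: "'a::euclidean_space \<Rightarrow> ennreal" and d :: real
  assumes [measurable]: "G \<in> borel_measurable borel" and "distinct bs" "set bs = Basis"
  shows "box_integral d bs G z \<le> (\<integral>\<^sup>+y. G y * indicator (cball z (DIM('a) * d)) y \<partial>lborel)"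
proof -
  have "box_integral d bs G z = (\<integral>\<^sup>+y. G (z + (\<Sum>b\<in>Basis. y b *\<^sub>R b)) * (\<Prod>b\<in>Basis. indicator {0..d} ((\<Sum>c\<in>Basis. y c *\<^sub>R c) \<bullet> b))
    \<partial>(\<Pi>\<^sub>M b\<in>Basis. lborel))"
    unfolding box_integral_eq_product[OF assms(1,2)] assms(3)
    by (intro nn_integral_cong arg_cong2[where f="(*)"] refl prod.cong) simp
  also have "\<dots> = (\<integral>\<^sup>+y. G (z + y) * (\<Prod>b\<in>Basis. indicator {0..d} (y \<bullet> b)) \<partial>lborel)"
    unfolding lborel_eq[where 'a='a] by (subst nn_integral_distr) auto
  also have "\<dots> \<le> (\<integral>\<^sup>+y. G (y + z) * indicator (cball z (DIM('a) * d)) (y + z) \<partial>lborel)"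
  proof (rule nn_integral_mono)
    fix y :: 'a
    show "G (z + y) * (\<Prod>b\<in>Basis. indicator {0..d} (y \<bullet> b)) \<le> G (y + z) * indicator (cball z (DIM('a) * d)) (y + z)"
    proof (cases "\<forall>b\<in>Basis. y \<bullet> b \<in> {0..d}")
      case True
      \<comment> \<open>Bounding the norm by the sum of the coordinates is what gives the radius n
        d.\<close>
      have "norm y \<le> (\<Sum>b\<in>Basis. \<bar>y \<bullet> b\<bar>)" by (rule norm_le_l1)
      also have "\<dots> \<le> (\<Sum>b\<in>(Basis::'a set). d)" using True by (intro sum_mono) auto
      finally have "y + z \<in> cball z (DIM('a) * d)" by (simp add: dist_norm)
      moreover have "(\<Prod>b\<in>Basis. indicator {0..d} (y \<bullet> b) :: ennreal) = 1"
        using True by (intro prod.neutral) auto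
      ultimately show ?thesis by (simp add: add.commute)
    next
      case False
      then obtain b where "b \<in> Basis" "y \<bullet> b \<notin> {0..d}" by blast
      then have "(\<Prod>b\<in>Basis. indicator {0..d} (y \<bullet> b) :: ennreal) = 0"
        by (intro prod_zero finite_Basis bexI[of _ b]) auto
      then show ?thesis by (simp only: mult_zero_right zero_le)
    qed
  qed
  also have "\<dots> = (\<integral>\<^sup>+y. G y * indicator (cball z (DIM('a) * d)) y \<partial>lborel)"
    by (rule nn_integral_lborel_translate) (intro borel_measurable_times_ennreal borel_measurable_indicator assms, simp)
  finally show ?thesis .
qed

lemma indicator_scaleR: "indicator A t *\<^sub>R (c::complex) = indicator A t * c"
  by (simp add: indicator_def)

context bounded_symbol
begin

lemma oscD_measurable_pair:
  assumes s: "schwartz (fst s)" "schwartz (snd s)"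
  shows "(\<lambda>p. oscD (fst p) (snd p) ds s) \<in> borel_measurable borel"
proof -
  have c: "(\<lambda>q. D ds (fst (fst q), snd q) * ftens (fst s) (snd s) (snd q) * cis ((snd (fst q), snd (fst q)) \<bullet> snd q)) \<in> borel_measurable borel"
    by (intro borel_measurable_continuous_onI continuous_intros continuous_on_compose2[OF continuous_D[of UNIV]]
        continuous_on_compose2[OF continuous_ftens[OF s, of UNIV]]) auto
  have "(\<lambda>p. \<integral>v. D ds (fst p, v) * ftens (fst s) (snd s) v * cis ((snd p, snd p) \<bullet> v) \<partial>lborel) \<in> borel_measurable lborel"
    by (rule lborel.borel_measurable_lebesgue_integral) (use c in \<open>simp add: lborel_prod split_beta'\<close>)
  then show ?thesis unfolding oscD_def osc_def by simp
qed

lemma oscD_measurable_compose: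
  assumes s: "schwartz (fst s)" "schwartz (snd s)" and p: "p \<in> borel_measurable M" and q: "q \<in> borel_measurable M"
  shows "(\<lambda>t. oscD (p t) (q t) ds s) \<in> borel_measurable M"
  using measurable_compose[OF borel_measurable_Pair[OF p q] oscD_measurable_pair[OF s]] by simp

lemma space_basis: "b \<in> Basis \<Longrightarrow> ((b, 0, 0) :: 'n triple) \<in> Basis"
  by (simp add: Basis_prod_def zero_prod_def)

text \<open>The phase does not contain z, so a shift of z acts on the symbol alone. The fundamental
  theorem of calculus applies under the integral, and boundedness of the differentiated symbol
  justifies Fubini.\<close>

lemma oscD_shift:
  assumes s: "schwartz (fst s)" "schwartz (snd s)" and ds: "ds \<in> lists Basis" and b: "b \<in> Basis" and t: "t \<ge> 0"
  shows "oscD (z + t *\<^sub>R b) x ds s - oscD z x ds s = (\<integral>r. indicator {0..t} r *\<^sub>R oscD (z + r *\<^sub>R b) x ((b, 0, 0) # ds) s \<partial>lborel)"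
proof -
  let ?E = "(b, 0, 0) # ds" and ?X = "(x, x)"
  have Eds: "?E \<in> lists Basis" using ds b space_basis by auto
  obtain B where B: "\<And>p. norm (D ds p) \<le> B" using D_bounded[OF ds] by blast
  obtain B' where B': "\<And>p. norm (D ?E p) \<le> B'" using D_bounded[OF Eds] by blast
  define w where "w v = ftens (fst s) (snd s) v * cis (?X \<bullet> v)" for v
  have w: "integrable lborel w"
    using integrable_osc[OF integrable_ftens[OF s], of "\<lambda>_. 1" 1 ?X] by (simp add: w_def[abs_def])
  have o: "oscD z x F s = (\<integral>v. w v * D F (z, v) \<partial>lborel)" for z F
    unfolding oscD_def osc_def w_def by (simp add: mult_ac)
  have i: "integrable lborel (\<lambda>v. w v * D ds (z, v))" for z
    by (rule integrable_mult_bounded[OF w _ B]) (use borel_measurable_continuous_onI[OF continuous_D_slice] in simp)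
  have g: "integrable lborel (\<lambda>r. indicator {0..t} r :: complex)"
  proof -
    have "integrable lborel (\<lambda>r. complex_of_real (indicator {0..t} r))"
      unfolding complex_of_real_integrable_eq by (rule integrable_real_indicator) (use t in auto)
    then show ?thesis by (simp add: of_real_indicator)
  qed
  have K: "(\<lambda>(v, r). D ?E (z + r *\<^sub>R b, v)) \<in> borel_measurable (lborel \<Otimes>\<^sub>M lborel)"
  proof -
    have "(\<lambda>q. D ?E (z + snd q *\<^sub>R b, fst q)) \<in> borel_measurable borel"
      by (intro borel_measurable_continuous_onI continuous_intros continuous_on_compose2[OF continuous_D[of UNIV]]) auto
    then show ?thesis by (simp add: lborel_prod split_beta')
  qed
  have ftc: "(\<integral>r. indicator {0..t} r * D ?E (z + r *\<^sub>R b, v) \<partial>lborel) = D ds (z + t *\<^sub>R b, v) - D ds (z, v)" for v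
    using integral_dir_deriv[OF dir_deriv_D continuous_D t, of "(b, 0, 0)" ds "(z, v)"]
    by (simp add: indicator_scaleR zero_prod_def[symmetric])
  have "oscD (z + t *\<^sub>R b) x ds s - oscD z x ds s = (\<integral>v. w v * (D ds (z + t *\<^sub>R b, v) - D ds (z, v)) \<partial>lborel)"
    unfolding o right_diff_distrib by (rule Bochner_Integration.integral_diff[symmetric]) (rule i)+
  also have "\<dots> = (\<integral>v. w v * (\<integral>r. indicator {0..t} r * D ?E (z + r *\<^sub>R b, v) \<partial>lborel) \<partial>lborel)"
    unfolding ftc ..
  also have "\<dots> = (\<integral>r. indicator {0..t} r * (\<integral>v. w v * D ?E (z + r *\<^sub>R b, v) \<partial>lborel) \<partial>lborel)"
    by (rule fubini_bounded_kernel[OF w g K B'])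
  finally show ?thesis unfolding o by (simp add: indicator_scaleR)
qed

text \<open>For t in [0, d] one has |u(0)|^2 <= 2 (|u(t)|^2 + d I), where I is the integral of
  |u'|^2 over [0, d]. Averaging over t gives the claim; d <= 1 absorbs the surplus powers of
  d.\<close>

lemma oscD_sobolev_step:
  assumes s: "schwartz (fst s)" "schwartz (snd s)" and ds: "ds \<in> lists Basis" and b: "b \<in> Basis" and d: "0 < d" "d \<le> 1"
  shows "ennreal ((norm (oscD z x ds s))\<^sup>2) \<le> ennreal (2 / d) * (\<integral>\<^sup>+t. indicator {0..d} t *
     (ennreal ((norm (oscD (z + t *\<^sub>R b) x ds s))\<^sup>2) + ennreal ((norm (oscD (z + t *\<^sub>R b) x ((b, 0, 0) # ds) s))\<^sup>2)) \<partial>lborel)"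
proof -
  define N where "N F t = ennreal (norm (oscD (z + t *\<^sub>R b) x F s))" for F t
  let ?E = "(b, 0, 0) # ds"
  have mN [measurable]: "N F \<in> borel_measurable borel" for F
  proof -
    have "(\<lambda>t. oscD (z + t *\<^sub>R b) x F s) \<in> borel_measurable borel"
      by (rule oscD_measurable_compose[OF s]) measurable
    then show ?thesis unfolding N_def[abs_def] by measurable
  qed
  define Q where "Q = (\<integral>\<^sup>+t. indicator {0..d} t * (N ?E t)\<^sup>2 \<partial>lborel)"
  have pw: "(N ds 0)\<^sup>2 \<le> 2 * ((N ds t)\<^sup>2 + ennreal d * Q)" if t: "t \<in> {0..d}" for t
  proof -
    let ?I = "\<integral>r. indicator {0..t} r *\<^sub>R oscD (z + r *\<^sub>R b) x ?E s \<partial>lborel"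
    have "?I = oscD (z + t *\<^sub>R b) x ds s - oscD z x ds s"
      by (rule oscD_shift[OF s ds b, symmetric]) (use t in simp)
    then have "oscD z x ds s = oscD (z + t *\<^sub>R b) x ds s - ?I" by simp
    then have "norm (oscD z x ds s) = norm (oscD (z + t *\<^sub>R b) x ds s - ?I)" by (rule arg_cong)
    also have "\<dots> \<le> norm (oscD (z + t *\<^sub>R b) x ds s) + norm ?I" by (rule norm_triangle_ineq4)
    finally have "norm (oscD z x ds s) \<le> norm (oscD (z + t *\<^sub>R b) x ds s) + norm ?I" .
    then have "N ds 0 \<le> N ds t + ennreal (norm ?I)"
      unfolding N_def by (simp add: ennreal_plus[symmetric] ennreal_leI del: ennreal_plus)
    also have "ennreal (norm ?I) \<le> (\<integral>\<^sup>+r. ennreal (norm (indicator {0..t} r *\<^sub>R oscD (z + r *\<^sub>R b) x ?E s)) \<partial>lborel)"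
      by (rule norm_integral_le_nn_integral)
    also have "\<dots> \<le> (\<integral>\<^sup>+r. indicator {0..d} r * N ?E r \<partial>lborel)"
      using t by (intro nn_integral_mono) (auto simp: indicator_def N_def)
    finally have "N ds 0 \<le> N ds t + (\<integral>\<^sup>+r. indicator {0..d} r * N ?E r \<partial>lborel)" by (auto intro: add_left_mono)
    then have "(N ds 0)\<^sup>2 \<le> (N ds t + (\<integral>\<^sup>+r. indicator {0..d} r * N ?E r \<partial>lborel))\<^sup>2" by (rule power_mono) simp
    also have "\<dots> \<le> 2 * ((N ds t)\<^sup>2 + (\<integral>\<^sup>+r. indicator {0..d} r * N ?E r \<partial>lborel)\<^sup>2)"
      by (rule add_square_le_ennreal)
    also have "\<dots> \<le> 2 * ((N ds t)\<^sup>2 + ennreal d * Q)"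
      unfolding Q_def using d by (intro mult_left_mono add_left_mono nn_integral_square_le_interval) auto
    finally show ?thesis .
  qed
  have "ennreal d * (N ds 0)\<^sup>2 = (\<integral>\<^sup>+t. indicator {0..d} t * (N ds 0)\<^sup>2 \<partial>lborel)"
    using d by (simp add: nn_integral_multc)
  also have "\<dots> \<le> (\<integral>\<^sup>+t. 2 * (indicator {0..d} t * (N ds t)\<^sup>2) + (2 * (ennreal d * Q)) * indicator {0..d} t \<partial>lborel)"
    using pw by (intro nn_integral_mono) (auto simp: indicator_def distrib_left)
  also have "\<dots> = 2 * (\<integral>\<^sup>+t. indicator {0..d} t * (N ds t)\<^sup>2 \<partial>lborel) + (2 * (ennreal d * Q)) * ennreal d"
    using d by (subst nn_integral_add, measurable) (simp add: nn_integral_cmult)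
  also have "(2 * (ennreal d * Q)) * ennreal d \<le> 2 * Q"
  proof -
    have "ennreal d * (ennreal d * Q) = ennreal (d * d) * Q" using d by (simp add: ennreal_mult mult.assoc)
    also have "\<dots> \<le> ennreal 1 * Q" using d by (intro mult_right_mono ennreal_leI mult_le_one) auto
    finally have "2 * (ennreal d * (ennreal d * Q)) \<le> 2 * Q" by (intro mult_left_mono) auto
    then show ?thesis by (simp add: mult_ac)
  qed
  also have "2 * (\<integral>\<^sup>+t. indicator {0..d} t * (N ds t)\<^sup>2 \<partial>lborel) + 2 * Q = 2 * (\<integral>\<^sup>+t. indicator {0..d} t * ((N ds t)\<^sup>2 + (N ?E t)\<^sup>2) \<partial>lborel)"
  proof -
    have "(\<integral>\<^sup>+t. indicator {0..d} t * ((N ds t)\<^sup>2 + (N ?E t)\<^sup>2) \<partial>lborel)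
      = (\<integral>\<^sup>+t. indicator {0..d} t * (N ds t)\<^sup>2 + indicator {0..d} t * (N ?E t)\<^sup>2 \<partial>lborel)"
      by (simp only: distrib_left)
    also have "\<dots> = (\<integral>\<^sup>+t. indicator {0..d} t * (N ds t)\<^sup>2 \<partial>lborel) + Q"
      unfolding Q_def by (rule nn_integral_add) measurable
    finally show ?thesis by (simp only: distrib_left)
  qed
  finally have le: "ennreal d * (N ds 0)\<^sup>2 \<le> 2 * (\<integral>\<^sup>+t. indicator {0..d} t * ((N ds t)\<^sup>2 + (N ?E t)\<^sup>2) \<partial>lborel)"
    by (auto intro: add_left_mono)
  have "(N ds 0)\<^sup>2 = ennreal (1 / d) * (ennreal d * (N ds 0)\<^sup>2)"
    using d by (simp add: mult.assoc[symmetric] ennreal_mult[symmetric])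
  also have "\<dots> \<le> ennreal (1 / d) * (2 * (\<integral>\<^sup>+t. indicator {0..d} t * ((N ds t)\<^sup>2 + (N ?E t)\<^sup>2) \<partial>lborel))"
    by (intro mult_left_mono le) simp
  also have "\<dots> = ennreal (2 / d) * (\<integral>\<^sup>+t. indicator {0..d} t * ((N ds t)\<^sup>2 + (N ?E t)\<^sup>2) \<partial>lborel)"
  proof -
    have "ennreal (2 / d) = ennreal (1 / d) * 2" using d ennreal_mult[of "1 / d" 2] by simp
    then show ?thesis by (simp add: mult.assoc)
  qed
  finally show ?thesis unfolding N_def by (simp add: ennreal_power)
qed

definition space_lists :: "nat \<Rightarrow> 'n triple list set" where
  "space_lists m = {T. set T \<subseteq> (\<lambda>b. (b, 0, 0)) ` Basis \<and> length T \<le> m}"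

lemma finite_space_lists: "finite (space_lists m)"
  unfolding space_lists_def by (rule finite_lists_length_le) auto

lemma space_lists_subset: "T \<in> space_lists m \<Longrightarrow> T \<in> lists Basis"
  unfolding space_lists_def using space_basis by auto

text \<open>At every step the new direction is either skipped or added as a derivative. The factor 2
  next to 2 / d pays for enlarging both resulting sums to the same set of lists.\<close>

lemma oscD_sobolev_box:
  assumes s: "schwartz (fst s)" "schwartz (snd s)" and "ds \<in> lists Basis" and "set bs \<subseteq> Basis" and d: "0 < d" "d \<le> 1"
  shows "ennreal ((norm (oscD z x ds s))\<^sup>2) \<le> (2 * ennreal (2 / d)) ^ length bs *
     (\<Sum>T\<in>space_lists (length bs). box_integral d bs (\<lambda>z. ennreal ((norm (oscD z x (T @ ds) s))\<^sup>2)) z)"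
  using assms(3,4)
proof (induction bs arbitrary: ds z)
  case Nil
  have "space_lists 0 = {[]}" by (auto simp: space_lists_def)
  then show ?case by simp
next
  case (Cons b bs)
  define m where "m = length bs"
  define N where "N F z = ennreal ((norm (oscD z x F s))\<^sup>2)" for F z
  have [measurable]: "N F \<in> borel_measurable borel" for F
  proof -
    have "(\<lambda>z. oscD z x F s) \<in> borel_measurable borel"
      by (rule oscD_measurable_compose[OF s]) measurable
    then show ?thesis unfolding N_def[abs_def] by measurable
  qed
  let ?c = "ennreal (2 / d)" and ?b = "(b, 0, 0) :: 'n triple"
  let ?S = "\<lambda>F z. \<Sum>T\<in>space_lists m. box_integral d bs (N (T @ F)) z"
  have b: "b \<in> Basis" and bs: "set bs \<subseteq> Basis" using Cons.prems by auto
  have bds: "?b # ds \<in> lists Basis" using Cons.prems space_basis by auto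
  have IH: "N F z \<le> (2 * ?c) ^ m * ?S F z" if "F \<in> lists Basis" for F z
    unfolding N_def m_def using Cons.IH[OF that bs] .
  have "N ds z \<le> ?c * (\<integral>\<^sup>+t. indicator {0..d} t * (N ds (z + t *\<^sub>R b) + N (?b # ds) (z + t *\<^sub>R b)) \<partial>lborel)"
    unfolding N_def by (rule oscD_sobolev_step[OF s Cons.prems(1) b d])
  also have "\<dots> \<le> ?c * (\<integral>\<^sup>+t. indicator {0..d} t * ((2 * ?c) ^ m * ?S ds (z + t *\<^sub>R b) + (2 * ?c) ^ m * ?S (?b # ds) (z + t *\<^sub>R b)) \<partial>lborel)"
    by (intro mult_left_mono nn_integral_mono add_mono IH Cons.prems bds) auto
  also have "\<dots> = ?c * (\<integral>\<^sup>+t. (2 * ?c) ^ m * ((\<Sum>T\<in>space_lists m. indicator {0..d} t * box_integral d bs (N (T @ ds)) (z + t *\<^sub>R b))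
      + (\<Sum>T\<in>space_lists m. indicator {0..d} t * box_integral d bs (N (T @ ?b # ds)) (z + t *\<^sub>R b))) \<partial>lborel)"
    by (simp add: sum_distrib_left distrib_left mult_ac)
  also have "\<dots> = ?c * ((2 * ?c) ^ m * ((\<Sum>T\<in>space_lists m. box_integral d (b # bs) (N (T @ ds)) z)
      + (\<Sum>T\<in>space_lists m. box_integral d (b # bs) (N (T @ ?b # ds)) z)))"
    by (simp add: nn_integral_cmult nn_integral_add nn_integral_sum)
  also have "(\<Sum>T\<in>space_lists m. box_integral d (b # bs) (N (T @ ?b # ds)) z)
    = (\<Sum>T\<in>(\<lambda>T. T @ [?b]) ` space_lists m. box_integral d (b # bs) (N (T @ ds)) z)"
    by (subst sum.reindex) (auto simp: inj_on_def)
  also have "?c * ((2 * ?c) ^ m * ((\<Sum>T\<in>space_lists m. box_integral d (b # bs) (N (T @ ds)) z) + \<dots>))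
    \<le> ?c * ((2 * ?c) ^ m * ((\<Sum>T\<in>space_lists (Suc m). box_integral d (b # bs) (N (T @ ds)) z) + (\<Sum>T\<in>space_lists (Suc m). box_integral d (b # bs) (N (T @ ds)) z)))"
    using b by (intro mult_left_mono add_mono sum_mono2 finite_space_lists) (auto simp: space_lists_def)
  also have "\<dots> = (2 * ?c) ^ Suc m * (\<Sum>T\<in>space_lists (Suc m). box_integral d (b # bs) (N (T @ ds)) z)"
    by (simp add: mult_2[symmetric] mult_ac)
  finally show ?case unfolding N_def m_def by simp
qed

lemma oscD_sobolev:
  "\<exists>C::real. \<forall>f g x0 x z ds. schwartz f \<and> schwartz g \<and> ds \<in> lists Basis \<and> z \<in> ball x0 (1/2) \<longrightarrow>
    ennreal ((norm (oscD z x ds (f, g)))\<^sup>2) \<le> ennreal C *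
     (\<Sum>T\<in>space_lists CARD('n). \<integral>\<^sup>+y\<in>ball x0 1. ennreal ((norm (oscD y x (T @ ds) (f, g)))\<^sup>2) \<partial>lborel)"
proof -
  obtain bs :: "(real^'n) list" where bs: "set bs = Basis" "distinct bs"
    using finite_distinct_list[OF finite_Basis] by blast
  have l: "length bs = CARD('n)" using bs distinct_card[OF bs(2)] by simp
  \<comment> \<open>The side is chosen so that n d = 1/2: a cube with corner in the ball of radius
    1/2 then stays inside the concentric ball of radius 1, where the hypothesis gives its
    bound.\<close>
  define d where "d = 1 / (2 * real CARD('n))"
  have d: "0 < d" "d \<le> 1" and dn: "real CARD('n) * d = 1 / 2" 
  proof -
    have "real CARD('n) \<ge> 1" by (simp add: Suc_leI)
    moreover from this have "1 \<le> 2 * real CARD('n)" by linarith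
    ultimately show "0 < d" "d \<le> 1" "real CARD('n) * d = 1 / 2" by (auto simp: d_def divide_le_eq)
  qed
  have "ennreal ((norm (oscD z x ds (f, g)))\<^sup>2) \<le> ennreal ((2 * (2 / d)) ^ CARD('n)) *
     (\<Sum>T\<in>space_lists CARD('n). \<integral>\<^sup>+y\<in>ball x0 1. ennreal ((norm (oscD y x (T @ ds) (f, g)))\<^sup>2) \<partial>lborel)"
    if s: "schwartz f" "schwartz g" and ds: "ds \<in> lists Basis" and z: "z \<in> ball x0 (1/2)" for f g x0 x z ds
  proof -
    have "box_integral d bs (\<lambda>z. ennreal ((norm (oscD z x (T @ ds) (f, g)))\<^sup>2)) z \<le> (\<integral>\<^sup>+y\<in>ball x0 1. ennreal ((norm (oscD y x (T @ ds) (f, g)))\<^sup>2) \<partial>lborel)" for T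
    proof -
      have "(\<lambda>z. oscD z x (T @ ds) (f, g)) \<in> borel_measurable borel"
        by (rule oscD_measurable_compose) (use s in auto)
      then have m: "(\<lambda>z. ennreal ((norm (oscD z x (T @ ds) (f, g)))\<^sup>2)) \<in> borel_measurable borel" by measurable
      have "cball z (1/2) \<subseteq> ball x0 1"
      proof
        fix y assume "y \<in> cball z (1/2)"
        then show "y \<in> ball x0 1" using z dist_triangle[of x0 y z] by simp
      qed
      moreover have e: "real DIM(real^'n) * d = 1 / 2" using dn by simp
      ultimately have "(\<integral>\<^sup>+y. ennreal ((norm (oscD y x (T @ ds) (f, g)))\<^sup>2) * indicator (cball z (DIM(real^'n) * d)) y \<partial>lborel)
        \<le> (\<integral>\<^sup>+y\<in>ball x0 1. ennreal ((norm (oscD y x (T @ ds) (f, g)))\<^sup>2) \<partial>lborel)"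
        unfolding e by (intro nn_integral_mono mult_left_mono) (auto simp: indicator_def simp del: mem_cball mem_ball)
      with box_integral_le_cball[OF m bs(2,1), of d z] show ?thesis by (rule order_trans)
    qed
    then have "(2 * ennreal (2 / d)) ^ CARD('n) * (\<Sum>T\<in>space_lists CARD('n). box_integral d bs (\<lambda>z. ennreal ((norm (oscD z x (T @ ds) (f, g)))\<^sup>2)) z)
      \<le> (2 * ennreal (2 / d)) ^ CARD('n) * (\<Sum>T\<in>space_lists CARD('n). \<integral>\<^sup>+y\<in>ball x0 1. ennreal ((norm (oscD y x (T @ ds) (f, g)))\<^sup>2) \<partial>lborel)"
      by (intro mult_left_mono sum_mono) auto
    moreover have "(2 * ennreal (2 / d)) = ennreal (2 * (2 / d))" using d ennreal_mult[of 2 "2 / d"] by simp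
    ultimately show ?thesis
      using oscD_sobolev_box[of "(f, g)" ds bs d z x] s ds bs l d by (simp add: ennreal_power)
  qed
  then show ?thesis by blast
qed

section \<open>The localised estimate\<close>

lemma localised_estimate:
  assumes sb: "\<And>T. T \<in> lists ((\<lambda>b. (b, 0, 0)) ` Basis) \<Longrightarrow> slice_bounded T"
  shows "\<exists>C::real. \<forall>f g x0. schwartz f \<and> schwartz g \<longrightarrow>
    (\<integral>\<^sup>+x\<in>ball x0 (1/2). ennreal ((norm (oscD x x [] (f, g)))\<^sup>2) \<partial>lborel)
     \<le> ennreal C * (\<integral>\<^sup>+y. ennreal ((norm (f y))\<^sup>2 * weight (y - x0)) \<partial>lborel) * (\<integral>\<^sup>+y. ennreal ((norm (g y))\<^sup>2 * weight (y - x0)) \<partial>lborel)"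
proof -
  obtain C1 where C1: "\<And>f g x0 x z ds. schwartz f \<Longrightarrow> schwartz g \<Longrightarrow> ds \<in> lists Basis \<Longrightarrow> z \<in> ball x0 (1/2) \<Longrightarrow>
    ennreal ((norm (oscD z x ds (f, g)))\<^sup>2) \<le> ennreal C1 *
     (\<Sum>T\<in>space_lists CARD('n). \<integral>\<^sup>+y\<in>ball x0 1. ennreal ((norm (oscD y x (T @ ds) (f, g)))\<^sup>2) \<partial>lborel)"
    using oscD_sobolev by blast
  let ?\<T> = "space_lists CARD('n)" and ?\<J> = "freq_lists (2 * CARD('n))"
  have sl: "slice_bounded (J @ T)" if "T \<in> ?\<T>" "J \<in> ?\<J>" for T J
    using slice_bounded_append[OF sb space_lists_subset[OF that(1)], of J] that
    by (auto simp: space_lists_def freq_lists_def)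
  then obtain A where A: "\<And>T J x0 \<zeta>. T \<in> ?\<T> \<Longrightarrow> J \<in> ?\<J> \<Longrightarrow> slice (J @ T) x0 \<zeta> \<le> ennreal (A T J)"
    unfolding slice_bounded_def by metis
  define P where "P = ennreal ((2 * pi) ^ CARD('n)) ^ 3"
  \<comment> \<open>81 = 9^2 comes from squaring \<open>oscD_weighted\<close>, the cardinality from
    Cauchy-Schwarz for the finite sum over J.\<close>
  define c2 where "c2 = ennreal (81 ^ CARD('n) * real (card ?\<J>))"
  define K where "K = (\<Sum>T\<in>?\<T>. ennreal C1 * (c2 * (\<Sum>J\<in>?\<J>. P * ennreal (A T J))))"
  have Kfin: "K < \<infinity>" unfolding K_def c2_def P_def
    by (simp add: ennreal_mult_less_top less_top ennreal_power finite_space_lists finite_freq_lists)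
  have "(\<integral>\<^sup>+x\<in>ball x0 (1/2). ennreal ((norm (oscD x x [] (f, g)))\<^sup>2) \<partial>lborel)
     \<le> K * (\<integral>\<^sup>+y. ennreal ((norm (f y))\<^sup>2 * weight (y - x0)) \<partial>lborel) * (\<integral>\<^sup>+y. ennreal ((norm (g y))\<^sup>2 * weight (y - x0)) \<partial>lborel)"
    if f: "schwartz f" and g: "schwartz g" for f g x0
  proof -
    let ?w = "(wall x0 f, wall x0 g)"
    let ?B = "ball x0 (1/2)"
    let ?F = "\<integral>\<^sup>+y. ennreal ((norm (f y))\<^sup>2 * weight (y - x0)) \<partial>lborel"
    let ?G = "\<integral>\<^sup>+y. ennreal ((norm (g y))\<^sup>2 * weight (y - x0)) \<partial>lborel"
    note fw = schwartz_wall[OF f, of x0] and gw = schwartz_wall[OF g, of x0]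
    define N where "N F y x = ennreal ((norm (oscD y x F ?w))\<^sup>2)" for F y x
    have mN: "(\<lambda>z. N F (fst z) (snd z)) \<in> borel_measurable borel" for F
    proof -
      have "(\<lambda>p. oscD (fst p) (snd p) F ?w) \<in> borel_measurable borel"
        using oscD_measurable_pair[of ?w] fw gw by simp
      then show ?thesis unfolding N_def by measurable
    qed
    then have mN1 [measurable]: "(\<lambda>z. N F (fst z) (snd z)) \<in> borel_measurable (lborel \<Otimes>\<^sub>M lborel)" for F
      by (simp add: lborel_prod)
    have mN2 [measurable]: "(\<lambda>y. N F y x) \<in> borel_measurable borel" and mN3 [measurable]: "(\<lambda>x. N F y x) \<in> borel_measurable borel" for F x y
      using measurable_compose[OF borel_measurable_Pair[OF measurable_ident measurable_const[of x]] mN[of F]]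
        measurable_compose[OF borel_measurable_Pair[OF measurable_const[of y] measurable_ident] mN[of F]] by simp_all
    have mNi: "(\<lambda>z. N F (fst z) (snd z) * indicator (ball x0 1) (fst z)) \<in> borel_measurable (lborel \<Otimes>\<^sub>M lborel)" for F
      using borel_measurable_times_ennreal[OF mN[of F] ball_fst_borel_measurable[of x0]] by (simp add: lborel_prod)
    have w: "ennreal ((norm (oscD y x T (f, g)))\<^sup>2) \<le> c2 * (\<Sum>J\<in>?\<J>. N (J @ T) y x)"
      if x: "x \<in> ?B" and T: "T \<in> ?\<T>" for x y T
    proof -
      have "norm (x - x0) \<le> 1" using x by (simp add: dist_norm norm_minus_commute)
      from oscD_weighted[OF f g space_lists_subset[OF T] this, of y]
      have "(norm (oscD y x T (f, g)))\<^sup>2 \<le> (9 ^ CARD('n) * (\<Sum>J\<in>?\<J>. norm (oscD y x (J @ T) ?w)))\<^sup>2"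
        by (rule power_mono) simp
      also have "\<dots> = 81 ^ CARD('n) * (\<Sum>J\<in>?\<J>. norm (oscD y x (J @ T) ?w))\<^sup>2"
        by (simp add: power_mult_distrib power_mult[symmetric] power2_eq_square flip: power_mult_distrib)
      also have "\<dots> \<le> 81 ^ CARD('n) * ((\<Sum>J\<in>?\<J>. (norm (oscD y x (J @ T) ?w))\<^sup>2) * card ?\<J>)"
        by (intro mult_left_mono sum_squared_le_sum_of_squares) auto
      finally have "ennreal ((norm (oscD y x T (f, g)))\<^sup>2) \<le> ennreal (81 ^ CARD('n) * ((\<Sum>J\<in>?\<J>. (norm (oscD y x (J @ T) ?w))\<^sup>2) * card ?\<J>))"
        by (rule ennreal_leI)
      also have "\<dots> = ennreal ((81 ^ CARD('n) * card ?\<J>) * (\<Sum>J\<in>?\<J>. (norm (oscD y x (J @ T) ?w))\<^sup>2))"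
        by (simp add: mult_ac)
      also have "\<dots> = c2 * (\<Sum>J\<in>?\<J>. N (J @ T) y x)"
        unfolding c2_def N_def by (subst ennreal_mult) (auto intro!: sum_nonneg)
      finally show ?thesis .
    qed
    have L2: "(\<integral>\<^sup>+y\<in>ball x0 1. (\<integral>\<^sup>+x. N (J @ T) y x \<partial>lborel) \<partial>lborel) \<le> P * ennreal (A T J) * ?F * ?G"
      if T: "T \<in> ?\<T>" and J: "J \<in> ?\<J>" for T J
    proof -
      have "J @ T \<in> lists Basis"
        using space_lists_subset[OF T] J freq_basis_subset by (auto simp: freq_lists_def)
      then obtain B where B: "\<And>p. norm (D (J @ T) p) \<le> B" using D_bounded by blast
      show ?thesis
        unfolding N_def oscD_def P_def fst_conv snd_conv
        using L2_estimate[OF D_measurable B _ _ fw gw, where S="ball x0 1" and A="ennreal (A T J)"] A[OF T J, unfolded slice_eq_iterated]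
        by (simp add: norm_wall)
    qed
    \<comment> \<open>The restriction of x to the half ball is used here, by Sobolev and by the
      weights, and then dropped, since the L^2 estimate integrates over all x.\<close>
    have "(\<integral>\<^sup>+x\<in>?B. ennreal ((norm (oscD x x [] (f, g)))\<^sup>2) \<partial>lborel)
      \<le> (\<integral>\<^sup>+x. (\<Sum>T\<in>?\<T>. ennreal C1 * (c2 * (\<Sum>J\<in>?\<J>. \<integral>\<^sup>+y\<in>ball x0 1. N (J @ T) y x \<partial>lborel))) \<partial>lborel)"
    proof (rule nn_integral_mono)
      fix x
      show "ennreal ((norm (oscD x x [] (f, g)))\<^sup>2) * indicator ?B x \<le> (\<Sum>T\<in>?\<T>. ennreal C1 * (c2 * (\<Sum>J\<in>?\<J>. \<integral>\<^sup>+y\<in>ball x0 1. N (J @ T) y x \<partial>lborel)))"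
      proof (cases "x \<in> ?B")
        case True
        have "ennreal ((norm (oscD x x [] (f, g)))\<^sup>2) \<le> ennreal C1 * (\<Sum>T\<in>?\<T>. \<integral>\<^sup>+y\<in>ball x0 1. ennreal ((norm (oscD y x T (f, g)))\<^sup>2) \<partial>lborel)"
          using C1[OF f g _ True, of "[]" x] by simp
        also have "\<dots> \<le> ennreal C1 * (\<Sum>T\<in>?\<T>. \<integral>\<^sup>+y\<in>ball x0 1. c2 * (\<Sum>J\<in>?\<J>. N (J @ T) y x) \<partial>lborel)"
          by (intro mult_left_mono sum_mono nn_integral_mono mult_right_mono w True) auto
        also have "\<dots> = (\<Sum>T\<in>?\<T>. ennreal C1 * (c2 * (\<Sum>J\<in>?\<J>. \<integral>\<^sup>+y\<in>ball x0 1. N (J @ T) y x \<partial>lborel)))"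
        proof -
          have "(\<integral>\<^sup>+y\<in>ball x0 1. c2 * (\<Sum>J\<in>?\<J>. N (J @ T) y x) \<partial>lborel) = c2 * (\<Sum>J\<in>?\<J>. \<integral>\<^sup>+y\<in>ball x0 1. N (J @ T) y x \<partial>lborel)" for T
          proof -
            have m: "(\<lambda>y. N F y x * indicator (ball x0 1) y) \<in> borel_measurable lborel" for F
              by (intro borel_measurable_times_ennreal borel_measurable_indicator) auto
            have "(\<integral>\<^sup>+y\<in>ball x0 1. c2 * (\<Sum>J\<in>?\<J>. N (J @ T) y x) \<partial>lborel) = (\<integral>\<^sup>+y. c2 * (\<Sum>J\<in>?\<J>. N (J @ T) y x * indicator (ball x0 1) y) \<partial>lborel)"
              by (simp add: sum_distrib_right mult.assoc)
            also have "\<dots> = c2 * (\<integral>\<^sup>+y. (\<Sum>J\<in>?\<J>. N (J @ T) y x * indicator (ball x0 1) y) \<partial>lborel)"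
              by (intro nn_integral_cmult borel_measurable_sum m)
            also have "(\<integral>\<^sup>+y. (\<Sum>J\<in>?\<J>. N (J @ T) y x * indicator (ball x0 1) y) \<partial>lborel) = (\<Sum>J\<in>?\<J>. \<integral>\<^sup>+y\<in>ball x0 1. N (J @ T) y x \<partial>lborel)"
              by (intro nn_integral_sum m)
            finally show ?thesis .
          qed
          then show ?thesis by (simp only: sum_distrib_left)
        qed
        finally show ?thesis using True by simp
      qed simp
    qed
    also have "\<dots> = (\<Sum>T\<in>?\<T>. ennreal C1 * (c2 * (\<Sum>J\<in>?\<J>. \<integral>\<^sup>+x. (\<integral>\<^sup>+y\<in>ball x0 1. N (J @ T) y x \<partial>lborel) \<partial>lborel)))"
    proof -
      have m: "(\<lambda>x. \<integral>\<^sup>+y\<in>ball x0 1. N F y x \<partial>lborel) \<in> borel_measurable lborel" for F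
      proof (rule lborel.borel_measurable_nn_integral)
        from measurable_compose[OF measurable_pair_swap' mNi[of F]]
        show "(\<lambda>(x, y). N F y x * indicator (ball x0 1) y) \<in> borel_measurable (lborel \<Otimes>\<^sub>M lborel)"
          by (simp add: split_beta')
      qed
      have mT: "(\<lambda>x. ennreal C1 * (c2 * (\<Sum>J\<in>?\<J>. \<integral>\<^sup>+y\<in>ball x0 1. N (J @ T) y x \<partial>lborel))) \<in> borel_measurable lborel" for T
        by (intro borel_measurable_times_ennreal borel_measurable_sum m borel_measurable_const)
      have "(\<integral>\<^sup>+x. ennreal C1 * (c2 * (\<Sum>J\<in>?\<J>. \<integral>\<^sup>+y\<in>ball x0 1. N (J @ T) y x \<partial>lborel)) \<partial>lborel)
        = ennreal C1 * (c2 * (\<Sum>J\<in>?\<J>. \<integral>\<^sup>+x. (\<integral>\<^sup>+y\<in>ball x0 1. N (J @ T) y x \<partial>lborel) \<partial>lborel))" for T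
      proof -
        have "(\<integral>\<^sup>+x. (ennreal C1 * c2) * (\<Sum>J\<in>?\<J>. \<integral>\<^sup>+y\<in>ball x0 1. N (J @ T) y x \<partial>lborel) \<partial>lborel)
          = (ennreal C1 * c2) * (\<integral>\<^sup>+x. (\<Sum>J\<in>?\<J>. \<integral>\<^sup>+y\<in>ball x0 1. N (J @ T) y x \<partial>lborel) \<partial>lborel)"
          by (intro nn_integral_cmult borel_measurable_sum m)
        also have "(\<integral>\<^sup>+x. (\<Sum>J\<in>?\<J>. \<integral>\<^sup>+y\<in>ball x0 1. N (J @ T) y x \<partial>lborel) \<partial>lborel)
          = (\<Sum>J\<in>?\<J>. \<integral>\<^sup>+x. (\<integral>\<^sup>+y\<in>ball x0 1. N (J @ T) y x \<partial>lborel) \<partial>lborel)"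
          by (intro nn_integral_sum m)
        finally show ?thesis by (simp only: mult.assoc)
      qed
      then show ?thesis by (simp only: nn_integral_sum[OF mT])
    qed
    also have "\<dots> = (\<Sum>T\<in>?\<T>. ennreal C1 * (c2 * (\<Sum>J\<in>?\<J>. \<integral>\<^sup>+y\<in>ball x0 1. (\<integral>\<^sup>+x. N (J @ T) y x \<partial>lborel) \<partial>lborel)))"
    proof (intro sum.cong refl arg_cong2[where f="(*)"])
      fix T J
      from mNi[of "J @ T"] have "(\<lambda>z. N (J @ T) (fst z) (snd z) * indicator (ball x0 1) (fst z)) \<in> borel_measurable borel"
        by (simp add: lborel_prod)
      from nn_integral_lborel_swap[OF this]
      show "(\<integral>\<^sup>+x. (\<integral>\<^sup>+y\<in>ball x0 1. N (J @ T) y x \<partial>lborel) \<partial>lborel) = (\<integral>\<^sup>+y\<in>ball x0 1. (\<integral>\<^sup>+x. N (J @ T) y x \<partial>lborel) \<partial>lborel)"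
        by (simp add: nn_integral_multc)
    qed
    also have "\<dots> \<le> (\<Sum>T\<in>?\<T>. ennreal C1 * (c2 * (\<Sum>J\<in>?\<J>. P * ennreal (A T J) * ?F * ?G)))"
      by (intro sum_mono mult_left_mono L2) auto
    also have "\<dots> = K * ?F * ?G"
      unfolding K_def by (simp add: sum_distrib_right sum_distrib_left mult.assoc)
    finally show ?thesis .
  qed
  moreover have "K = ennreal (enn2real K)" using Kfin by (simp add: less_top)
  ultimately show ?thesis by (intro exI[of _ "enn2real K"]) simp
qed

end

section \<open>From the localised estimate to Lebesgue norms\<close>

text \<open>With \<open>0 powr 0 = 0\<close> this holds for the end points \<open>\<theta> = 0, 1\<close> as well.\<close>

lemma nn_integral_holder:
  fixes u v :: "'a \<Rightarrow> real"
  assumes [measurable]: "u \<in> borel_measurable M" "v \<in> borel_measurable M"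
    and u0: "\<And>x. 0 \<le> u x" and v0: "\<And>x. 0 \<le> v x"
    and U: "(\<integral>\<^sup>+x. ennreal (u x) \<partial>M) \<le> ennreal U" and V: "(\<integral>\<^sup>+x. ennreal (v x) \<partial>M) \<le> ennreal V"
    and U0: "0 \<le> U" and V0: "0 \<le> V" and \<theta>: "0 \<le> \<theta>" "\<theta> \<le> 1"
  shows "(\<integral>\<^sup>+x. ennreal (u x powr \<theta> * v x powr (1 - \<theta>)) \<partial>M) \<le> ennreal (U powr \<theta> * V powr (1 - \<theta>))"
\<comment> \<open>The main argument divides by U and V. If one of them is 0, the corresponding
  function and hence the integrand vanish almost everywhere.\<close>
proof (cases "U = 0 \<or> V = 0")
  case True
  have "AE x in M. u x powr \<theta> * v x powr (1 - \<theta>) = 0"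
    using True
  proof
    assume "U = 0"
    then have "(\<integral>\<^sup>+x. ennreal (u x) \<partial>M) = 0" using U by simp
    then have "AE x in M. ennreal (u x) = 0" by (subst (asm) nn_integral_0_iff_AE) auto
    then show ?thesis
    proof eventually_elim
      case (elim x)
      then have "u x = 0" using u0[of x] by simp
      then show ?case by simp
    qed
  next
    assume "V = 0"
    then have "(\<integral>\<^sup>+x. ennreal (v x) \<partial>M) = 0" using V by simp
    then have "AE x in M. ennreal (v x) = 0" by (subst (asm) nn_integral_0_iff_AE) auto
    then show ?thesis
    proof eventually_elim
      case (elim x)
      then have "v x = 0" using v0[of x] by simp
      then show ?case by simp
    qed
  qed
  then have "(\<integral>\<^sup>+x. ennreal (u x powr \<theta> * v x powr (1 - \<theta>)) \<partial>M) = (\<integral>\<^sup>+x. 0 \<partial>M)"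
    by (intro nn_integral_cong_AE) auto
  then show ?thesis by simp
next
  case False
  then have p: "U > 0" "V > 0" using U0 V0 by auto
  let ?c = "U powr \<theta> * V powr (1 - \<theta>)"
  \<comment> \<open>Weighted arithmetic-geometric mean, normalised so that the two summands in
    brackets integrate to at most \<theta> and 1 - \<theta>.\<close>
  have young: "u x powr \<theta> * v x powr (1 - \<theta>) \<le> ?c * (\<theta> / U * u x + (1 - \<theta>) / V * v x)" for x
  proof (cases "u x = 0 \<or> v x = 0")
    case True
    then show ?thesis using u0[of x] v0[of x] p \<theta> by auto
  next
    case False
    then have q: "u x / U > 0" "v x / V > 0" using u0[of x] v0[of x] p by (auto simp: less_le)
    have "u x powr \<theta> * v x powr (1 - \<theta>) = ?c * ((u x / U) powr \<theta> * (v x / V) powr (1 - \<theta>))"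
      using p u0[of x] v0[of x] by (simp add: powr_divide)
    also have "\<dots> \<le> ?c * (\<theta> * (u x / U) + (1 - \<theta>) * (v x / V))"
      using \<theta> q by (intro mult_left_mono Youngs_inequality_0) auto
    finally show ?thesis by simp
  qed
  have "(\<integral>\<^sup>+x. ennreal (u x powr \<theta> * v x powr (1 - \<theta>)) \<partial>M)
    \<le> (\<integral>\<^sup>+x. ennreal ?c * (ennreal (\<theta> / U) * ennreal (u x) + ennreal ((1 - \<theta>) / V) * ennreal (v x)) \<partial>M)"
  proof (rule nn_integral_mono)
    fix x
    have "ennreal (u x powr \<theta> * v x powr (1 - \<theta>)) \<le> ennreal (?c * (\<theta> / U * u x + (1 - \<theta>) / V * v x))"
      by (rule ennreal_leI[OF young])
    also have "\<dots> = ennreal ?c * (ennreal (\<theta> / U) * ennreal (u x) + ennreal ((1 - \<theta>) / V) * ennreal (v x))"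
      using p \<theta> u0[of x] v0[of x]
      by (simp add: ennreal_mult[symmetric] ennreal_plus[symmetric] del: ennreal_plus)
    finally show "ennreal (u x powr \<theta> * v x powr (1 - \<theta>)) \<le> ennreal ?c * (ennreal (\<theta> / U) * ennreal (u x) + ennreal ((1 - \<theta>) / V) * ennreal (v x))" .
  qed
  also have "\<dots> = ennreal ?c * (ennreal (\<theta> / U) * (\<integral>\<^sup>+x. ennreal (u x) \<partial>M) + ennreal ((1 - \<theta>) / V) * (\<integral>\<^sup>+x. ennreal (v x) \<partial>M))"
    by (simp add: nn_integral_cmult nn_integral_add)
  also have "\<dots> \<le> ennreal ?c * (ennreal (\<theta> / U) * ennreal U + ennreal ((1 - \<theta>) / V) * ennreal V)"
    by (intro mult_left_mono add_mono U V) auto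
  also have "ennreal (\<theta> / U) * ennreal U + ennreal ((1 - \<theta>) / V) * ennreal V = ennreal 1"
    using p \<theta> by (simp add: ennreal_mult[symmetric] ennreal_plus[symmetric] del: ennreal_plus)
  finally show ?thesis by simp
qed

lemma powr_square_half: "0 \<le> (s::real) \<Longrightarrow> (s\<^sup>2) powr (r / 2) = s powr r"
  by (cases "s = 0") (auto simp: powr_powr powr_numeral[symmetric] simp del: powr_numeral)

lemma rapid_powr_finite:
  fixes f :: "'a::euclidean_space \<Rightarrow> complex"
  assumes f: "rapid f" and p: "1 \<le> p"
  shows "(\<integral>\<^sup>+y. ennreal (norm (f y) powr p) \<partial>lborel) < \<infinity>"
proof -
  have [measurable]: "f \<in> borel_measurable borel" by (rule rapid_measurable[OF f])
  from f obtain B where "\<And>x. (1 + norm x) ^ 0 * norm (f x) \<le> B" unfolding rapid_def by blast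
  then have B: "norm (f x) \<le> B" for x by simp
  have "norm (f y) powr p \<le> B powr (p - 1) * norm (f y)" for y
  proof -
    have "norm (f y) powr p = norm (f y) powr (p - 1) * norm (f y)"
      using powr_add[of "norm (f y)" "p - 1" 1] by simp
    also have "\<dots> \<le> B powr (p - 1) * norm (f y)"
      using p by (intro mult_right_mono powr_mono2 B) auto
    finally show ?thesis .
  qed
  then have "(\<integral>\<^sup>+y. ennreal (norm (f y) powr p) \<partial>lborel) \<le> (\<integral>\<^sup>+y. ennreal (B powr (p - 1)) * ennreal (norm (f y)) \<partial>lborel)"
    by (intro nn_integral_mono) (simp add: ennreal_mult[symmetric] ennreal_leI)
  also have "\<dots> = ennreal (B powr (p - 1)) * (\<integral>\<^sup>+y. ennreal (norm (f y)) \<partial>lborel)"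
    by (rule nn_integral_cmult) measurable
  also have "\<dots> < \<infinity>"
    using rapid_integrable[OF f] by (simp add: integrable_iff_bounded ennreal_mult_less_top)
  finally show ?thesis .
qed

definition wmass :: "'a::euclidean_space itself \<Rightarrow> real" where
  "wmass _ = enn2real (\<integral>\<^sup>+y. ennreal (weight (y::'a)) \<partial>lborel)"

lemma wmass_nonneg: "0 \<le> wmass TYPE('a::euclidean_space)"
  by (simp add: wmass_def)

lemma nn_integral_weight_translate:
  "(\<integral>\<^sup>+y. ennreal (weight (y - x0)) \<partial>lborel) = ennreal (wmass TYPE('a))"
  "(\<integral>\<^sup>+x0. ennreal (weight (y - x0)) \<partial>lborel) = ennreal (wmass TYPE('a))" for x0 y :: "'a::euclidean_space"
proof -
  have m: "(\<lambda>y::'a. ennreal (weight y)) \<in> borel_measurable borel" by measurable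
  have w: "(\<integral>\<^sup>+y. ennreal (weight (y::'a)) \<partial>lborel) = ennreal (wmass TYPE('a))"
    unfolding wmass_def using nn_integral_weight_finite[where 'a='a] by (simp add: less_top)
  show "(\<integral>\<^sup>+y. ennreal (weight (y - x0)) \<partial>lborel) = ennreal (wmass TYPE('a))"
    using nn_integral_lborel_translate[OF m, of "- x0"] w by simp
  show "(\<integral>\<^sup>+x0. ennreal (weight (y - x0)) \<partial>lborel) = ennreal (wmass TYPE('a))"
    using nn_integral_lborel_reflect[OF m, of y] w by simp
qed

text \<open>The convolution of |f|^2 with the even function \<open>weight\<close>, made real so that
  it can be raised to real powers. \<open>enn2real\<close> would turn infinity into 0;
  \<open>loc_eq\<close> excludes this for rapidly decreasing f.\<close>

definition loc :: "('a::euclidean_space \<Rightarrow> complex) \<Rightarrow> 'a \<Rightarrow> real" where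
  "loc f x0 = enn2real (\<integral>\<^sup>+y. ennreal ((norm (f y))\<^sup>2 * weight (y - x0)) \<partial>lborel)"

lemma loc_nonneg: "0 \<le> loc f x0"
  by (simp add: loc_def)

lemma weight_diff_measurable [measurable]:
  "(\<lambda>z. weight (fst z - snd z)) \<in> borel_measurable (lborel \<Otimes>\<^sub>M lborel)"
  "(\<lambda>z. weight (snd z - fst z)) \<in> borel_measurable (lborel \<Otimes>\<^sub>M lborel)"
  by (rule measurable_compose[OF _ weight_measurable], simp)+

lemma loc_measurable [measurable]:
  assumes [measurable]: "f \<in> borel_measurable borel"
  shows "loc f \<in> borel_measurable borel"
  unfolding loc_def[abs_def] by measurable

text \<open>An almost everywhere bound is enough, so that B may be the essential supremum.\<close>

lemma loc_le:
  fixes f :: "'a::euclidean_space \<Rightarrow> complex"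
  assumes b: "AE y in lborel. norm (f y) \<le> B" and B0: "0 \<le> B"
  shows "(\<integral>\<^sup>+y. ennreal ((norm (f y))\<^sup>2 * weight (y - x0)) \<partial>lborel) = ennreal (loc f x0)"
    and "loc f x0 \<le> B\<^sup>2 * wmass TYPE('a)"
proof -
  have "(\<integral>\<^sup>+y. ennreal ((norm (f y))\<^sup>2 * weight (y - x0)) \<partial>lborel) \<le> (\<integral>\<^sup>+y. ennreal (B\<^sup>2) * ennreal (weight (y - x0)) \<partial>lborel)"
  proof (rule nn_integral_mono_AE, use b in eventually_elim)
    fix y assume "norm (f y) \<le> B"
    then have "(norm (f y))\<^sup>2 * weight (y - x0) \<le> B\<^sup>2 * weight (y - x0)"
      by (intro mult_right_mono power_mono weight_nonneg) auto
    then show "ennreal ((norm (f y))\<^sup>2 * weight (y - x0)) \<le> ennreal (B\<^sup>2) * ennreal (weight (y - x0))"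
      by (simp add: ennreal_mult[symmetric] weight_nonneg ennreal_leI)
  qed
  also have "\<dots> = ennreal (B\<^sup>2 * wmass TYPE('a))"
    by (subst nn_integral_cmult) (simp_all add: nn_integral_weight_translate ennreal_mult wmass_nonneg)
  finally have le: "(\<integral>\<^sup>+y. ennreal ((norm (f y))\<^sup>2 * weight (y - x0)) \<partial>lborel) \<le> ennreal (B\<^sup>2 * wmass TYPE('a))" .
  then have "(\<integral>\<^sup>+y. ennreal ((norm (f y))\<^sup>2 * weight (y - x0)) \<partial>lborel) \<noteq> \<infinity>" by (auto simp: top_unique)
  then show eq: "(\<integral>\<^sup>+y. ennreal ((norm (f y))\<^sup>2 * weight (y - x0)) \<partial>lborel) = ennreal (loc f x0)"
    unfolding loc_def by (simp add: less_top)
  show "loc f x0 \<le> B\<^sup>2 * wmass TYPE('a)"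
    using le unfolding eq by (simp add: wmass_nonneg)
qed

lemma rapid_bounded: "rapid f \<Longrightarrow> \<exists>B\<ge>0. \<forall>y. norm (f y) \<le> B"
proof -
  assume "rapid f"
  then obtain B where "\<And>x. (1 + norm x) ^ 0 * norm (f x) \<le> B" unfolding rapid_def by blast
  then have "norm (f x) \<le> B" for x by simp
  moreover from this have "0 \<le> B" by (rule order_trans[OF norm_ge_zero])
  ultimately show ?thesis by blast
qed

lemma loc_eq:
  assumes "rapid f"
  shows "(\<integral>\<^sup>+y. ennreal ((norm (f y))\<^sup>2 * weight (y - x0)) \<partial>lborel) = ennreal (loc f x0)"
  using rapid_bounded[OF assms] by (auto intro: loc_le(1))

text \<open>Young's inequality for the convolution with W = \<open>weight\<close> in L^(p/2), of
  total mass w. Hoelder is applied to |f|^2 W = (|f|^p W)^(2/p) W^(1 - 2/p) and the result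
  integrated over x0. Hoelder contributes w^(p/2 - 1) and the integral of W one more w.\<close>

lemma loc_powr_integral:
  fixes f :: "'a::euclidean_space \<Rightarrow> complex"
  assumes f: "rapid f" and p: "2 \<le> p" and I: "(\<integral>\<^sup>+y. ennreal (norm (f y) powr p) \<partial>lborel) = ennreal I" and I0: "0 \<le> I"
  shows "(\<integral>\<^sup>+x0. ennreal (loc f x0 powr (p / 2)) \<partial>lborel) \<le> ennreal (wmass TYPE('a) powr (p / 2) * I)"
proof -
  let ?w = "wmass TYPE('a)"
  have fm [measurable]: "f \<in> borel_measurable borel" by (rule rapid_measurable[OF f])
  define J where "J x0 = (\<integral>\<^sup>+y. ennreal (norm (f y) powr p * weight (y - x0)) \<partial>lborel)" for x0
  have Jle: "J x0 \<le> ennreal I" for x0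
  proof -
    have "J x0 \<le> (\<integral>\<^sup>+y. ennreal (norm (f y) powr p) \<partial>lborel)"
      unfolding J_def by (intro nn_integral_mono ennreal_leI mult_left_le weight_le_1) auto
    then show ?thesis unfolding I .
  qed
  have Jfin: "J x0 \<noteq> \<infinity>" for x0 using Jle[of x0] by (auto simp: top_unique)
  have pw: "ennreal (loc f x0 powr (p / 2)) \<le> ennreal (?w powr (p / 2 - 1)) * J x0" for x0
  proof -
    define j where "j = enn2real (J x0)"
    have j: "J x0 = ennreal j" "0 \<le> j" unfolding j_def using Jfin[of x0] by (auto simp: less_top)
    have e: "(norm (f y) powr p * weight (y - x0)) powr (2 / p) * weight (y - x0) powr (1 - 2 / p) = (norm (f y))\<^sup>2 * weight (y - x0)" for y
    proof -
      have "(norm (f y) powr p * weight (y - x0)) powr (2 / p) = (norm (f y))\<^sup>2 * weight (y - x0) powr (2 / p)"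
        using p weight_nonneg by (subst powr_mult) (auto simp: powr_powr)
      moreover have "weight (y - x0) powr (2 / p) * weight (y - x0) powr (1 - 2 / p) = weight (y - x0)"
        using weight_pos[of "y - x0"] by (simp add: powr_add[symmetric])
      ultimately show ?thesis by simp
    qed
    have "ennreal (loc f x0) \<le> ennreal (j powr (2 / p) * ?w powr (1 - 2 / p))"
      unfolding loc_eq[OF f, symmetric] e[symmetric]
      by (rule nn_integral_holder)
         (use p j weight_nonneg nn_integral_weight_translate(1)[where 'a='a] wmass_nonneg[where 'a='a] in
           \<open>auto simp: J_def intro!: mult_nonneg_nonneg\<close>)
    then have "loc f x0 \<le> j powr (2 / p) * ?w powr (1 - 2 / p)"
      by (subst (asm) ennreal_le_iff) auto
    then have "loc f x0 powr (p / 2) \<le> (j powr (2 / p) * ?w powr (1 - 2 / p)) powr (p / 2)"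
      using p by (intro powr_mono2 loc_nonneg) auto
    also have "\<dots> = j powr (2 / p * (p / 2)) * ?w powr ((1 - 2 / p) * (p / 2))"
      by (subst powr_mult) (auto simp: powr_powr)
    also have "2 / p * (p / 2) = 1" using p by simp
    also have "(1 - 2 / p) * (p / 2) = p / 2 - 1" using p by (simp add: field_simps)
    finally have "loc f x0 powr (p / 2) \<le> ?w powr (p / 2 - 1) * j" using j by (simp add: mult.commute)
    then show ?thesis unfolding j(1) by (simp add: ennreal_mult[symmetric] j ennreal_leI)
  qed
  have "(\<integral>\<^sup>+x0. ennreal (loc f x0 powr (p / 2)) \<partial>lborel) \<le> (\<integral>\<^sup>+x0. ennreal (?w powr (p / 2 - 1)) * J x0 \<partial>lborel)"
    by (intro nn_integral_mono pw)
  also have "\<dots> = ennreal (?w powr (p / 2 - 1)) * (\<integral>\<^sup>+x0. J x0 \<partial>lborel)"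
    unfolding J_def by (intro nn_integral_cmult) measurable
  also have "(\<integral>\<^sup>+x0. J x0 \<partial>lborel) = (\<integral>\<^sup>+y. \<integral>\<^sup>+x0. ennreal (norm (f y) powr p) * ennreal (weight (y - x0)) \<partial>lborel \<partial>lborel)"
    unfolding J_def ennreal_mult[OF powr_ge_zero weight_nonneg] by (rule lborel_pair.Fubini') measurable
  also have "\<dots> = ennreal I * ennreal ?w"
    by (simp add: nn_integral_cmult nn_integral_multc nn_integral_weight_translate I)
  also have "ennreal (?w powr (p / 2 - 1)) * (ennreal I * ennreal ?w) = ennreal (?w powr (p / 2) * I)"
  proof -
    have "?w powr (p / 2 - 1) * ?w = ?w powr (p / 2)"
      using powr_add[of ?w "p / 2 - 1" 1] wmass_nonneg[where 'a='a] by simp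
    then have "?w powr (p / 2 - 1) * (I * ?w) = ?w powr (p / 2) * I" by (simp add: mult.left_commute mult.commute)
    then show ?thesis using I0 wmass_nonneg[where 'a='a] by (simp add: ennreal_mult[symmetric])
  qed
  finally show ?thesis .
qed

text \<open>The centres of the half balls containing a given x fill a volume \<omega>, hence the
  factor 1 / \<omega> when local integrals are averaged. On each ball Hoelder passes from L^2 to L^r
  at the cost of \<omega>^(1 - r/2).\<close>

lemma integral_powr_le_loc:
  fixes T f g :: "'a::euclidean_space \<Rightarrow> complex"
  assumes [measurable]: "T \<in> borel_measurable borel" and f: "rapid f" and g: "rapid g"
    and key: "\<And>x0. (\<integral>\<^sup>+x\<in>ball x0 (1/2). ennreal ((norm (T x))\<^sup>2) \<partial>lborel) \<le> ennreal (C * loc f x0 * loc g x0)"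
    and C: "0 \<le> C" and r: "1 \<le> r" "r \<le> 2"
  defines "\<omega> \<equiv> measure lborel (ball (0::'a) (1/2))"
  shows "(\<integral>\<^sup>+x. ennreal (norm (T x) powr r) \<partial>lborel)
    \<le> ennreal (1 / \<omega> * \<omega> powr (1 - r / 2) * C powr (r / 2)) * (\<integral>\<^sup>+x0. ennreal (loc f x0 powr (r / 2) * loc g x0 powr (r / 2)) \<partial>lborel)"
proof -
  have fm [measurable]: "f \<in> borel_measurable borel" "g \<in> borel_measurable borel"
    using rapid_measurable f g by auto
  have ball: "emeasure lborel (ball x0 (1/2)) = ennreal \<omega>" for x0 :: 'a
    unfolding \<omega>_def by (simp add: emeasure_eq_ennreal_measure emeasure_ball content_ball)
  have \<omega>: "\<omega> > 0" unfolding \<omega>_def by (rule content_ball_pos) simp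
  have ind: "indicator (ball x0 (1/2)) x = (indicator (ball x (1/2)) x0 :: 'z::zero_neq_one)" for x x0 :: 'a
    by (simp add: indicator_def dist_commute)
  have loc: "(\<integral>\<^sup>+x\<in>ball x0 (1/2). ennreal (norm (T x) powr r) \<partial>lborel)
     \<le> ennreal (\<omega> powr (1 - r / 2) * C powr (r / 2)) * ennreal (loc f x0 powr (r / 2) * loc g x0 powr (r / 2))" for x0
  proof -
    let ?i = "indicator (ball x0 (1/2)) :: 'a \<Rightarrow> real"
    have "(\<integral>\<^sup>+x\<in>ball x0 (1/2). ennreal (norm (T x) powr r) \<partial>lborel)
       = (\<integral>\<^sup>+x. ennreal (((norm (T x))\<^sup>2 * ?i x) powr (r / 2) * ?i x powr (1 - r / 2)) \<partial>lborel)"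
      by (intro nn_integral_cong) (auto simp: indicator_def powr_square_half)
    also have "\<dots> \<le> ennreal ((C * loc f x0 * loc g x0) powr (r / 2) * \<omega> powr (1 - r / 2))"
    proof (rule nn_integral_holder)
      have "(\<integral>\<^sup>+x. ennreal ((norm (T x))\<^sup>2 * ?i x) \<partial>lborel) = (\<integral>\<^sup>+x\<in>ball x0 (1/2). ennreal ((norm (T x))\<^sup>2) \<partial>lborel)"
        by (intro nn_integral_cong) (auto simp: indicator_def)
      then show "(\<integral>\<^sup>+x. ennreal ((norm (T x))\<^sup>2 * ?i x) \<partial>lborel) \<le> ennreal (C * loc f x0 * loc g x0)" using key by simp
      have "(\<integral>\<^sup>+x. ennreal (?i x) \<partial>lborel) = emeasure lborel (ball x0 (1/2))"
        by (simp add: ennreal_indicator)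
      then show "(\<integral>\<^sup>+x. ennreal (?i x) \<partial>lborel) \<le> ennreal \<omega>" using ball by simp
      show "?i \<in> borel_measurable lborel" by (rule borel_measurable_indicator) simp
      show "(\<lambda>x. (norm (T x))\<^sup>2 * ?i x) \<in> borel_measurable lborel"
        by (intro borel_measurable_times borel_measurable_indicator) auto
    qed (use r \<omega> C loc_nonneg in \<open>auto intro!: mult_nonneg_nonneg\<close>)
    also have "(C * loc f x0 * loc g x0) powr (r / 2) * \<omega> powr (1 - r / 2)
       = (\<omega> powr (1 - r / 2) * C powr (r / 2)) * (loc f x0 powr (r / 2) * loc g x0 powr (r / 2))"
      using C loc_nonneg by (simp add: powr_mult mult_ac)
    finally show ?thesis by (simp add: ennreal_mult)
  qed
  let ?K = "ennreal (\<omega> powr (1 - r / 2) * C powr (r / 2))"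
  have "(\<integral>\<^sup>+x. ennreal (norm (T x) powr r) \<partial>lborel) = ennreal (1 / \<omega>) * (\<integral>\<^sup>+x. ennreal (norm (T x) powr r) * ennreal \<omega> \<partial>lborel)"
  proof -
    have "(\<integral>\<^sup>+x. ennreal (norm (T x) powr r) * ennreal \<omega> \<partial>lborel) = (\<integral>\<^sup>+x. ennreal (norm (T x) powr r) \<partial>lborel) * ennreal \<omega>"
      by (rule nn_integral_multc) measurable
    moreover have "ennreal (1 / \<omega>) * ennreal \<omega> = 1" using \<omega> by (simp add: ennreal_mult[symmetric])
    ultimately show ?thesis by (metis mult.left_commute mult.right_neutral)
  qed
  also have "(\<integral>\<^sup>+x. ennreal (norm (T x) powr r) * ennreal \<omega> \<partial>lborel)
     = (\<integral>\<^sup>+x. \<integral>\<^sup>+x0. ennreal (norm (T x) powr r) * indicator (ball x (1/2)) x0 \<partial>lborel \<partial>lborel)"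
    by (intro nn_integral_cong) (simp add: nn_integral_cmult_indicator ball)
  also have "\<dots> = (\<integral>\<^sup>+x0. \<integral>\<^sup>+x. ennreal (norm (T x) powr r) * indicator (ball x (1/2)) x0 \<partial>lborel \<partial>lborel)"
  proof (rule nn_integral_lborel_swap)
    have "open {z :: 'a \<times> 'a. dist (fst z) (snd z) < 1/2}"
      by (intro open_Collect_less continuous_intros)
    then have "(\<lambda>z. indicator {z :: 'a \<times> 'a. dist (fst z) (snd z) < 1/2} z :: ennreal) \<in> borel_measurable borel"
      by (intro borel_measurable_indicator) auto
    then have 1: "(\<lambda>z :: 'a \<times> 'a. indicator (ball (fst z) (1/2)) (snd z) :: ennreal) \<in> borel_measurable borel"
      by (simp add: indicator_def)
    have "(fst :: 'a \<times> 'a \<Rightarrow> 'a) \<in> borel_measurable borel"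
      by (intro borel_measurable_continuous_onI continuous_intros)
    then have 2: "(\<lambda>z :: 'a \<times> 'a. ennreal (norm (T (fst z)) powr r)) \<in> borel_measurable borel"
      by (rule measurable_compose) measurable
    show "(\<lambda>z. ennreal (norm (T (fst z)) powr r) * indicator (ball (fst z) (1/2)) (snd z)) \<in> borel_measurable borel"
      by (rule borel_measurable_times_ennreal[OF 2 1])
  qed
  also have "\<dots> = (\<integral>\<^sup>+x0. (\<integral>\<^sup>+x\<in>ball x0 (1/2). ennreal (norm (T x) powr r) \<partial>lborel) \<partial>lborel)"
    by (simp only: ind)
  also have "\<dots> \<le> (\<integral>\<^sup>+x0. ?K * ennreal (loc f x0 powr (r / 2) * loc g x0 powr (r / 2)) \<partial>lborel)"
    by (intro nn_integral_mono loc)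
  also have "\<dots> = ?K * (\<integral>\<^sup>+x0. ennreal (loc f x0 powr (r / 2) * loc g x0 powr (r / 2)) \<partial>lborel)"
    by (rule nn_integral_cmult) measurable
  finally have "(\<integral>\<^sup>+x. ennreal (norm (T x) powr r) \<partial>lborel) \<le>
     ennreal (1 / \<omega>) * (?K * (\<integral>\<^sup>+x0. ennreal (loc f x0 powr (r / 2) * loc g x0 powr (r / 2)) \<partial>lborel))"
    by (simp add: mult_left_mono)
  moreover have "ennreal (1 / \<omega>) * ?K = ennreal (1 / \<omega> * \<omega> powr (1 - r / 2) * C powr (r / 2))"
    using \<omega> by (subst ennreal_mult[symmetric]) (auto simp: mult.assoc)
  ultimately show ?thesis by (simp add: mult.assoc[symmetric])
qed

section \<open>Lebesgue norms: finite exponents and the case of an infinite exponent\<close>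

lemma Lp_norm_le:
  fixes T :: "real^'n::finite \<Rightarrow> complex"
  assumes "(\<integral>\<^sup>+x. ennreal (norm (T x) powr r) \<partial>lborel) \<le> ennreal Q" "0 \<le> Q" "0 < r"
  shows "Lp_norm (ereal r) T \<le> ennreal (Q powr (1 / r))"
proof -
  let ?I = "\<integral>\<^sup>+x. ennreal (norm (T x) powr r) \<partial>lborel"
  have "?I \<noteq> \<infinity>" using assms(1) by (auto simp: top_unique)
  moreover have "enn2real ?I \<le> Q" using assms(1,2) by (simp add: enn2real_leI)
  then have "enn2real ?I powr (1 / r) \<le> Q powr (1 / r)" using assms(3) by (intro powr_mono2) auto
  ultimately show ?thesis unfolding Lp_norm_def by (simp add: Let_def ennreal_leI)
qed

lemma Lp_norm_rapid:
  fixes f :: "real^'n::finite \<Rightarrow> complex"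
  assumes f: "rapid f" and p: "1 \<le> p"
  obtains I where "0 \<le> I" "(\<integral>\<^sup>+y. ennreal (norm (f y) powr p) \<partial>lborel) = ennreal I" "Lp_norm (ereal p) f = ennreal (I powr (1 / p))"
proof (rule that[of "enn2real (\<integral>\<^sup>+y. ennreal (norm (f y) powr p) \<partial>lborel)"])
  have fin: "(\<integral>\<^sup>+y. ennreal (norm (f y) powr p) \<partial>lborel) \<noteq> \<infinity>" using rapid_powr_finite[OF f p] by (simp add: less_top)
  then show "(\<integral>\<^sup>+y. ennreal (norm (f y) powr p) \<partial>lborel) = ennreal (enn2real (\<integral>\<^sup>+y. ennreal (norm (f y) powr p) \<partial>lborel))"
    by (simp add: less_top)
  show "Lp_norm (ereal p) f = ennreal (enn2real (\<integral>\<^sup>+y. ennreal (norm (f y) powr p) \<partial>lborel) powr (1 / p))"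
    unfolding Lp_norm_def using fin by (simp add: Let_def)
qed simp

text \<open>Hoelder in x0 with weights r/p and r/q, which add up to 1 precisely because 1/p + 1/q =
  1/r; \<open>loc f\<close> is controlled in L^(p/2) and \<open>loc g\<close> in L^(q/2). Each
  function contributes w^(1/2), whatever its exponent.\<close>

lemma Lp_bound_finite_exponents:
  fixes T f g :: "real^'n::finite \<Rightarrow> complex"
  assumes T: "T \<in> borel_measurable borel" and f: "rapid f" and g: "rapid g"
    and key: "\<And>x0. (\<integral>\<^sup>+x\<in>ball x0 (1/2). ennreal ((norm (T x))\<^sup>2) \<partial>lborel) \<le> ennreal (C * loc f x0 * loc g x0)"
    and C: "0 \<le> C" and r: "1 \<le> r" "r \<le> 2" and p: "2 \<le> p" and q: "2 \<le> q" and pqr: "1 / p + 1 / q = 1 / r"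
  defines "\<omega> \<equiv> measure lborel (ball (0::real^'n) (1/2))" and "w \<equiv> wmass TYPE(real^'n)"
  shows "Lp_norm (ereal r) T \<le> ennreal ((1 / \<omega> * \<omega> powr (1 - r / 2) * C powr (r / 2)) powr (1 / r) * w powr (1 / 2) * w powr (1 / 2))
     * Lp_norm (ereal p) f * Lp_norm (ereal q) g"
proof -
  note [measurable] = rapid_measurable[OF f] rapid_measurable[OF g]
  let ?K = "1 / \<omega> * \<omega> powr (1 - r / 2) * C powr (r / 2)"
  have K: "0 \<le> ?K" unfolding \<omega>_def by simp
  have w: "0 \<le> w" unfolding w_def by (rule wmass_nonneg)
  obtain I where I: "0 \<le> I" "(\<integral>\<^sup>+y. ennreal (norm (f y) powr p) \<partial>lborel) = ennreal I" "Lp_norm (ereal p) f = ennreal (I powr (1 / p))"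
    using Lp_norm_rapid[OF f, of p] p by auto
  obtain J where J: "0 \<le> J" "(\<integral>\<^sup>+y. ennreal (norm (g y) powr q) \<partial>lborel) = ennreal J" "Lp_norm (ereal q) g = ennreal (J powr (1 / q))"
    using Lp_norm_rapid[OF g, of q] q by auto
  have rq: "1 - r / p = r / q" using pqr r p q by (simp add: field_simps)
  have "0 \<le> r / q" using r q by simp
  then have rp1: "r / p \<le> 1" using rq by linarith
  let ?A = "w powr (p / 2) * I" and ?B = "w powr (q / 2) * J"
  have e: "loc f x0 powr (r / 2) * loc g x0 powr (r / 2) = (loc f x0 powr (p / 2)) powr (r / p) * (loc g x0 powr (q / 2)) powr (1 - r / p)" for x0
    unfolding rq powr_powr using p q by simp
  have "(\<integral>\<^sup>+x0. ennreal (loc f x0 powr (r / 2) * loc g x0 powr (r / 2)) \<partial>lborel) \<le> ennreal (?A powr (r / p) * ?B powr (1 - r / p))"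
    unfolding e
    by (rule nn_integral_holder)
       (use loc_powr_integral[OF f p I(2,1)] loc_powr_integral[OF g q J(2,1)] I(1) J(1) rp1 r p in \<open>auto simp: w_def\<close>)
  then have "(\<integral>\<^sup>+x. ennreal (norm (T x) powr r) \<partial>lborel) \<le> ennreal ?K * ennreal (?A powr (r / p) * ?B powr (1 - r / p))"
    using integral_powr_le_loc[OF T f g key C r, folded \<omega>_def] by (meson mult_left_mono order_trans zero_le)
  also have "\<dots> = ennreal (?K * (?A powr (r / p) * ?B powr (r / q)))"
    unfolding rq by (rule ennreal_mult[OF K, symmetric]) simp
  finally have le: "(\<integral>\<^sup>+x. ennreal (norm (T x) powr r) \<partial>lborel) \<le> ennreal (?K * (?A powr (r / p) * ?B powr (r / q)))" .
  have "0 \<le> ?K * (?A powr (r / p) * ?B powr (r / q))" by (rule mult_nonneg_nonneg[OF K]) simp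
  from Lp_norm_le[OF le this] r
  have "Lp_norm (ereal r) T \<le> ennreal ((?K * (?A powr (r / p) * ?B powr (r / q))) powr (1 / r))" by simp
  also have "(?K * (?A powr (r / p) * ?B powr (r / q))) powr (1 / r) = ?K powr (1 / r) * (?A powr (1 / p) * ?B powr (1 / q))"
  proof -
    have "(x * (A powr (r / p) * B powr (r / q))) powr (1 / r) = x powr (1 / r) * (A powr (1 / p) * B powr (1 / q))" for x A B :: real
      using r by (simp add: powr_mult powr_powr)
    then show ?thesis .
  qed
  also have "?A powr (1 / p) = w powr (1 / 2) * I powr (1 / p)"
    using p I(1) by (simp add: powr_mult powr_powr)
  also have "?B powr (1 / q) = w powr (1 / 2) * J powr (1 / q)"
    using q J(1) by (simp add: powr_mult powr_powr)
  also have "?K powr (1 / r) * (w powr (1 / 2) * I powr (1 / p) * (w powr (1 / 2) * J powr (1 / q)))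
    = (?K powr (1 / r) * w powr (1 / 2) * w powr (1 / 2)) * I powr (1 / p) * J powr (1 / q)" by (simp only: mult_ac)
  finally show ?thesis unfolding I(3) J(3) by (simp add: ennreal_mult mult.assoc)
qed

text \<open>An infinite exponent forces the other one and r to be 2. Hoelder is replaced by the
  bound of \<open>loc f\<close> by w times the squared essential supremum, so that only
  \<open>loc g\<close> has to be integrated.\<close>

lemma Lp_bound_infinite_exponent:
  fixes T f g :: "real^'n::finite \<Rightarrow> complex"
  assumes T: "T \<in> borel_measurable borel" and f: "rapid f" and g: "rapid g"
    and key: "\<And>x0. (\<integral>\<^sup>+x\<in>ball x0 (1/2). ennreal ((norm (T x))\<^sup>2) \<partial>lborel) \<le> ennreal (C * loc f x0 * loc g x0)"
    and C: "0 \<le> C"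
  defines "\<omega> \<equiv> measure lborel (ball (0::real^'n) (1/2))" and "w \<equiv> wmass TYPE(real^'n)"
  shows "Lp_norm 2 T \<le> ennreal ((1 / \<omega> * C * w * w) powr (1 / 2)) * Lp_norm \<infinity> f * Lp_norm 2 g"
proof -
  note [measurable] = rapid_measurable[OF f] rapid_measurable[OF g]
  have w: "0 \<le> w" unfolding w_def by (rule wmass_nonneg)
  have \<omega>: "\<omega> > 0" unfolding \<omega>_def by (rule content_ball_pos) simp
  obtain B where B: "0 \<le> B" "\<And>y. norm (f y) \<le> B" using rapid_bounded[OF f] by blast
  define E where "E = esssup lborel (\<lambda>x. ennreal (norm (f x)))"
  \<comment> \<open>The pointwise bound B shows that the essential supremum is finite; the estimate
    below works with M.\<close>
  have EB: "E \<le> ennreal B" unfolding E_def by (rule esssup_I) (auto intro: ennreal_leI B)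
  define M where "M = enn2real E"
  have "E \<noteq> top" using EB by (auto simp: top_unique)
  then have M: "E = ennreal M" "0 \<le> M" unfolding M_def by (simp_all add: less_top)
  have "AE y in lborel. ennreal (norm (f y)) \<le> E" unfolding E_def by (rule esssup_AE)
  then have ae: "AE y in lborel. norm (f y) \<le> M" unfolding M(1) using M(2) by simp
  obtain J where J: "0 \<le> J" "(\<integral>\<^sup>+y. ennreal (norm (g y) powr 2) \<partial>lborel) = ennreal J" "Lp_norm (ereal 2) g = ennreal (J powr (1 / 2))"
    using Lp_norm_rapid[OF g, of 2] by auto
  have "(\<integral>\<^sup>+x0. ennreal (loc f x0 powr (2 / 2) * loc g x0 powr (2 / 2)) \<partial>lborel)
     \<le> (\<integral>\<^sup>+x0. ennreal (M\<^sup>2 * w) * ennreal (loc g x0 powr (2 / 2)) \<partial>lborel)"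
  proof (rule nn_integral_mono)
    fix x0
    have c: "0 \<le> M\<^sup>2 * w" using w by simp
    have "loc f x0 * loc g x0 \<le> M\<^sup>2 * w * loc g x0"
      using loc_le(2)[OF ae M(2), of x0] unfolding w_def by (rule mult_right_mono) (rule loc_nonneg)
    then have "ennreal (loc f x0 * loc g x0) \<le> ennreal (M\<^sup>2 * w) * ennreal (loc g x0)"
      unfolding ennreal_mult[OF c loc_nonneg, symmetric] by (rule ennreal_leI)
    then show "ennreal (loc f x0 powr (2 / 2) * loc g x0 powr (2 / 2)) \<le> ennreal (M\<^sup>2 * w) * ennreal (loc g x0 powr (2 / 2))"
      by (simp add: abs_of_nonneg[OF loc_nonneg])
  qed
  also have "\<dots> = ennreal (M\<^sup>2 * w) * (\<integral>\<^sup>+x0. ennreal (loc g x0 powr (2 / 2)) \<partial>lborel)"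
    by (rule nn_integral_cmult) measurable
  also have "\<dots> \<le> ennreal (M\<^sup>2 * w) * ennreal (w powr (2 / 2) * J)"
    unfolding w_def by (intro mult_left_mono loc_powr_integral[OF g _ J(2,1)]) auto
  finally have le: "(\<integral>\<^sup>+x0. ennreal (loc f x0 powr (2 / 2) * loc g x0 powr (2 / 2)) \<partial>lborel) \<le> ennreal (M\<^sup>2 * w) * ennreal (w powr (2 / 2) * J)" .
  have "(\<integral>\<^sup>+x. ennreal (norm (T x) powr 2) \<partial>lborel) \<le> ennreal (1 / \<omega> * \<omega> powr (1 - 2 / 2) * C powr (2 / 2)) *
      (\<integral>\<^sup>+x0. ennreal (loc f x0 powr (2 / 2) * loc g x0 powr (2 / 2)) \<partial>lborel)"
    unfolding \<omega>_def by (rule integral_powr_le_loc[OF T f g key C]) auto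
  also have "\<dots> \<le> ennreal (1 / \<omega> * \<omega> powr (1 - 2 / 2) * C powr (2 / 2)) * (ennreal (M\<^sup>2 * w) * ennreal (w powr (2 / 2) * J))"
    by (rule mult_left_mono[OF le]) simp
  also have "\<dots> = ennreal (1 / \<omega> * C * w * w * (M\<^sup>2 * J))"
    using w \<omega> C J(1) by (simp add: ennreal_mult[symmetric] mult_ac)
  finally have "Lp_norm (ereal 2) T \<le> ennreal ((1 / \<omega> * C * w * w * (M\<^sup>2 * J)) powr (1 / 2))"
    using w \<omega> C J(1) by (intro Lp_norm_le) auto
  also have "(1 / \<omega> * C * w * w * (M\<^sup>2 * J)) powr (1 / 2) = (1 / \<omega> * C * w * w) powr (1 / 2) * M * J powr (1 / 2)"
  proof -
    have "(1 / \<omega> * C * w * w * (M\<^sup>2 * J)) powr (1 / 2) = (1 / \<omega> * C * w * w) powr (1 / 2) * ((M\<^sup>2) powr (1 / 2) * J powr (1 / 2))"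
      unfolding powr_mult ..
    also have "(M\<^sup>2) powr (1 / 2) = M" using powr_square_half[OF M(2), of 1] M(2) by simp
    finally show ?thesis by simp
  qed
  finally show ?thesis
    using M(2) unfolding numeral_eq_ereal J(3) by (simp add: Lp_norm_def[of \<infinity>] E_def[symmetric] M(1) ennreal_mult mult.assoc)
qed

lemma (in bounded_symbol) bilinear_op_eq_oscD:
  assumes f: "schwartz f" and g: "schwartz g"
  shows "bilinear_op a f g x = oscD x x [] (f, g)"
proof -
  obtain B where B: "\<And>p. norm (D [] p) \<le> B" using D_bounded[of "[]"] by auto
  let ?h = "\<lambda>v. D [] (x, v) * ftens f g v * cis ((x, x) \<bullet> v)"
  have h: "integrable lborel ?h"
    by (rule integrable_osc[OF integrable_ftens[OF f g] continuous_D_slice B])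
  have i: "integrable (lborel \<Otimes>\<^sub>M lborel) (\<lambda>(\<xi>, \<eta>). ?h (\<xi>, \<eta>))"
    using h by (simp add: lborel_prod split_beta' del: inner_Pair)
  have "oscD x x [] (f, g) = integral\<^sup>L (lborel \<Otimes>\<^sub>M lborel) (\<lambda>(\<xi>, \<eta>). ?h (\<xi>, \<eta>))"
    unfolding oscD_def osc_def by (simp add: lborel_prod split_beta' del: inner_Pair)
  also have "\<dots> = (\<integral>\<eta>. \<integral>\<xi>. ?h (\<xi>, \<eta>) \<partial>lborel \<partial>lborel)"
    by (rule lborel_pair.integral_snd[OF i, symmetric])
  also have "\<dots> = bilinear_op a f g x"
    unfolding bilinear_op_def D_def
    by (simp add: uncurry3_def ftens_def inner_prod_def inner_add_right mult.assoc)
  finally show ?thesis ..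
qed

theorem theorem6p2:
  fixes a :: "real^'n::finite \<Rightarrow> real^'n \<Rightarrow> real^'n \<Rightarrow> complex" and \<rho> :: real
  assumes "0 < \<rho>" and "\<rho> \<le> 1"
    and "bisymbol 0 \<rho> 0 a"
    and "\<forall>ds \<in> lists ((\<lambda>b. (b, 0, 0)) ` Basis). \<exists>C::real. \<forall>x0 \<zeta>.
           (\<integral>\<^sup>+x\<in>ball x0 1. (\<integral>\<^sup>+\<eta>. ennreal ((norm (iter_deriv ds (uncurry3 a) (x, \<zeta> - \<eta>, \<eta>))) ^ 2) \<partial>lborel) \<partial>lborel)
             \<le> ennreal C"
  shows "\<forall>p q :: ereal. \<forall>r :: real.
           2 \<le> p \<and> 2 \<le> q \<and> 1 \<le> r \<and> r \<le> 2 \<and> inverse p + inverse q = ereal (1 / r) \<longrightarrow>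
           (\<exists>C::real. \<forall>f g. schwartz f \<and> schwartz g \<longrightarrow>
              Lp_norm (ereal r) (bilinear_op a f g) \<le> ennreal C * Lp_norm p f * Lp_norm q g)"
proof (intro allI impI)
  fix p q :: ereal and r :: real
  assume pqr: "2 \<le> p \<and> 2 \<le> q \<and> 1 \<le> r \<and> r \<le> 2 \<and> inverse p + inverse q = ereal (1 / r)"
  interpret bounded_symbol a \<rho>
    using assms by unfold_locales auto
  have sb: "slice_bounded ds" if "ds \<in> lists ((\<lambda>b. (b, 0, 0)) ` Basis)" for ds
  proof -
    from assms(4) that obtain C :: real where "\<forall>x0 \<zeta>.
           (\<integral>\<^sup>+x\<in>ball x0 1. (\<integral>\<^sup>+\<eta>. ennreal ((norm (iter_deriv ds (uncurry3 a) (x, \<zeta> - \<eta>, \<eta>))) ^ 2) \<partial>lborel) \<partial>lborel)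
             \<le> ennreal C" by blast
    then show ?thesis unfolding slice_bounded_def slice_eq_iterated D_def by blast
  qed
  obtain C' where C': "\<And>f g x0. schwartz f \<Longrightarrow> schwartz g \<Longrightarrow>
    (\<integral>\<^sup>+x\<in>ball x0 (1/2). ennreal ((norm (oscD x x [] (f, g)))\<^sup>2) \<partial>lborel)
     \<le> ennreal C' * (\<integral>\<^sup>+y. ennreal ((norm (f y))\<^sup>2 * weight (y - x0)) \<partial>lborel) * (\<integral>\<^sup>+y. ennreal ((norm (g y))\<^sup>2 * weight (y - x0)) \<partial>lborel)"
    using localised_estimate[OF sb] by blast
  \<comment> \<open>The constant obtained above may be negative; its nonnegative part has the same
    image under \<open>ennreal\<close>.\<close>
  define C where "C = max 0 C'"
  have C0: "0 \<le> C" by (simp add: C_def)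
  have key: "(\<integral>\<^sup>+x\<in>ball x0 (1/2). ennreal ((norm (bilinear_op a f g x))\<^sup>2) \<partial>lborel) \<le> ennreal (C * loc f x0 * loc g x0)"
    if f: "schwartz f" and g: "schwartz g" for f g x0
  proof -
    have "ennreal C' = ennreal C" by (simp add: C_def max_def ennreal_neg)
    moreover have "ennreal (C * loc f x0 * loc g x0) = ennreal C * ennreal (loc f x0) * ennreal (loc g x0)"
      using C0 by (simp add: ennreal_mult loc_nonneg mult_nonneg_nonneg)
    ultimately show ?thesis
      using C'[OF f g, of x0]
      by (simp add: bilinear_op_eq_oscD[OF f g] loc_eq[OF schwartz_rapid[OF f]] loc_eq[OF schwartz_rapid[OF g]])
  qed
  \<comment> \<open>For infinite q the lemma on an infinite exponent is applied to the same operator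
    with f and g exchanged in the bound.\<close>
  have key': "(\<integral>\<^sup>+x\<in>ball x0 (1/2). ennreal ((norm (bilinear_op a f g x))\<^sup>2) \<partial>lborel) \<le> ennreal (C * loc g x0 * loc f x0)"
    if f: "schwartz f" and g: "schwartz g" for f g x0
    using key[OF f g, of x0] by (simp only: mult_ac)
  have T: "bilinear_op a f g \<in> borel_measurable borel" if f: "schwartz f" and g: "schwartz g" for f g
  proof -
    have "(\<lambda>x. oscD x x [] (f, g)) \<in> borel_measurable borel"
      by (rule oscD_measurable_compose) (use f g in auto)
    then show ?thesis by (simp add: bilinear_op_eq_oscD[OF f g, symmetric])
  qed
  have r: "1 \<le> r" "r \<le> 2" using pqr by blast+
  \<comment> \<open>Used when the other exponent is infinite and contributes 0: then q' = r, and 2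
    <= q' together with r <= 2 leaves only the value 2.\<close>
  have two: "q' = 2 \<and> r = 2" if "2 \<le> q'" "inverse q' = ereal (1 / r)" for q' :: ereal
  proof (cases q')
    case (real s)
    have s: "2 \<le> s" using that(1) real by simp
    then have "1 / s = 1 / r" using that(2) real by (simp add: inverse_eq_divide)
    then have "s = r" using s r by simp
    then have "s = 2" "r = 2" using s r by linarith+
    then show ?thesis using real by simp
  next
    case PInf
    then show ?thesis using that(2) r by simp
  next
    case MInf
    then show ?thesis using that(1) by simp
  qed
  show "\<exists>C::real. \<forall>f g. schwartz f \<and> schwartz g \<longrightarrow>
              Lp_norm (ereal r) (bilinear_op a f g) \<le> ennreal C * Lp_norm p f * Lp_norm q g"
  proof -
    let ?\<omega> = "measure lborel (ball (0::real^'n) (1/2))" and ?w = "wmass TYPE(real^'n)"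
    consider "p = \<infinity>" | "q = \<infinity>" | p' q' where "p = ereal p'" "q = ereal q'"
    proof -
      have "p \<noteq> - \<infinity>" "q \<noteq> - \<infinity>" using pqr by auto
      then show ?thesis using that by (cases p; cases q) auto
    qed
    then show ?thesis
    proof cases
      case 1
      then have "q = 2" "r = 2" using two[of q] pqr by auto
      show ?thesis
      proof (rule exI[of _ "(1 / ?\<omega> * C * ?w * ?w) powr (1 / 2)"], intro allI impI, elim conjE)
        fix f g :: "real^'n \<Rightarrow> complex" assume f: "schwartz f" and g: "schwartz g"
        show "Lp_norm (ereal r) (bilinear_op a f g) \<le> ennreal ((1 / ?\<omega> * C * ?w * ?w) powr (1 / 2)) * Lp_norm p f * Lp_norm q g"
          unfolding 1 \<open>q = 2\<close> \<open>r = 2\<close> numeral_eq_ereal[symmetric]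
          by (rule Lp_bound_infinite_exponent[OF T[OF f g] schwartz_rapid[OF f] schwartz_rapid[OF g] key[OF f g] C0])
      qed
    next
      case 2
      then have "p = 2" "r = 2" using two[of p] pqr by auto
      show ?thesis
      proof (rule exI[of _ "(1 / ?\<omega> * C * ?w * ?w) powr (1 / 2)"], intro allI impI, elim conjE)
        fix f g :: "real^'n \<Rightarrow> complex" assume f: "schwartz f" and g: "schwartz g"
        have "Lp_norm 2 (bilinear_op a f g) \<le> ennreal ((1 / ?\<omega> * C * ?w * ?w) powr (1 / 2)) * Lp_norm \<infinity> g * Lp_norm 2 f"
          by (rule Lp_bound_infinite_exponent[OF T[OF f g] schwartz_rapid[OF g] schwartz_rapid[OF f] key'[OF f g] C0])
        then show "Lp_norm (ereal r) (bilinear_op a f g) \<le> ennreal ((1 / ?\<omega> * C * ?w * ?w) powr (1 / 2)) * Lp_norm p f * Lp_norm q g"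
          unfolding 2 \<open>p = 2\<close> \<open>r = 2\<close> numeral_eq_ereal[symmetric] by (simp only: mult_ac)
      qed
    next
      case 3
      have p': "2 \<le> p'" "2 \<le> q'" using pqr 3 by auto
      moreover from this have "1 / p' + 1 / q' = 1 / r" using pqr 3 by (simp add: inverse_eq_divide)
      ultimately show ?thesis
        unfolding 3 using Lp_bound_finite_exponents[OF T schwartz_rapid schwartz_rapid key C0, of _ _ r p' q'] pqr by blast
    qed
  qed
qed

end
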